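(* There is a randomized algorithm that, given $\varepsilon\in(0,1)$ and no knowledge of $n$, either returns a $(1\pm\varepsilon)$-approximation $\widehat{n}$ to $n$, or returns a $(1\pm\varepsilon)$-approximation $\widehat{\rho}$ to $n/d$. It uses $\mathbf{RandVert}$, $\mathbf{RandNbr}$, $\mathbf{Degree}$ and either the $\mathbf{Pair}$ or the $\mathbf{Additive}$ oracle. With the $\mathbf{Pair}$ oracle it makes $O(\varepsilon^{-2}(n/d))$ queries. With the $\mathbf{Additive}$ oracle it makes $O(\varepsilon^{-2}\sqrt{n/d})$ queries.
   Context: $G=(V,E)$ is an unknown simple undirected graph with $n=|V|$ vertices and $m=|E|$ edges, no isolated vertices, and average degree $d=2m/n$. The oracles are: - $\mathbf{RandVert}()$ returns a uniformly random vertex. - $\mathbf{RandNbr}(x)$ returns a uniformly random neighbor of $x$. - $\mathbf{Degree}(x)$ returns $\deg(x)$. - $\mathbf{Pair}(x,y)$ returns whether $\{x,y\}\in E$, at cost $1$. - $\mathbf{Additive}(S)$, for $S\subseteq V$, returns the number of edges with both endpoints in $S$, at cost $|S|$. The other oracles have unit cost. Vertex identifiers reveal nothing about $n$. A $(1\pm\varepsilon)$-approximation to a quantity $Q$ is a value in $[(1-\varepsilon)Q,(1+\varepsilon)Q]$. The guarantee holds with constant probability bounded away from $1/2$, and the query bounds are on expected queries. *)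

theory Defs
  imports "HOL-Probability.Probability"
begin

text \<open>
  Vertex identifiers are natural numbers, and \<open>V\<close> is an arbitrary finite set of them. Guarantees
  are stated for one algorithm and all \<open>V\<close>, hence for adversarially chosen identifiers, so these
  reveal nothing about the number of vertices.
\<close>

locale simple_graph =
  fixes V :: "nat set" and E :: "nat set set"
  assumes finite_V: "finite V"
    and V_nonempty: "V \<noteq> {}"
    and edge_wf: "e \<in> E \<Longrightarrow> \<exists>x y. x \<in> V \<and> y \<in> V \<and> x \<noteq> y \<and> e = {x, y}"

definition nbrs :: "nat set set \<Rightarrow> nat \<Rightarrow> nat set" where
  "nbrs E x = {y. {x, y} \<in> E}"

definition no_isolated_vertices :: "nat set \<Rightarrow> nat set set \<Rightarrow> bool" where
  "no_isolated_vertices V E \<longleftrightarrow> (\<forall>x\<in>V. nbrs E x \<noteq> {})"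

definition degree :: "nat set set \<Rightarrow> nat \<Rightarrow> nat" where
  "degree E x = card (nbrs E x)"

definition avg_degree :: "nat set \<Rightarrow> nat set set \<Rightarrow> real" where
  "avg_degree V E = 2 * real (card E) / real (card V)"

definition induced_edges :: "nat set set \<Rightarrow> nat set \<Rightarrow> nat set set" where
  "induced_edges E S = {e \<in> E. e \<subseteq> S}"

text \<open>
  An algorithm is a possibly infinite decision tree. Each inner node asks an oracle, and the
  subtree continues with the answer; the tree itself does not depend on the graph, so everything
  known about the graph comes from the answers. \<open>Toss\<close> is internal randomness and is free.
  The tree has to be allowed to be infinite because without any bound on the number of vertices
  the number of queries cannot be bounded in advance.
\<close>

codatatype 'r alg =
    Return 'r
  | RandVert "nat \<Rightarrow> 'r alg"
  | RandNbr nat "nat \<Rightarrow> 'r alg"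
  | Degree nat "nat \<Rightarrow> 'r alg"
  | PairQuery nat nat "bool \<Rightarrow> 'r alg"
  | Additive "nat set" "nat \<Rightarrow> 'r alg"
  | Toss "nat pmf" "nat \<Rightarrow> 'r alg"

datatype extra_oracle = Pair_Oracle | Additive_Oracle

text \<open>
  \<open>run ex V E K A\<close> is the joint distribution of the output of \<open>A\<close> and its total query cost, when
  the vertices handed out so far are those in \<open>K\<close>. A vertex identifier may be used in a query
  only after an oracle has returned it, so that membership of other identifiers in \<open>V\<close> cannot be
  tested; other queries, and queries to the extra oracle that is not provided, abort.
  Aborted and nonterminating runs are the missing mass of the subprobability distribution, so
  \<^const>\<open>lossless_spmf\<close> says that neither happens (up to probability zero).
\<close>

partial_function (spmf) run ::
  "extra_oracle \<Rightarrow> nat set \<Rightarrow> nat set set \<Rightarrow> nat set \<Rightarrow> 'r alg \<Rightarrow> ('r \<times> nat) spmf"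
where
  "run ex V E K A = (case A of
     Return r \<Rightarrow> return_spmf (r, 0)
   | RandVert f \<Rightarrow>
       bind_spmf (spmf_of_set V) (\<lambda>v. map_spmf (apsnd ((+) 1)) (run ex V E (insert v K) (f v)))
   | RandNbr x f \<Rightarrow>
       if x \<in> K
       then bind_spmf (spmf_of_set (nbrs E x))
              (\<lambda>y. map_spmf (apsnd ((+) 1)) (run ex V E (insert y K) (f y)))
       else return_pmf None
   | Degree x f \<Rightarrow>
       if x \<in> K then map_spmf (apsnd ((+) 1)) (run ex V E K (f (degree E x)))
       else return_pmf None
   | PairQuery x y f \<Rightarrow>
       if ex = Pair_Oracle \<and> x \<in> K \<and> y \<in> K
       then map_spmf (apsnd ((+) 1)) (run ex V E K (f ({x, y} \<in> E)))
       else return_pmf None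
   | Additive S f \<Rightarrow>
       if ex = Additive_Oracle \<and> S \<subseteq> K
       then map_spmf (apsnd ((+) (card S))) (run ex V E K (f (card (induced_edges E S))))
       else return_pmf None
   | Toss D f \<Rightarrow> bind_spmf (spmf_of_pmf D) (\<lambda>i. run ex V E K (f i)))"

definition execute :: "extra_oracle \<Rightarrow> nat set \<Rightarrow> nat set set \<Rightarrow> 'r alg \<Rightarrow> ('r \<times> nat) spmf" where
  "execute ex V E A = run ex V E {} A"

definition output_prob ::
  "extra_oracle \<Rightarrow> nat set \<Rightarrow> nat set set \<Rightarrow> 'r alg \<Rightarrow> 'r set \<Rightarrow> real" where
  "output_prob ex V E A R = measure (measure_spmf (execute ex V E A)) {(r, c). r \<in> R}"

definition expected_queries ::
  "extra_oracle \<Rightarrow> nat set \<Rightarrow> nat set set \<Rightarrow> 'r alg \<Rightarrow> ennreal" where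
  "expected_queries ex V E A = (\<integral>\<^sup>+ (r, c). of_nat c \<partial>measure_spmf (execute ex V E A))"

datatype estimate = Est_n real | Est_rho real

definition approx :: "real \<Rightarrow> real \<Rightarrow> real set" where
  "approx \<epsilon> Q = {(1 - \<epsilon>) * Q .. (1 + \<epsilon>) * Q}"

definition correct_estimates :: "real \<Rightarrow> nat set \<Rightarrow> nat set set \<Rightarrow> estimate set" where
  "correct_estimates \<epsilon> V E =
     Est_n ` approx \<epsilon> (real (card V)) \<union> Est_rho ` approx \<epsilon> (real (card V) / avg_degree V E)"

end

theory Submission
  imports Defs
begin

text \<open>
  Two uniform random vertices are adjacent with probability \<open>p = d / n\<close>, so \<open>1 / p\<close> can be
  estimated by counting adjacent pairs in samples of doubling size until enough of them are seen;
  with the pair oracle this is already the algorithm. With the additive oracle, the adjacent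
  pairs within \<open>O(\<epsilon>\<^sup>-\<^sup>2)\<close> groups of \<open>r\<close> vertices are counted at cost \<open>O(r)\<close> per group, and
  \<open>r\<close> about \<open>sqrt (n / d)\<close> suffices unless vertices of degree above \<open>n / r\<close> spoil the variance.
  If such heavy vertices carry more than a small fraction of the edges, a random neighbour of
  one of the sampled vertices is heavy with high probability. For a heavy vertex \<open>h\<close> the
  probability \<open>deg h / n\<close> that a random vertex is adjacent to \<open>h\<close> can be estimated within the
  cost bound, and this gives \<open>n\<close>. Otherwise the light edges alone determine \<open>n / d\<close> up to the
  allowed error.

  Each round tests the vertex of largest degree seen. If it looks heavy, the algorithm commits to
  estimating \<open>n\<close> from it. This estimate has a fresh and unbounded budget, so that its error
  probability is small whichever vertex was chosen and does not accumulate over the rounds.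
\<close>

section \<open>Loops of finite programs\<close>

text \<open>The number of rounds is unbounded, so error and cost are carried by potentials of the
  state: what a round contributes plus the expected potential of the next state must not exceed the
  present potential. The threshold n / r for heaviness, with r about sqrt (n / d), balances two
  demands. If all adjacency probabilities are at most 1 / r, pairs of counted edges that share an
  endpoint contribute about r^3 * p / r to the variance of a group, which is of the order of the
  mean r^2 * p. A vertex of degree at least n / r is adjacent to enough of O(\<epsilon>^-2 * r)
  random vertices to be recognised. A commitment never endangers correctness, only cost: a vertex of
  degree \<delta> makes the later estimation cost about n / \<delta>, but a premature test succeeds
  with probability proportional to r * \<delta> / n, so the expected expense is proportional to the
  cost of the round. With G at least 2^24 / \<epsilon>^2, every deviation event in a round of ratio
  t has probability at most \<beta> / t for a small \<beta>. Rounds with t below 1/128 are too small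
  for such bounds; there Markov's inequality gives 4 * t, which sums to at most 1/16 over the
  doubling ratios.\<close>

lemma nn_integral_lub_spmf:
  assumes chain: "Complete_Partial_Order.chain (ord_spmf (=)) Y" and "Y \<noteq> {}"
  shows "(\<integral>\<^sup>+ x. g x \<partial>measure_spmf (lub_spmf Y)) = (SUP p\<in>Y. \<integral>\<^sup>+ x. g x \<partial>measure_spmf p)"
proof -
  let ?B = "set_spmf (lub_spmf Y)"
  have sub: "set_spmf p \<subseteq> ?B" if "p \<in> Y" for p
    using that by (auto simp: set_lub_spmf[OF chain])
  have "(\<integral>\<^sup>+ x. g x \<partial>measure_spmf (lub_spmf Y))
      = (\<integral>\<^sup>+ x. (SUP p\<in>Y. ennreal (spmf p x) * g x) \<partial>count_space ?B)"
    by (simp add: nn_integral_measure_spmf' ennreal_spmf_lub_spmf[OF chain \<open>Y \<noteq> {}\<close>] SUP_mult_right_ennreal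
        \<open>Y \<noteq> {}\<close>)
  \<comment> \<open>Monotone convergence is available along an arbitrary chain, not only along a
    sequence, because the support of the limit is countable.\<close>
  also have "\<dots> = (SUP p\<in>Y. \<integral>\<^sup>+ x. ennreal (spmf p x) * g x \<partial>count_space ?B)"
  proof (rule nn_integral_monotone_convergence_SUP_countable)
    show "Complete_Partial_Order.chain (\<le>) ((\<lambda>i x. ennreal (spmf i x) * g x) ` Y)"
      using chain by (rule chain_imageI) (auto simp: le_fun_def intro!: mult_right_mono ennreal_leI dest: ord_spmf_eq_leD)
  qed (use \<open>Y \<noteq> {}\<close> in simp_all)
  also have "\<dots> = (SUP p\<in>Y. \<integral>\<^sup>+ x. g x \<partial>measure_spmf p)"
  proof (intro SUP_cong refl)
    fix p assume "p \<in> Y"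
    show "(\<integral>\<^sup>+ x. ennreal (spmf p x) * g x \<partial>count_space ?B) = (\<integral>\<^sup>+ x. g x \<partial>measure_spmf p)"
      using sub[OF \<open>p \<in> Y\<close>]
      by (auto simp: nn_integral_measure_spmf nn_integral_count_space_indicator spmf_eq_0_set_spmf
          intro!: nn_integral_cong split: split_indicator)
  qed
  finally show ?thesis .
qed

lemma mcont_nn_integral_spmf:
  "mcont lub_spmf (ord_spmf (=)) Sup (\<le>) (\<lambda>p. \<integral>\<^sup>+ x. g x \<partial>measure_spmf p)"
proof (rule mcontI)
  show "monotone (ord_spmf (=)) (\<le>) (\<lambda>p. \<integral>\<^sup>+ x. g x \<partial>measure_spmf p)"
    by (rule monotoneI)
      (auto simp: nn_integral_measure_spmf intro!: nn_integral_mono mult_right_mono ennreal_leI dest: ord_spmf_eq_leD)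
  show "cont lub_spmf (ord_spmf (=)) Sup (\<le>) (\<lambda>p. \<integral>\<^sup>+ x. g x \<partial>measure_spmf p)"
    by (rule contI) (rule nn_integral_lub_spmf)
qed

text \<open>\<open>run\<close> is a least fixed point, and upper bounds on an integral survive
  suprema of chains, so they can be proved by fixed point induction. Lower bounds do not survive in
  the same way, hence the separate argument for losslessness.\<close>

lemma admissible_nn_integral_spmf_le:
  assumes "mcont lub ord lub_spmf (ord_spmf (=)) f"
  shows "ccpo.admissible lub ord (\<lambda>x. (\<integral>\<^sup>+ y. g y \<partial>measure_spmf (f x)) \<le> B)"
proof -
  have 1: "mcont lub ord Sup (\<le>) (\<lambda>x. \<integral>\<^sup>+ y. g y \<partial>measure_spmf (f x))"
    by (rule ccpo.mcont2mcont[OF complete_lattice_ccpo mcont_nn_integral_spmf assms])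
  show ?thesis
    by (rule admissible_leI[OF complete_lattice_ccpo' 1]) (simp add: mcont_const)
qed

lemma nn_integral_bind_spmf:
  "(\<integral>\<^sup>+ y. g y \<partial>measure_spmf (bind_spmf p f)) = (\<integral>\<^sup>+ x. \<integral>\<^sup>+ y. g y \<partial>measure_spmf (f x) \<partial>measure_spmf p)"
  by (simp add: measure_spmf_bind o_def nn_integral_bind[where B="count_space UNIV"] space_measure_spmf
      measure_spmf.subprob_space_axioms space_subprob_algebra)

lemma nn_integral_bind_pmf_spmf:
  "(\<integral>\<^sup>+ y. g y \<partial>measure_spmf (bind_pmf p f)) = (\<integral>\<^sup>+ x. \<integral>\<^sup>+ y. g y \<partial>measure_spmf (f x) \<partial>measure_pmf p)"
  using nn_integral_bind_spmf[of "spmf_of_pmf p" f g] by (simp add: measure_spmf_spmf_of_pmf)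

lemma pmf_map_spmf_None: "pmf (map_spmf f p) None = pmf p None"
  by (simp add: pmf_None_eq_weight_spmf)

section \<open>Finite query programs and their infinite iteration\<close>

text \<open>The body of a round is a well-founded tree, so that outcome, expected cost and legality
  can be defined by structural recursion. Infinite behaviour enters only through
  \<open>loop\<close>, whose body returns a new state as \<open>Inl\<close> or the answer as
  \<open>Inr\<close>.\<close>

datatype (discs_sels) 'a prog =
    Ret 'a
  | Vert "nat \<Rightarrow> 'a prog"
  | Nbr nat "nat \<Rightarrow> 'a prog"
  | Deg nat "nat \<Rightarrow> 'a prog"
  | Ask nat nat "bool \<Rightarrow> 'a prog"
  | Count "nat set" "nat \<Rightarrow> 'a prog"

primrec bind_prog :: "'a prog \<Rightarrow> ('a \<Rightarrow> 'b prog) \<Rightarrow> 'b prog" where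
  "bind_prog (Ret x) k = k x"
| "bind_prog (Vert f) k = Vert (\<lambda>v. bind_prog (f v) k)"
| "bind_prog (Nbr x f) k = Nbr x (\<lambda>v. bind_prog (f v) k)"
| "bind_prog (Deg x f) k = Deg x (\<lambda>v. bind_prog (f v) k)"
| "bind_prog (Ask x y f) k = Ask x y (\<lambda>v. bind_prog (f v) k)"
| "bind_prog (Count S f) k = Count S (\<lambda>v. bind_prog (f v) k)"

adhoc_overloading Monad_Syntax.bind \<rightleftharpoons> bind_prog

text \<open>The free \<open>Toss\<close> is there only to guard the corecursive call.\<close>

primcorec loop :: "('s \<Rightarrow> ('s + 'r) prog) \<Rightarrow> ('s + 'r) prog \<Rightarrow> 'r alg" where
  "loop body t = (case t of
     Ret x \<Rightarrow> if isl x then Toss (return_pmf 0) (\<lambda>_. loop body (body (projl x))) else Return (projr x)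
   | Vert f \<Rightarrow> RandVert (\<lambda>v. loop body (f v))
   | Nbr x f \<Rightarrow> RandNbr x (\<lambda>v. loop body (f v))
   | Deg x f \<Rightarrow> Degree x (\<lambda>v. loop body (f v))
   | Ask x y f \<Rightarrow> PairQuery x y (\<lambda>v. loop body (f v))
   | Count S f \<Rightarrow> Additive S (\<lambda>v. loop body (f v)))"

lemma loop_simps:
  "loop body (Ret (Inl s)) = Toss (return_pmf 0) (\<lambda>_. loop body (body s))"
  "loop body (Ret (Inr r)) = Return r"
  "loop body (Vert f) = RandVert (\<lambda>v. loop body (f v))"
  "loop body (Nbr x f) = RandNbr x (\<lambda>v. loop body (f v))"
  "loop body (Deg x g) = Degree x (\<lambda>v. loop body (g v))"
  "loop body (Ask x y h) = PairQuery x y (\<lambda>v. loop body (h v))"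
  "loop body (Count S g) = Additive S (\<lambda>v. loop body (g v))"
  by (subst loop.code; simp)+

section \<open>Outcome, cost and legality of programs on a fixed graph, and rules for loops\<close>

locale graph = simple_graph +
  assumes no_isolated: "no_isolated_vertices V E"
begin

lemma nbrs_subset: "nbrs E x \<subseteq> V"
  using edge_wf by (fastforce simp: nbrs_def doubleton_eq_iff)

lemma finite_nbrs [simp]: "finite (nbrs E x)"
  using nbrs_subset finite_V finite_subset by blast

lemma nbrs_nonempty: "x \<in> V \<Longrightarrow> nbrs E x \<noteq> {}"
  using no_isolated by (simp add: no_isolated_vertices_def)

text \<open>The set of known vertices does not occur in \<open>result\<close> and
  \<open>ecost\<close>, so probability calculations need not carry it. That the queries are legal is
  tracked by \<open>ok\<close> alone.\<close>

primrec result :: "'a prog \<Rightarrow> 'a pmf" where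
  "result (Ret x) = return_pmf x"
| "result (Vert f) = bind_pmf (pmf_of_set V) (\<lambda>v. result (f v))"
| "result (Nbr x f) = bind_pmf (pmf_of_set (nbrs E x)) (\<lambda>v. result (f v))"
| "result (Deg x f) = result (f (degree E x))"
| "result (Ask x y f) = result (f ({x, y} \<in> E))"
| "result (Count S f) = result (f (card (induced_edges E S)))"

primrec ecost :: "'a prog \<Rightarrow> ennreal" where
  "ecost (Ret x) = 0"
| "ecost (Vert f) = 1 + (\<integral>\<^sup>+ v. ecost (f v) \<partial>pmf_of_set V)"
| "ecost (Nbr x f) = 1 + (\<integral>\<^sup>+ v. ecost (f v) \<partial>pmf_of_set (nbrs E x))"
| "ecost (Deg x f) = 1 + ecost (f (degree E x))"
| "ecost (Ask x y f) = 1 + ecost (f ({x, y} \<in> E))"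
| "ecost (Count S f) = of_nat (card S) + ecost (f (card (induced_edges E S)))"

text \<open>A weakest precondition. The postcondition sees the known vertices because a later round
  may query a vertex found earlier. The condition \<open>x \<in> V\<close> at \<open>Nbr\<close>
  makes the set of neighbours nonempty.\<close>

primrec ok :: "extra_oracle \<Rightarrow> nat set \<Rightarrow> 'a prog \<Rightarrow> (nat set \<Rightarrow> 'a \<Rightarrow> bool) \<Rightarrow> bool" where
  "ok ex K (Ret x) Q = Q K x"
| "ok ex K (Vert f) Q = (\<forall>v\<in>V. ok ex (insert v K) (f v) Q)"
| "ok ex K (Nbr x f) Q = (x \<in> K \<and> x \<in> V \<and> (\<forall>y\<in>nbrs E x. ok ex (insert y K) (f y) Q))"
| "ok ex K (Deg x f) Q = (x \<in> K \<and> ok ex K (f (degree E x)) Q)"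
| "ok ex K (Ask x y f) Q = (ex = Pair_Oracle \<and> x \<in> K \<and> y \<in> K \<and> ok ex K (f ({x, y} \<in> E)) Q)"
| "ok ex K (Count S f) Q =
     (ex = Additive_Oracle \<and> S \<subseteq> K \<and> ok ex K (f (card (induced_edges E S))) Q)"

lemma result_bind: "result (bind_prog t k) = bind_pmf (result t) (\<lambda>x. result (k x))"
  by (induction t) (simp_all add: bind_return_pmf bind_assoc_pmf)

lemma ecost_bind: "ecost (bind_prog t k) = ecost t + (\<integral>\<^sup>+ x. ecost (k x) \<partial>result t)"
  by (induction t) (simp_all add: nn_integral_add add.assoc)

lemma ok_bind: "ok ex K (bind_prog t k) Q = ok ex K t (\<lambda>K' x. ok ex K' (k x) Q)"
  by (induction t arbitrary: K) simp_all

lemma ok_mono: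
  assumes "ok ex K t P" "\<And>K' x. K \<subseteq> K' \<Longrightarrow> P K' x \<Longrightarrow> Q K' x"
  shows "ok ex K t Q"
  using assms
proof (induction t arbitrary: K)
  case (Vert f)
  have "ok ex (insert v K) (f v) Q" if "v \<in> V" for v
    by (rule Vert.IH) (use Vert.prems that in auto)
  then show ?case by simp
next
  case (Nbr x f)
  have "ok ex (insert v K) (f v) Q" if "v \<in> nbrs E x" for v
    by (rule Nbr.IH) (use Nbr.prems that in auto)
  then show ?case using Nbr.prems by simp
qed auto

abbreviation expect_next :: "('s \<Rightarrow> ennreal) \<Rightarrow> ('r \<Rightarrow> ennreal) \<Rightarrow> ('s + 'r) prog \<Rightarrow> ennreal" where
  "expect_next F g t \<equiv> \<integral>\<^sup>+ x. case_sum F g x \<partial>result t"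

abbreviation loop_ok :: "extra_oracle \<Rightarrow> (nat set \<Rightarrow> 's \<Rightarrow> bool) \<Rightarrow> nat set \<Rightarrow> ('s + 'r) prog \<Rightarrow> bool" where
  "loop_ok ex I K t \<equiv> ok ex K t (\<lambda>K'. case_sum (I K') (\<lambda>_. True))"

lemma spmf_of_set_V: "spmf_of_set V = spmf_of_pmf (pmf_of_set V)"
  using finite_V V_nonempty by (simp add: spmf_of_pmf_pmf_of_set)

lemma spmf_of_set_nbrs: "x \<in> V \<Longrightarrow> spmf_of_set (nbrs E x) = spmf_of_pmf (pmf_of_set (nbrs E x))"
  using nbrs_nonempty by (simp add: spmf_of_pmf_pmf_of_set)



text \<open>A supermartingale argument with potential \<open>\<Phi>\<close>. The choice
  \<open>a = 1\<close>, \<open>g = 0\<close> bounds the expected cost; \<open>a = 0\<close> with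
  \<open>g\<close> an indicator bounds the probability of a wrong output.\<close>

lemma run_loop_le:
  fixes \<Phi> :: "'s \<Rightarrow> ennreal" and g :: "'r \<Rightarrow> ennreal" and body :: "'s \<Rightarrow> ('s + 'r) prog"
  assumes step: "\<And>K s. I K s \<Longrightarrow> loop_ok ex I K (body s)"
    and le: "\<And>K s. I K s \<Longrightarrow> a * ecost (body s) + expect_next \<Phi> g (body s) \<le> \<Phi> s"
    and "loop_ok ex I K t"
  shows "(\<integral>\<^sup>+ x. (case x of (r, c) \<Rightarrow> a * of_nat c + g r) \<partial>measure_spmf (run ex V E K (loop body t)))
       \<le> a * ecost t + expect_next \<Phi> g t"
proof -
  let ?g = "\<lambda>x. case x of (r, c :: nat) \<Rightarrow> a * of_nat c + g r"
  have shift: "(\<integral>\<^sup>+ x. ?g x \<partial>measure_spmf (map_spmf (apsnd ((+) k)) p)) \<le> a * of_nat k + B"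
    if "(\<integral>\<^sup>+ x. ?g x \<partial>measure_spmf p) \<le> B" for k p B
  proof -
    have "(\<integral>\<^sup>+ x. ?g x \<partial>measure_spmf (map_spmf (apsnd ((+) k)) p))
        = (\<integral>\<^sup>+ x. a * of_nat k + ?g x \<partial>measure_spmf p)"
      by (auto intro!: nn_integral_cong simp: distrib_left add.assoc)
    also have "\<dots> = a * of_nat k * emeasure (measure_spmf p) UNIV + (\<integral>\<^sup>+ x. ?g x \<partial>measure_spmf p)"
      by (simp add: nn_integral_add space_measure_spmf)
    \<comment> \<open>A run has mass at most 1; charging the query to lost mass as well only
      enlarges the bound.\<close>
    also have "\<dots> \<le> a * of_nat k * 1 + B"
      using that measure_spmf.subprob_emeasure_le_1[of p UNIV] by (intro add_mono mult_left_mono) auto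
    finally show ?thesis by simp
  qed
  have "\<forall>K t. loop_ok ex I K t \<longrightarrow>
      (\<integral>\<^sup>+ x. ?g x \<partial>measure_spmf (run ex V E K (loop body t))) \<le> a * ecost t + expect_next \<Phi> g t"
  proof (induction rule: run.fixp_induct)
    case 1
    show ?case
      by (intro admissible_all admissible_imp admissible_nn_integral_spmf_le) (simp_all add: curry_def cont_intro)
  next
    case 2
    show ?case by simp
  next
    case (3 R)
    show ?case
    proof (intro allI impI)
      fix K and t :: "('s + 'r) prog"
      assume ok: "loop_ok ex I K t"
      have IH: "(\<integral>\<^sup>+ x. ?g x \<partial>measure_spmf (R ex V E K (loop body t))) \<le> a * ecost t + expect_next \<Phi> g t"
        if "loop_ok ex I K t" for K t
        using 3 that by blast
      show "(\<integral>\<^sup>+ x. ?g x \<partial>measure_spmf (case loop body t of Return r \<Rightarrow> return_spmf (r, 0)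
              | RandVert f \<Rightarrow> spmf_of_set V \<bind> (\<lambda>v. map_spmf (apsnd ((+) 1)) (R ex V E (insert v K) (f v)))
              | RandNbr x f \<Rightarrow>
                  if x \<in> K
                  then spmf_of_set (nbrs E x) \<bind> (\<lambda>y. map_spmf (apsnd ((+) 1)) (R ex V E (insert y K) (f y)))
                  else return_pmf None
              | Degree x f \<Rightarrow>
                  if x \<in> K then map_spmf (apsnd ((+) 1)) (R ex V E K (f (Defs.degree E x))) else return_pmf None
              | PairQuery x y f \<Rightarrow>
                  if ex = Pair_Oracle \<and> x \<in> K \<and> y \<in> K
                  then map_spmf (apsnd ((+) 1)) (R ex V E K (f ({x, y} \<in> E))) else return_pmf None
              | Additive S f \<Rightarrow>
                  if ex = Additive_Oracle \<and> S \<subseteq> K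
                  then map_spmf (apsnd ((+) (card S))) (R ex V E K (f (card (induced_edges E S))))
                  else return_pmf None
              | Toss D f \<Rightarrow> spmf_of_pmf D \<bind> (\<lambda>i. R ex V E K (f i))))
            \<le> a * ecost t + expect_next \<Phi> g t"
      proof (cases t)
        case (Ret x)
        show ?thesis
        proof (cases x)
          case (Inl s)
          \<comment> \<open>The head of the loop is the only place where the potential inequality is
            used: it turns the bound for the body into \<open>\<Phi> s\<close>.\<close>
          have "I K s" using ok Ret Inl by simp
          then show ?thesis
            using order_trans[OF IH[OF step] le, of K s] by (simp add: Ret Inl loop_simps bind_return_pmf)
        next
          case (Inr r)
          then show ?thesis by (simp add: Ret loop_simps measure_spmf_return_spmf nn_integral_return)
        qed
      next
        case (Vert f)
        have "(\<integral>\<^sup>+ v. \<integral>\<^sup>+ x. ?g x \<partial>measure_spmf (map_spmf (apsnd ((+) 1)) (R ex V E (insert v K) (loop body (f v)))) \<partial>pmf_of_set V)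
           \<le> (\<integral>\<^sup>+ v. a * of_nat 1 + (a * ecost (f v) + expect_next \<Phi> g (f v)) \<partial>pmf_of_set V)"
          using ok Vert finite_V V_nonempty
          by (intro nn_integral_mono_AE AE_pmfI shift IH) auto
        then show ?thesis
          by (simp add: Vert loop_simps spmf_of_set_V nn_integral_bind_pmf_spmf
              nn_integral_add nn_integral_cmult distrib_left add.assoc del: spmf_of_pmf_pmf_of_set nn_integral_map_spmf)
      next
        case (Nbr y f)
        then have y: "y \<in> V" using ok by simp
        have "(\<integral>\<^sup>+ v. \<integral>\<^sup>+ x. ?g x \<partial>measure_spmf (map_spmf (apsnd ((+) 1)) (R ex V E (insert v K) (loop body (f v)))) \<partial>pmf_of_set (nbrs E y))
           \<le> (\<integral>\<^sup>+ v. a * of_nat 1 + (a * ecost (f v) + expect_next \<Phi> g (f v)) \<partial>pmf_of_set (nbrs E y))"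
          using ok Nbr nbrs_nonempty[OF y]
          by (intro nn_integral_mono_AE AE_pmfI shift IH) auto
        then show ?thesis using ok
          by (simp add: Nbr loop_simps spmf_of_set_nbrs[OF y] nn_integral_bind_pmf_spmf
              nn_integral_add nn_integral_cmult distrib_left add.assoc del: spmf_of_pmf_pmf_of_set nn_integral_map_spmf)
      next
        case (Deg y f)
        then show ?thesis using ok shift[OF IH, of K "f (Defs.degree E y)" 1]
          by (simp add: loop_simps distrib_left add.assoc)
      next
        case (Ask y z f)
        then have "loop_ok ex I K (f ({y, z} \<in> E))" using ok by auto
        from shift[OF IH[OF this], of 1] show ?thesis using ok Ask
          by (simp add: loop_simps distrib_left add.assoc)
      next
        case (Count S f)
        then have "loop_ok ex I K (f (card (induced_edges E S)))" using ok by auto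
        from shift[OF IH[OF this], of "card S"] show ?thesis using ok Count
          by (simp add: loop_simps distrib_left add.assoc)
      qed
    qed
  qed
  then show ?thesis using \<open>loop_ok ex I K t\<close> by blast
qed


text \<open>Within one round nothing is lost by itself: legal queries have answers and the tree is
  finite, so all missing mass comes from the states in which the round ends.\<close>

lemma pmf_run_loop_None_le:
  fixes d :: "'s \<Rightarrow> ennreal" and body :: "'s \<Rightarrow> ('s + 'r) prog"
  assumes d: "\<And>K s. I K s \<Longrightarrow> pmf (run ex V E K (loop body (Ret (Inl s)))) None \<le> d s"
    and "loop_ok ex I K t"
  shows "pmf (run ex V E K (loop body t)) None \<le> expect_next d (\<lambda>_. 0) t"
  using assms(2)
proof (induction t arbitrary: K)
  case (Ret x)
  show ?case
  proof (cases x)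
    case (Inl s)
    then show ?thesis using Ret d by simp
  next
    case (Inr r)
    then show ?thesis unfolding Ret by (subst run.simps) (simp add: loop_simps)
  qed
next
  case (Vert f)
  have "(\<integral>\<^sup>+ v. pmf (run ex V E (insert v K) (loop body (f v))) None \<partial>pmf_of_set V)
      \<le> (\<integral>\<^sup>+ v. expect_next d (\<lambda>_. 0) (f v) \<partial>pmf_of_set V)"
    using Vert.prems finite_V V_nonempty by (intro nn_integral_mono_AE AE_pmfI Vert.IH) auto
  then show ?case
    by (subst run.simps) (simp add: loop_simps spmf_of_set_V ennreal_pmf_bind pmf_map_spmf_None
        del: spmf_of_pmf_pmf_of_set)
next
  case (Nbr y f)
  then have y: "y \<in> V" "y \<in> K" by auto
  have "(\<integral>\<^sup>+ v. pmf (run ex V E (insert v K) (loop body (f v))) None \<partial>pmf_of_set (nbrs E y))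
      \<le> (\<integral>\<^sup>+ v. expect_next d (\<lambda>_. 0) (f v) \<partial>pmf_of_set (nbrs E y))"
    using Nbr.prems nbrs_nonempty[OF y(1)] by (intro nn_integral_mono_AE AE_pmfI Nbr.IH) auto
  then show ?case using y
    by (subst run.simps) (simp add: loop_simps spmf_of_set_nbrs ennreal_pmf_bind pmf_map_spmf_None
        del: spmf_of_pmf_pmf_of_set)
next
  case (Deg y f)
  then show ?case by (subst run.simps) (simp add: loop_simps pmf_map_spmf_None)
next
  case (Ask y z f)
  from Ask.prems have "loop_ok ex I K (f ({y, z} \<in> E))" "ex = Pair_Oracle \<and> y \<in> K \<and> z \<in> K"
    by auto
  then show ?case using Ask.IH[OF rangeI, of K "{y, z} \<in> E"]
    by (subst run.simps) (auto simp: loop_simps pmf_map_spmf_None)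
next
  case (Count S f)
  from Count.prems have "loop_ok ex I K (f (card (induced_edges E S)))" "ex = Additive_Oracle \<and> S \<subseteq> K"
    by auto
  then show ?case using Count.IH[OF rangeI, of K "card (induced_edges E S)"]
    by (subst run.simps) (auto simp: loop_simps pmf_map_spmf_None)
qed

text \<open>Each round costs at least 1, so lost mass would pay for arbitrarily many rounds: by
  induction, \<open>n\<close> times the lost mass is at most the potential, for every
  \<open>n\<close>. A finite potential therefore leaves no lost mass.\<close>

lemma run_loop_lossless:
  fixes \<Phi> :: "'s \<Rightarrow> ennreal" and body :: "'s \<Rightarrow> ('s + 'r) prog"
  assumes step: "\<And>K s. I K s \<Longrightarrow> loop_ok ex I K (body s)"
    and le: "\<And>K s. I K s \<Longrightarrow> ecost (body s) + expect_next \<Phi> (\<lambda>_. 0) (body s) \<le> \<Phi> s"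
    and pos: "\<And>K s. I K s \<Longrightarrow> 1 \<le> ecost (body s)"
    and "I K s" and fin: "\<Phi> s < \<top>"
  shows "lossless_spmf (run ex V E K (loop body (Ret (Inl s))))"
proof -
  let ?p = "\<lambda>K s. pmf (run ex V E K (loop body (Ret (Inl s)))) None"
  have bound: "of_nat n * ennreal (?p K s) \<le> \<Phi> s" if "I K s" for n K s
    using that
  proof (induction n arbitrary: K s)
    case (Suc n)
    have *: "?p K s = pmf (run ex V E K (loop body (body s))) None"
      by (subst run.simps) (simp add: loop_simps bind_return_pmf)
    have "of_nat n * ennreal (?p K s) \<le> expect_next \<Phi> (\<lambda>_. 0) (body s)"
    proof (cases "n = 0")
      case False
      then have n: "0 < (of_nat n :: ennreal)" "(of_nat n :: ennreal) < \<top>"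
        by (auto simp: of_nat_less_top)
      \<comment> \<open>The induction hypothesis, divided by \<open>n\<close>, bounds the loss at
        each possible next state.\<close>
      have "ennreal (?p K s) \<le> expect_next (\<lambda>s. \<Phi> s / of_nat n) (\<lambda>_. 0) (body s)"
        unfolding * 
      proof (rule pmf_run_loop_None_le[OF _ step[OF Suc.prems]])
        fix K s assume "I K s"
        from Suc.IH[OF this] n show "ennreal (?p K s) \<le> \<Phi> s / of_nat n"
          by (metis divide_less_ennreal mult.commute not_less less_irrefl)
      qed
      also have "\<dots> = (\<integral>\<^sup>+ x. case_sum \<Phi> (\<lambda>_. 0) x / of_nat n \<partial>result (body s))"
        by (intro nn_integral_cong) (auto split: sum.split)
      also have "\<dots> = expect_next \<Phi> (\<lambda>_. 0) (body s) / of_nat n"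
        by (simp add: nn_integral_divide)
      finally show ?thesis using n
        by (metis divide_less_ennreal mult.commute not_less less_irrefl)
    qed simp
    moreover have "ennreal (?p K s) \<le> ecost (body s)"
      using pos[OF Suc.prems] by (rule order_trans[rotated]) (simp add: pmf_le_1)
    ultimately have "of_nat (Suc n) * ennreal (?p K s) \<le> ecost (body s) + expect_next \<Phi> (\<lambda>_. 0) (body s)"
      by (simp add: distrib_right add_mono)
    then show ?case using le[OF Suc.prems] by (rule order_trans)
  qed simp
  obtain B where B: "\<Phi> s = ennreal B" "B \<ge> 0" using fin by (cases "\<Phi> s") auto
  have "real n * ?p K s \<le> B" for n
    using bound[OF \<open>I K s\<close>, of n] B by (simp add: ennreal_of_nat_eq_real_of_nat flip: ennreal_mult)
  then have "?p K s = 0"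
    by (metis pmf_nonneg ex_less_of_nat_mult leD less_eq_real_def)
  then show ?thesis
    by (simp add: lossless_iff_pmf_None)
qed

end

section \<open>Moments of independent samples\<close>

abbreviation expec :: "'a pmf \<Rightarrow> ('a \<Rightarrow> real) \<Rightarrow> real" where
  "expec \<equiv> measure_pmf.expectation"

text \<open>All distributions sampled by a round have finite support, so expectations reduce to
  finite sums and integrability is never an issue.\<close>

lemma expec_finite: "finite (set_pmf p) \<Longrightarrow> expec p f = (\<Sum>x\<in>set_pmf p. pmf p x * f x)"
  by (subst integral_measure_pmf[of "set_pmf p"]) (auto simp: set_pmf_iff)

lemma expec_bind:
  assumes "finite (set_pmf p)" "\<And>x. x \<in> set_pmf p \<Longrightarrow> finite (set_pmf (f x))"
  shows "expec (bind_pmf p f) h = expec p (\<lambda>x. expec (f x) h)"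
  using assms by (subst pmf_expectation_bind[of "set_pmf p"]) (auto simp: expec_finite)

lemma expec_swap:
  assumes "finite (set_pmf p)" "finite (set_pmf q)"
  shows "expec p (\<lambda>x. expec q (\<lambda>y. h x y)) = expec q (\<lambda>y. expec p (\<lambda>x. h x y))"
  using assms by (simp add: expec_finite sum_distrib_left mult.left_commute sum.swap[of _ "set_pmf p"])

lemma expec_add:
  "finite (set_pmf p) \<Longrightarrow> expec p (\<lambda>x. f x + g x) = expec p f + expec p g"
  by (simp add: expec_finite distrib_left sum.distrib)

lemma expec_const: "expec p (\<lambda>x. c) = c"
  by simp

lemma expec_cmult: "expec p (\<lambda>x. c * f x) = c * expec p f"
  by simp

lemma expec_sum_list:
  "finite (set_pmf p) \<Longrightarrow> expec p (\<lambda>y. \<Sum>x\<leftarrow>xs. f x y) = (\<Sum>x\<leftarrow>xs. expec p (f x))"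
  by (induction xs) (simp_all add: expec_add)

lemma expec_mono:
  assumes "finite (set_pmf p)" "\<And>x. x \<in> set_pmf p \<Longrightarrow> f x \<le> g x"
  shows "expec p f \<le> expec p g"
  using assms by (auto simp: expec_finite intro!: sum_mono mult_left_mono)

lemma finite_replicate_pmf: "finite (set_pmf p) \<Longrightarrow> finite (set_pmf (replicate_pmf n p))"
  by (simp add: set_replicate_pmf lists_eq_set finite_lists_length_eq)

lemma expec_replicate_Suc:
  assumes "finite (set_pmf p)"
  shows "expec (replicate_pmf (Suc n) p) h = expec p (\<lambda>x. expec (replicate_pmf n p) (\<lambda>xs. h (x # xs)))"
  using assms finite_replicate_pmf[OF assms]
  by (simp add: expec_bind)

lemma expec_replicate_sum:
  assumes "finite (set_pmf p)"
  shows "expec (replicate_pmf n p) (\<lambda>xs. \<Sum>x\<leftarrow>xs. f x) = real n * expec p f"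
proof (induction n)
  case (Suc n)
  then show ?case using assms finite_replicate_pmf[OF assms]
    by (simp add: expec_replicate_Suc expec_add algebra_simps del: replicate_pmf.simps)
qed simp

lemma expec_replicate_sum_square:
  assumes "finite (set_pmf p)"
  shows "expec (replicate_pmf n p) (\<lambda>xs. (\<Sum>x\<leftarrow>xs. f x)\<^sup>2)
       = real n * expec p (\<lambda>x. (f x)\<^sup>2) + real n * (real n - 1) * (expec p f)\<^sup>2"
proof (induction n)
  case (Suc n)
  let ?S = "\<lambda>xs. \<Sum>x\<leftarrow>xs. f x"
  have "expec (replicate_pmf (Suc n) p) (\<lambda>xs. (?S xs)\<^sup>2)
      = expec p (\<lambda>x. expec (replicate_pmf n p) (\<lambda>xs. (f x)\<^sup>2 + (2 * f x * ?S xs + (?S xs)\<^sup>2)))"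
    using assms by (simp add: expec_replicate_Suc power2_sum algebra_simps del: replicate_pmf.simps)
  also have "\<dots> = expec p (\<lambda>x. (f x)\<^sup>2 + ((2 * real n * expec p f) * f x +
      (real n * expec p (\<lambda>x. (f x)\<^sup>2) + real n * (real n - 1) * (expec p f)\<^sup>2)))"
    using finite_replicate_pmf[OF assms]
    by (simp add: expec_add Suc.IH expec_replicate_sum[OF assms] mult_ac)
  also have "\<dots> = real (Suc n) * expec p (\<lambda>x. (f x)\<^sup>2) + real (Suc n) * (real (Suc n) - 1) * (expec p f)\<^sup>2"
    using assms by (simp add: expec_add) (simp add: algebra_simps power2_eq_square)
  finally show ?case .
qed simp

lemma markov_finite:
  assumes fin: "finite (set_pmf p)" and nn: "\<And>x. x \<in> set_pmf p \<Longrightarrow> 0 \<le> f x" and "0 < a"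
    and "\<And>x. x \<in> set_pmf p \<Longrightarrow> x \<in> A \<Longrightarrow> a \<le> f x"
  shows "measure_pmf.prob p A \<le> expec p f / a"
proof -
  have "a * measure_pmf.prob p A = expec p (\<lambda>x. a * indicator A x)"
    by (simp add: measure_pmf.emeasure_eq_measure)
  also have "\<dots> \<le> expec p f"
    using assms by (intro expec_mono fin) (auto simp: indicator_def)
  finally show ?thesis using \<open>0 < a\<close> by (simp add: field_simps)
qed

lemma chebyshev_replicate:
  assumes fin: "finite (set_pmf p)" and "0 < a"
    and var: "expec p (\<lambda>x. (f x)\<^sup>2) - (expec p f)\<^sup>2 \<le> v"
  shows "measure_pmf.prob (replicate_pmf n p) {xs. a \<le> \<bar>(\<Sum>x\<leftarrow>xs. f x) - real n * expec p f\<bar>}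
       \<le> real n * v / a\<^sup>2"
proof -
  let ?S = "\<lambda>xs. \<Sum>x\<leftarrow>xs. f x" and ?m = "real n * expec p f" and ?R = "replicate_pmf n p"
  have "measure_pmf.prob ?R {xs. a \<le> \<bar>?S xs - ?m\<bar>} \<le> expec ?R (\<lambda>xs. (?S xs - ?m)\<^sup>2) / a\<^sup>2"
    using \<open>0 < a\<close> by (intro markov_finite finite_replicate_pmf fin) (auto simp: abs_le_square_iff[symmetric])
  also have "expec ?R (\<lambda>xs. (?S xs - ?m)\<^sup>2) = expec ?R (\<lambda>xs. (?S xs)\<^sup>2 + ((- 2 * ?m) * ?S xs + ?m\<^sup>2))"
    by (simp add: power2_diff algebra_simps)
  also have "\<dots> = real n * (expec p (\<lambda>x. (f x)\<^sup>2) - (expec p f)\<^sup>2)"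
    by (simp only: expec_add[OF finite_replicate_pmf[OF fin]] expec_cmult expec_replicate_sum[OF fin]
        expec_replicate_sum_square[OF fin] expec_const) (simp add: algebra_simps power2_eq_square)
  also have "\<dots> / a\<^sup>2 \<le> real n * v / a\<^sup>2"
    using var by (intro divide_right_mono mult_left_mono) auto
  finally show ?thesis .
qed

lemma prob_replicate_miss:
  "measure_pmf.prob (replicate_pmf n p) {xs. set xs \<inter> A = {}} = (1 - measure_pmf.prob p A) ^ n"
proof (induction n)
  case (Suc n)
  have eq: "indicator {xs. set xs \<inter> A = {}} (x # xs) = indicator (- A) x * (indicator {xs. set xs \<inter> A = {}} xs :: ennreal)"
    for x :: 'a and xs by (auto simp: indicator_def)
  have "emeasure (replicate_pmf (Suc n) p) {xs. set xs \<inter> A = {}}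
      = (\<integral>\<^sup>+ x. \<integral>\<^sup>+ xs. indicator {xs. set xs \<inter> A = {}} (x # xs) \<partial>replicate_pmf n p \<partial>p)"
    by (simp flip: nn_integral_indicator)
  also have "\<dots> = emeasure p (- A) * emeasure (replicate_pmf n p) {xs. set xs \<inter> A = {}}"
    unfolding eq by (simp add: nn_integral_cmult nn_integral_multc)
  finally show ?case
    using measure_pmf.prob_compl[of A p] Suc.IH
    by (simp add: measure_pmf.emeasure_eq_measure Compl_eq_Diff_UNIV flip: ennreal_mult)
qed simp

text \<open>The miss probability is at most exp (- c). It is weakened to \<open>1 / c\<close> to
  have the same shape \<beta> / t as the Chebyshev bounds it is added to.\<close>

lemma prob_replicate_miss_le:
  assumes "0 < c" "c \<le> real n * measure_pmf.prob p A"
  shows "measure_pmf.prob (replicate_pmf n p) {xs. set xs \<inter> A = {}} \<le> 1 / c"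
proof -
  let ?q = "measure_pmf.prob p A"
  have "(1 - ?q) ^ n \<le> exp (- ?q) ^ n"
    using exp_ge_add_one_self[of "- ?q"] by (intro power_mono) auto
  also have "\<dots> = exp (- (real n * ?q))"
    by (simp add: exp_of_nat_mult[symmetric])
  also have "\<dots> \<le> exp (- c)" using assms by simp
  also have "\<dots> \<le> 1 / c"
  proof -
    have "c \<le> exp c" using exp_ge_add_one_self[of c] by linarith
    then show ?thesis using assms by (simp add: exp_minus field_simps)
  qed
  finally show ?thesis by (simp add: prob_replicate_miss)
qed

section \<open>Counting pairs between two independent samples\<close>

lemma pair_replicate_mean:
  fixes f :: "'a \<Rightarrow> 'a \<Rightarrow> real"
  assumes fin: "finite (set_pmf p)"
  shows "expec (replicate_pmf r p) (\<lambda>xs. expec (replicate_pmf r p) (\<lambda>ys. \<Sum>y\<leftarrow>ys. \<Sum>x\<leftarrow>xs. f x y))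
       = (real r)\<^sup>2 * expec p (\<lambda>x. expec p (f x))"
  by (simp add: expec_replicate_sum[OF fin] expec_sum_list[OF fin] power2_eq_square)

text \<open>Given \<open>xs\<close>, the count is a sum of independent terms over \<open>ys\<close>;
  the second moment formula is applied to \<open>ys\<close> and then to \<open>xs\<close>. A pair of
  counted pairs is equal (r^2 * m), shares one entry (2 * r^2 * (r - 1) times the second moment of
  the conditional mean), or is disjoint and cancels against the squared mean.\<close>

lemma pair_replicate_square:
  fixes f :: "'a \<Rightarrow> 'a \<Rightarrow> real"
  assumes fin: "finite (set_pmf p)" and sym: "\<And>x y. f x y = f y x" and sq: "\<And>x y. (f x y)\<^sup>2 = f x y"
    and m: "m = expec p (\<lambda>x. expec p (f x))" and q: "expec p (\<lambda>x. (expec p (f x))\<^sup>2) \<le> q"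
  shows "expec (replicate_pmf r p) (\<lambda>xs. expec (replicate_pmf r p) (\<lambda>ys. (\<Sum>y\<leftarrow>ys. \<Sum>x\<leftarrow>xs. f x y)\<^sup>2))
       - ((real r)\<^sup>2 * m)\<^sup>2 \<le> (real r)\<^sup>2 * m + 2 * (real r) ^ 3 * q"
proof -
  let ?R = "replicate_pmf r p" and ?b = "\<lambda>x. expec p (f x)"
  let ?q = "expec p (\<lambda>x. (?b x)\<^sup>2)"
  note finR = finite_replicate_pmf[OF fin, of r]
  have "expec ?R (\<lambda>xs. expec ?R (\<lambda>ys. (\<Sum>y\<leftarrow>ys. \<Sum>x\<leftarrow>xs. f x y)\<^sup>2))
      = real r * expec ?R (\<lambda>xs. expec p (\<lambda>y. (\<Sum>x\<leftarrow>xs. f x y)\<^sup>2))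
      + real r * (real r - 1) * expec ?R (\<lambda>xs. (\<Sum>x\<leftarrow>xs. ?b x)\<^sup>2)"
    by (simp add: expec_replicate_sum_square[OF fin] expec_add[OF finR] expec_sum_list[OF fin])
  also have "expec ?R (\<lambda>xs. expec p (\<lambda>y. (\<Sum>x\<leftarrow>xs. f x y)\<^sup>2))
      = expec p (\<lambda>y. real r * ?b y + real r * (real r - 1) * (?b y)\<^sup>2)"
    by (subst expec_swap[OF finR fin]) (simp add: expec_replicate_sum_square[OF fin] sq sym[of _ y for y])
  also have "\<dots> = real r * m + real r * (real r - 1) * ?q"
    using fin by (simp add: expec_add m)
  also have "expec ?R (\<lambda>xs. (\<Sum>x\<leftarrow>xs. ?b x)\<^sup>2) = real r * ?q + real r * (real r - 1) * m\<^sup>2"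
    by (simp add: expec_replicate_sum_square[OF fin] m)
  finally have eq: "expec ?R (\<lambda>xs. expec ?R (\<lambda>ys. (\<Sum>y\<leftarrow>ys. \<Sum>x\<leftarrow>xs. f x y)\<^sup>2)) - ((real r)\<^sup>2 * m)\<^sup>2
      = (real r)\<^sup>2 * m + 2 * ((real r)\<^sup>2 * (real r - 1)) * ?q - ((real r)\<^sup>2 * (2 * real r - 1)) * m\<^sup>2"
    by (simp add: algebra_simps power2_eq_square)
  have "(real r)\<^sup>2 * (real r - 1) \<le> real r ^ 3"
    by (simp add: power2_eq_square power3_eq_cube algebra_simps)
  moreover have "0 \<le> ?q" by (intro Bochner_Integration.integral_nonneg) auto
  ultimately have "(real r)\<^sup>2 * (real r - 1) * ?q \<le> real r ^ 3 * q"
    using q by (intro mult_mono) auto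
  moreover have "0 \<le> ((real r)\<^sup>2 * (2 * real r - 1)) * m\<^sup>2"
    by (cases r) (auto intro!: mult_nonneg_nonneg)
  ultimately show ?thesis unfolding eq by linarith
qed

section \<open>Repetitions in a sample with replacement\<close>

primrec repeats :: "'a list \<Rightarrow> 'a list" where
  "repeats [] = []"
| "repeats (x # xs) = (if x \<in> set xs then x # repeats xs else repeats xs)"

lemma sum_list_repeats: "(\<Sum>x\<leftarrow>xs. f x) = (\<Sum>x\<in>set xs. f x) + (\<Sum>x\<leftarrow>repeats xs. f x)" for f :: "'a \<Rightarrow> 'b::comm_monoid_add"
  by (induction xs) (auto simp: insert_absorb add_ac)

lemma set_repeats: "set (repeats xs) \<subseteq> set xs"
  by (induction xs) auto

text \<open>The birthday bound: a new element meets one of at most r earlier values with probability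
  at most r / n.\<close>

lemma expec_repeats:
  assumes "finite A" "A \<noteq> {}"
  shows "expec (replicate_pmf r (pmf_of_set A)) (\<lambda>xs. real (length (repeats xs))) \<le> (real r)\<^sup>2 / real (card A)"
proof (induction r)
  case (Suc r)
  let ?U = "pmf_of_set A" and ?R = "replicate_pmf r (pmf_of_set A)"
  have fin: "finite (set_pmf ?U)" using assms by simp
  note finR = finite_replicate_pmf[OF fin, of r]
  have "expec (replicate_pmf (Suc r) ?U) (\<lambda>xs. real (length (repeats xs)))
      = expec ?U (\<lambda>x. expec ?R (\<lambda>xs. indicator (set xs) x + real (length (repeats xs))))"
    unfolding expec_replicate_Suc[OF fin]
    by (intro Bochner_Integration.integral_cong refl) (auto simp: indicator_def)
  also have "\<dots> = expec ?R (\<lambda>xs. expec ?U (indicator (set xs))) + expec ?R (\<lambda>xs. real (length (repeats xs)))"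
    by (simp add: expec_add[OF finR] expec_add[OF fin] expec_swap[OF fin finR, of "\<lambda>x xs. indicator (set xs) x"])
  also have "expec ?R (\<lambda>xs. expec ?U (indicator (set xs))) \<le> expec ?R (\<lambda>xs. real r / real (card A))"
  proof (intro expec_mono finR)
    fix xs assume "xs \<in> set_pmf ?R"
    then have "length xs = r" by (simp add: set_replicate_pmf)
    have "card (A \<inter> set xs) \<le> r"
      using card_mono[of "set xs" "A \<inter> set xs"] card_length[of xs] \<open>length xs = r\<close> by auto
    then show "expec ?U (indicator (set xs)) \<le> real r / real (card A)"
      using assms by (simp add: measure_pmf_of_set divide_right_mono)
  qed
  also have "expec ?R (\<lambda>xs. real (length (repeats xs))) \<le> (real r)\<^sup>2 / real (card A)"
    by (rule Suc.IH)
  also have "expec ?R (\<lambda>xs. real r / real (card A)) + (real r)\<^sup>2 / real (card A) \<le> (real (Suc r))\<^sup>2 / real (card A)"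
    by (simp add: add_divide_distrib[symmetric] divide_right_mono power2_eq_square algebra_simps)
  finally show ?case by simp
qed simp

section \<open>Programs\<close>

primrec repeat_prog :: "nat \<Rightarrow> 'a prog \<Rightarrow> 'a list prog" where
  "repeat_prog 0 t = Ret []"
| "repeat_prog (Suc n) t = do { x \<leftarrow> t; xs \<leftarrow> repeat_prog n t; Ret (x # xs) }"

primrec map_prog :: "('a \<Rightarrow> 'b prog) \<Rightarrow> 'a list \<Rightarrow> 'b list prog" where
  "map_prog f [] = Ret []"
| "map_prog f (x # xs) = do { y \<leftarrow> f x; ys \<leftarrow> map_prog f xs; Ret (y # ys) }"

definition vertex :: "nat prog" where
  "vertex = Vert Ret"

definition edge_test :: "extra_oracle \<Rightarrow> nat \<Rightarrow> nat \<Rightarrow> bool prog" where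
  "edge_test ex x y = (case ex of
     Pair_Oracle \<Rightarrow> Ask x y Ret
   | Additive_Oracle \<Rightarrow> Count {x, y} (\<lambda>m. Ret (0 < m)))"

text \<open>The bias is d / n for \<open>None\<close> and deg h / n for \<open>Some h\<close>. One
  estimator thus serves the whole pair oracle algorithm, the test of a hub, and the final estimation
  of n from the hub.\<close>

definition coin :: "extra_oracle \<Rightarrow> nat option \<Rightarrow> bool prog" where
  "coin ex c = (case c of
     None \<Rightarrow> do { x \<leftarrow> vertex; y \<leftarrow> vertex; edge_test ex x y }
   | Some h \<Rightarrow> do { x \<leftarrow> vertex; edge_test ex x h })"

text \<open>Inclusion-exclusion for the ordered adjacent pairs in A x B, correct also if A and B
  overlap: an edge inside the intersection counts twice, once for each order of its ends.\<close>

definition cross :: "nat set \<Rightarrow> nat set \<Rightarrow> nat prog" where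
  "cross A B = Count (A \<union> B) (\<lambda>a. Count (A \<inter> B) (\<lambda>b. Count (A - B) (\<lambda>c. Count (B - A) (\<lambda>d.
     Ret (a + b - (c + d))))))"

text \<open>
  The additive oracle takes sets, but unbiased counting needs the multiplicities of a sample
  drawn with replacement. Samples of size at most about \<open>sqrt n\<close> have few repetitions, so
  splitting off a singleton for each of them costs little.
\<close>

definition layers :: "nat list \<Rightarrow> nat set list" where
  "layers xs = set xs # map (\<lambda>x. {x}) (repeats xs)"

definition pair_count :: "nat list \<Rightarrow> nat list \<Rightarrow> nat prog" where
  "pair_count xs ys = do {
     cs \<leftarrow> map_prog (\<lambda>(A, B). cross A B) (List.product (layers xs) (layers ys));
     Ret (sum_list cs) }"

definition probe :: "nat prog" where
  "probe = do { x \<leftarrow> vertex; Nbr x Ret }"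

text \<open>Two independent samples, so that the pairs between them form a bilinear statistic whose
  moments can be computed one sample at a time.\<close>

definition group :: "nat \<Rightarrow> (nat list \<times> nat list) prog" where
  "group r = do { xs \<leftarrow> repeat_prog r vertex; ys \<leftarrow> repeat_prog r vertex; Ret (xs, ys) }"

primrec max_degree_from :: "nat \<Rightarrow> nat \<Rightarrow> nat list \<Rightarrow> nat prog" where
  "max_degree_from v d [] = Ret v"
| "max_degree_from v d (x # xs) =
     Deg x (\<lambda>d'. if d < d' then max_degree_from x d' xs else max_degree_from v d xs)"

definition max_degree :: "nat list \<Rightarrow> nat prog" where
  "max_degree xs = Deg (hd xs) (\<lambda>d. max_degree_from (hd xs) d (tl xs))"

section \<open>Semantics of the individual programs\<close>

context graph
begin

lemma finite_E: "finite E"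
proof -
  have "E \<subseteq> Pow V" using edge_wf by blast
  then show ?thesis using finite_V finite_subset by blast
qed

lemma card_V_pos: "0 < card V"
  using finite_V V_nonempty by (simp add: card_gt_0_iff)

abbreviation U :: "nat pmf" where "U \<equiv> pmf_of_set V"

lemma set_U [simp]: "set_pmf U = V"
  using finite_V V_nonempty by simp

lemma finite_U: "finite (set_pmf U)"
  using finite_V by simp

lemma sum_degree: "(\<Sum>x\<in>V. Defs.degree E x) = 2 * card E"
proof -
  have deg: "Defs.degree E x = card {e \<in> E. x \<in> e}" if "x \<in> V" for x
  proof -
    have "bij_betw (\<lambda>y. {x, y}) (nbrs E x) {e \<in> E. x \<in> e}"
    proof (rule bij_betw_imageI)
      show "inj_on (\<lambda>y. {x, y}) (nbrs E x)"
        by (auto simp: inj_on_def doubleton_eq_iff)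
      show "(\<lambda>y. {x, y}) ` nbrs E x = {e \<in> E. x \<in> e}"
      proof (intro equalityI subsetI)
        fix e assume "e \<in> {e \<in> E. x \<in> e}"
        then obtain y where "e = {x, y}" using edge_wf by (auto simp: insert_commute)
        then show "e \<in> (\<lambda>y. {x, y}) ` nbrs E x"
          using \<open>e \<in> {e \<in> E. x \<in> e}\<close> by (auto simp: nbrs_def)
      qed (auto simp: nbrs_def)
    qed
    then show ?thesis by (simp add: degree_def bij_betw_same_card)
  qed
  have "(\<Sum>x\<in>V. Defs.degree E x) = (\<Sum>x\<in>V. \<Sum>e\<in>E. of_bool (x \<in> e))"
    using finite_E by (intro sum.cong refl) (simp add: deg Int_def)
  also have "\<dots> = (\<Sum>e\<in>E. card e)"
  proof (subst sum.swap, intro sum.cong refl)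
    fix e assume "e \<in> E"
    then have "V \<inter> e = e" using edge_wf by blast
    then show "(\<Sum>x\<in>V. of_bool (x \<in> e)) = card e" using finite_V by simp
  qed
  also have "\<dots> = (\<Sum>e\<in>E. 2)"
    using edge_wf by (intro sum.cong refl) (metis card_2_iff)
  finally show ?thesis by simp
qed

lemma degree_pos: "x \<in> V \<Longrightarrow> 0 < Defs.degree E x"
  using nbrs_nonempty by (simp add: degree_def card_gt_0_iff)

lemma degree_le: "Defs.degree E x \<le> card V"
  unfolding degree_def by (intro card_mono finite_V nbrs_subset)

lemma ok_bindI:
  assumes "ok ex K t P" "\<And>K' x. K \<subseteq> K' \<Longrightarrow> P K' x \<Longrightarrow> ok ex K' (k x) Q"
  shows "ok ex K (bind_prog t k) Q"
  unfolding ok_bind using assms(1) by (rule ok_mono) (rule assms(2))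

lemma result_repeat: "result (repeat_prog n t) = replicate_pmf n (result t)"
  by (induction n) (simp_all add: result_bind)

lemma ecost_repeat: "ecost (repeat_prog n t) = of_nat n * ecost t"
  by (induction n) (simp_all add: ecost_bind distrib_right)

lemma ok_repeat:
  assumes "\<And>K'. K \<subseteq> K' \<Longrightarrow> ok ex K' t P" and mono: "\<And>K K' x. K \<subseteq> K' \<Longrightarrow> P K x \<Longrightarrow> P K' x"
  shows "ok ex K (repeat_prog n t) (\<lambda>K' xs. \<forall>x\<in>set xs. P K' x)"
  using assms(1)
proof (induction n arbitrary: K)
  case (Suc n)
  show ?case unfolding repeat_prog.simps
  proof (rule ok_bindI[OF Suc.prems[OF order_refl]], rule ok_bindI[OF Suc.IH])
    show "ok ex K' t P" if "K \<subseteq> K''" "K'' \<subseteq> K'" for K' K'' using Suc.prems that by blast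
  qed (auto intro: mono)
qed simp

lemma result_map_prog:
  "(\<And>x. x \<in> set xs \<Longrightarrow> result (f x) = return_pmf (g x)) \<Longrightarrow> result (map_prog f xs) = return_pmf (map g xs)"
  by (induction xs) (simp_all add: result_bind bind_return_pmf)

lemma ecost_map_prog: "ecost (map_prog f xs) = (\<Sum>x\<leftarrow>xs. ecost (f x))"
  by (induction xs) (simp_all add: ecost_bind)

lemma ok_map_prog:
  assumes "\<And>K' x. K \<subseteq> K' \<Longrightarrow> x \<in> set xs \<Longrightarrow> ok ex K' (f x) (\<lambda>_ _. True)"
  shows "ok ex K (map_prog f xs) (\<lambda>_ _. True)"
  using assms
proof (induction xs arbitrary: K)
  case (Cons x xs)
  show ?case unfolding map_prog.simps
  proof (rule ok_bindI[OF Cons.prems[OF order_refl]], simp, rule ok_bindI[OF Cons.IH])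
    show "ok ex K' (f y) (\<lambda>_ _. True)" if "K \<subseteq> K''" "K'' \<subseteq> K'" "y \<in> set xs" for K' K'' y
      using Cons.prems[of K' y] that by auto
  qed auto
qed simp

lemma result_vertex: "result vertex = U"
  by (simp add: vertex_def bind_return_pmf')

lemma ecost_vertex: "ecost vertex = 1"
  by (simp add: vertex_def)

lemma ok_vertex: "ok ex K vertex (\<lambda>K' x. x \<in> K' \<and> x \<in> V)"
  by (simp add: vertex_def)

lemma induced_edges_pair: "0 < card (induced_edges E {x, y}) \<longleftrightarrow> {x, y} \<in> E"
proof -
  have "e = {x, y}" if "e \<in> E" "e \<subseteq> {x, y}" for e
    using edge_wf[OF that(1)] that(2) by auto
  then have "induced_edges E {x, y} = (if {x, y} \<in> E then {{x, y}} else {})"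
    by (auto simp: induced_edges_def)
  then show ?thesis by simp
qed

lemma result_edge_test: "result (edge_test ex x y) = return_pmf ({x, y} \<in> E)"
  by (cases ex) (simp_all add: edge_test_def induced_edges_pair)

lemma ecost_edge_test: "1 \<le> ecost (edge_test ex x y)" "ecost (edge_test ex x y) \<le> 2"
  by (cases ex; simp add: edge_test_def card_insert_if)+

lemma ok_edge_test: "x \<in> K \<Longrightarrow> y \<in> K \<Longrightarrow> ok ex K (edge_test ex x y) (\<lambda>_ _. True)"
  by (cases ex) (simp_all add: edge_test_def)

lemma result_coin: "result (coin ex c) = (case c of
     None \<Rightarrow> bind_pmf U (\<lambda>x. map_pmf (\<lambda>y. {x, y} \<in> E) U)
   | Some h \<Rightarrow> map_pmf (\<lambda>x. {x, h} \<in> E) U)"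
  by (cases c) (simp_all add: coin_def result_bind result_vertex result_edge_test map_pmf_def)

lemma ecost_coin: "1 \<le> ecost (coin ex c)" "ecost (coin ex c) \<le> 4"
proof -
  have "(\<integral>\<^sup>+ y. ecost (edge_test ex x y) \<partial>U) \<le> (\<integral>\<^sup>+ y. 2 \<partial>U)"
    "(\<integral>\<^sup>+ y. ecost (edge_test ex y x) \<partial>U) \<le> (\<integral>\<^sup>+ y. 2 \<partial>U)" for x
    by (intro nn_integral_mono ecost_edge_test)+
  then have 1: "(\<integral>\<^sup>+ y. ecost (edge_test ex x y) \<partial>U) \<le> 2" "(\<integral>\<^sup>+ y. ecost (edge_test ex y x) \<partial>U) \<le> 2" for x
    by simp_all
  have "(\<integral>\<^sup>+ x. 1 + (\<integral>\<^sup>+ y. ecost (edge_test ex x y) \<partial>U) \<partial>U) \<le> (\<integral>\<^sup>+ x. 1 + 2 \<partial>U)"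
    by (intro nn_integral_mono add_left_mono 1)
  then have 2: "(\<integral>\<^sup>+ x. 1 + (\<integral>\<^sup>+ y. ecost (edge_test ex x y) \<partial>U) \<partial>U) \<le> 3"
    by simp
  have "1 + (3 :: ennreal) = 4" "1 + (2 :: ennreal) \<le> 4" by simp_all
  then show "ecost (coin ex c) \<le> 4"
    using add_left_mono[OF 2, of 1] order_trans[OF add_left_mono[OF 1(2), of 1]]
    by (cases c) (simp_all add: coin_def ecost_bind ecost_vertex result_vertex)
  show "1 \<le> ecost (coin ex c)"
    by (cases c) (simp_all add: coin_def ecost_bind ecost_vertex)
qed

lemma ok_coin:
  assumes "\<And>h. c = Some h \<Longrightarrow> h \<in> K"
  shows "ok ex K (coin ex c) (\<lambda>_ _. True)"
proof (cases c)
  case None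
  show ?thesis unfolding coin_def None option.case
    by (rule ok_bindI[OF ok_vertex], rule ok_bindI[OF ok_vertex]) (auto intro: ok_edge_test)
next
  case (Some h)
  show ?thesis unfolding coin_def Some option.case
    by (rule ok_bindI[OF ok_vertex]) (use assms Some in \<open>auto intro: ok_edge_test\<close>)
qed

definition adj :: "nat \<Rightarrow> nat \<Rightarrow> nat" where
  "adj x y = of_bool ({x, y} \<in> E)"

lemma adj_sym: "adj x y = adj y x"
  by (simp add: adj_def insert_commute)

text \<open>Every edge inside A corresponds to two ordered pairs, since its ends differ.\<close>

lemma adj_sum_self:
  assumes "finite A"
  shows "(\<Sum>x\<in>A. \<Sum>y\<in>A. adj x y) = 2 * card (induced_edges E A)"
proof -
  have fin: "finite (induced_edges E A)" using finite_E by (simp add: induced_edges_def)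
  have "(\<Sum>x\<in>A. \<Sum>y\<in>A. adj x y) = card (SIGMA x:A. {y \<in> A. {x, y} \<in> E})"
    using assms by (simp add: adj_def Int_def)
  also have "(SIGMA x:A. {y \<in> A. {x, y} \<in> E}) = (\<Union>e\<in>induced_edges E A. {(x, y). e = {x, y}})"
    by (auto simp: induced_edges_def)
  also have "card \<dots> = (\<Sum>e\<in>induced_edges E A. card {(x, y). e = {x, y}})"
  proof (rule card_UN_disjoint[OF fin])
    show "\<forall>e\<in>induced_edges E A. finite {(x, y). e = {x, y}}"
    proof
      fix e assume "e \<in> induced_edges E A"
      then have "{(x, y). e = {x, y}} \<subseteq> A \<times> A" by (auto simp: induced_edges_def)
      then show "finite {(x, y). e = {x, y}}" using assms finite_subset by blast
    qed
  qed auto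
  also have "\<dots> = (\<Sum>e\<in>induced_edges E A. 2)"
  proof (intro sum.cong refl)
    fix e assume "e \<in> induced_edges E A"
    then have "e \<in> E" by (simp add: induced_edges_def)
    from edge_wf[OF this] obtain x y where "x \<noteq> y" "e = {x, y}" by blast
    then have "{(x, y). e = {x, y}} = {(x, y), (y, x)}" by (auto simp: doubleton_eq_iff)
    then show "card {(x, y). e = {x, y}} = 2" using \<open>x \<noteq> y\<close> by simp
  qed
  finally show ?thesis by simp
qed

lemma result_cross:
  assumes "finite A" "finite B"
  shows "result (cross A B) = return_pmf (\<Sum>x\<in>A. \<Sum>y\<in>B. adj x y)"
proof -
  let ?s = "\<lambda>A B. \<Sum>x\<in>A. \<Sum>y\<in>B. adj x y" and ?e = "\<lambda>S. card (induced_edges E S)"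
  let ?P = "A - B" and ?Q = "A \<inter> B" and ?R = "B - A"
  have fin: "finite ?P" "finite ?Q" "finite ?R" using assms by auto
  have sum_union: "sum f (X \<union> Y) = sum f X + sum f Y" if "finite X" "finite Y" "X \<inter> Y = {}" for f :: "nat \<Rightarrow> nat" and X Y
    using that by (rule sum.union_disjoint)
  have sA: "sum f A = sum f ?P + sum f ?Q" and sB: "sum f B = sum f ?Q + sum f ?R"
    and sAB: "sum f (A \<union> B) = sum f ?P + sum f ?Q + sum f ?R" for f :: "nat \<Rightarrow> nat"
  proof -
    have "A = ?P \<union> ?Q" by auto
    then show "sum f A = sum f ?P + sum f ?Q" using sum_union[of ?P ?Q f] fin by auto
    have "B = ?Q \<union> ?R" by auto
    then show "sum f B = sum f ?Q + sum f ?R" using sum_union[of ?Q ?R f] fin by auto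
    have "sum f (A \<union> B) = sum f (A \<union> ?R)" by simp
    also have "\<dots> = sum f A + sum f ?R" using assms fin by (intro sum_union) auto
    finally show "sum f (A \<union> B) = sum f ?P + sum f ?Q + sum f ?R"
      by (simp add: \<open>sum f A = sum f ?P + sum f ?Q\<close>)
  qed
  have sym: "?s X Y = ?s Y X" for X Y
    by (subst sum.swap) (simp add: adj_sym)
  \<comment> \<open>Stated additively, this also shows that the subtraction of naturals in
    \<open>cross\<close> does not truncate.\<close>
  have "2 * ?e (A \<union> B) + 2 * ?e ?Q = 2 * ?s A B + 2 * ?e ?P + 2 * ?e ?R"
    using fin assms
    by (simp add: adj_sum_self[symmetric] sA sB sAB sum.distrib sym[of ?Q ?P] sym[of ?R ?P] sym[of ?R ?Q])
  then show ?thesis by (simp add: cross_def)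
qed

lemma ecost_cross:
  assumes "finite A" "finite B"
  shows "ecost (cross A B) \<le> of_nat (2 * (card A + card B))"
proof -
  have arith: "u \<le> a + b \<Longrightarrow> m + i = a \<Longrightarrow> n \<le> b \<Longrightarrow> u + (i + (m + n)) \<le> 2 * (a + b)"
    for u a b m i n :: nat by simp
  have "card (A \<union> B) \<le> card A + card B" "card (A - B) + card (A \<inter> B) = card A"
    "card (B - A) \<le> card B"
    using assms by (auto simp: card_Un_le card_mono card_Diff_subset_Int Int_commute)
  then have "card (A \<union> B) + (card (A \<inter> B) + (card (A - B) + card (B - A))) \<le> 2 * (card A + card B)"
    by (rule arith)
  then have "(of_nat (card (A \<union> B) + (card (A \<inter> B) + (card (A - B) + card (B - A)))) :: ennreal)
      \<le> of_nat (2 * (card A + card B))"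
    by (rule of_nat_mono)
  then show ?thesis by (simp add: cross_def)
qed

lemma finite_layers: "A \<in> set (layers xs) \<Longrightarrow> finite A"
  by (auto simp: layers_def)

text \<open>The layers decompose the sample as a multiset, so a bilinear count over two samples is
  the sum of the counts over all pairs of layers.\<close>

lemma sum_layers: "(\<Sum>A\<leftarrow>layers xs. \<Sum>x\<in>A. f x) = (\<Sum>x\<leftarrow>xs. f x)" for f :: "nat \<Rightarrow> nat"
  by (simp add: layers_def o_def flip: sum_list_repeats)

lemma sum_list_product:
  "(\<Sum>(x, y)\<leftarrow>List.product xs ys. f x y) = (\<Sum>x\<leftarrow>xs. \<Sum>y\<leftarrow>ys. f x y)"
  for f :: "'b \<Rightarrow> 'c \<Rightarrow> nat"
  by (induction xs) (simp_all add: o_def)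

lemma sum_list_sum: "(\<Sum>y\<leftarrow>ys. \<Sum>x\<in>A. f x y) = (\<Sum>x\<in>A. \<Sum>y\<leftarrow>ys. f x y)" for f :: "'b \<Rightarrow> 'c \<Rightarrow> nat"
  by (induction ys) (simp_all add: sum.distrib)

definition pair_sum :: "nat list \<Rightarrow> nat list \<Rightarrow> nat" where
  "pair_sum xs ys = (\<Sum>x\<leftarrow>xs. \<Sum>y\<leftarrow>ys. adj x y)"

lemma result_pair_count: "result (pair_count xs ys) = return_pmf (pair_sum xs ys)"
proof -
  have "result (map_prog (\<lambda>(A, B). cross A B) (List.product (layers xs) (layers ys)))
      = return_pmf (map (\<lambda>(A, B). \<Sum>x\<in>A. \<Sum>y\<in>B. adj x y) (List.product (layers xs) (layers ys)))"
    by (rule result_map_prog) (auto intro!: result_cross dest: finite_layers)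
  moreover have "(\<Sum>(A, B)\<leftarrow>List.product (layers xs) (layers ys). \<Sum>x\<in>A. \<Sum>y\<in>B. adj x y) = pair_sum xs ys"
    by (simp add: sum_list_product sum_list_sum sum_layers pair_sum_def)
  ultimately show ?thesis
    by (simp add: pair_count_def result_bind bind_return_pmf)
qed

text \<open>The layers of each sample have total size r, and each layer is paired with all layers of
  the other sample. The cost is thus r times the number of layers on both sides, doubled by the four
  queries of \<open>cross\<close>.\<close>

lemma ecost_pair_count:
  assumes "length xs = r" "length ys = r"
  shows "ecost (pair_count xs ys) \<le> of_nat (2 * r * (2 + length (repeats xs) + length (repeats ys)))"
proof -
  let ?L = "List.product (layers xs) (layers ys)"
  have mono: "sum_list (map f zs) \<le> sum_list (map g zs)" if "\<And>z. z \<in> set zs \<Longrightarrow> f z \<le> g z"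
    for f g :: "'d \<Rightarrow> ennreal" and zs
    using that by (induction zs) (auto intro: add_mono)
  have of_nat: "(\<Sum>z\<leftarrow>zs. of_nat (f z)) = (of_nat (\<Sum>z\<leftarrow>zs. f z) :: ennreal)" for f :: "'d \<Rightarrow> nat" and zs
    by (induction zs) simp_all
  have len: "length (layers zs) = Suc (length (repeats zs))" for zs
    by (simp add: layers_def)
  have cards: "(\<Sum>A\<leftarrow>layers zs. card A) = length zs" for zs
    using sum_layers[of "\<lambda>_. 1" zs] by (simp add: sum_list_triv)
  have "ecost (pair_count xs ys) = (\<Sum>(A, B)\<leftarrow>?L. ecost (cross A B))"
    by (simp add: pair_count_def ecost_bind ecost_map_prog case_prod_unfold)
  also have "\<dots> \<le> (\<Sum>(A, B)\<leftarrow>?L. of_nat (2 * (card A + card B)))"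
  proof (rule mono)
    fix z assume "z \<in> set ?L"
    then obtain A B where "z = (A, B)" "finite A" "finite B"
      unfolding set_product using finite_layers by blast
    then show "(case z of (A, B) \<Rightarrow> ecost (cross A B)) \<le> (case z of (A, B) \<Rightarrow> of_nat (2 * (card A + card B)))"
      by (simp only: case_prod_conv ecost_cross)
  qed
  also have "\<dots> = of_nat (\<Sum>(A, B)\<leftarrow>?L. 2 * (card A + card B))"
    by (simp add: of_nat case_prod_unfold del: of_nat_mult of_nat_add)
  also have "(\<Sum>(A, B)\<leftarrow>?L. 2 * (card A + card B))
      = 2 * (length (layers ys) * (\<Sum>A\<leftarrow>layers xs. card A) + length (layers xs) * (\<Sum>B\<leftarrow>layers ys. card B))"
    by (simp add: sum_list_product sum_list_addf sum_list_const_mult sum_list_mult_const sum_list_triv distrib_left mult_ac)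
  also have "\<dots> = 2 * r * (2 + length (repeats xs) + length (repeats ys))"
    by (simp add: cards assms len algebra_simps)
  finally show ?thesis .
qed

lemma layers_subset: "A \<in> set (layers xs) \<Longrightarrow> A \<subseteq> set xs"
  using set_repeats[of xs] by (auto simp: layers_def)

lemma ok_pair_count:
  assumes "set xs \<subseteq> K" "set ys \<subseteq> K"
  shows "ok Additive_Oracle K (pair_count xs ys) (\<lambda>_ _. True)"
  unfolding pair_count_def
proof (rule ok_bindI[OF ok_map_prog])
  fix K' z assume "K \<subseteq> K'" and z: "z \<in> set (List.product (layers xs) (layers ys))"
  obtain A B where z_eq: "z = (A, B)" by (cases z)
  have "A \<subseteq> K'" "B \<subseteq> K'"
    using z layers_subset[of A xs] layers_subset[of B ys] assms \<open>K \<subseteq> K'\<close> unfolding z_eq set_product by auto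
  then have "A \<union> B \<subseteq> K'" "A \<inter> B \<subseteq> K'" "A - B \<subseteq> K'" "B - A \<subseteq> K'" by auto
  then show "ok Additive_Oracle K' (case z of (A, B) \<Rightarrow> cross A B) (\<lambda>_ _. True)"
    by (simp only: z_eq case_prod_conv cross_def ok.simps simp_thms)
qed simp

lemma result_probe: "result probe = bind_pmf U (\<lambda>x. pmf_of_set (nbrs E x))"
  by (simp add: probe_def result_bind result_vertex bind_return_pmf')

lemma ecost_probe: "ecost probe = 2"
  by (simp add: probe_def ecost_bind ecost_vertex)

lemma ok_probe: "ok ex K probe (\<lambda>K' x. x \<in> K' \<and> x \<in> V)"
  unfolding probe_def by (rule ok_bindI[OF ok_vertex]) (use nbrs_subset in auto)

lemma set_probe: "set_pmf (result probe) \<subseteq> V"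
  using nbrs_subset nbrs_nonempty by (fastforce simp: result_probe)

lemma result_group: "result (group r) = pair_pmf (replicate_pmf r U) (replicate_pmf r U)"
  by (simp only: group_def result_bind result_repeat result_vertex result.simps) (subst pair_pmf_def, rule refl)

lemma ecost_group: "ecost (group r) = of_nat (2 * r)"
  by (simp add: group_def ecost_bind ecost_repeat ecost_vertex result_repeat mult_2)

lemma ok_group: "ok ex K (group r) (\<lambda>K' (xs, ys). set xs \<subseteq> K' \<inter> V \<and> set ys \<subseteq> K' \<inter> V)"
proof -
  have rep: "ok ex K (repeat_prog r vertex) (\<lambda>K' xs. \<forall>x\<in>set xs. x \<in> K' \<and> x \<in> V)" for K
    by (rule ok_repeat[OF ok_vertex]) auto
  show ?thesis unfolding group_def
    by (rule ok_bindI[OF rep], rule ok_bindI[OF rep]) auto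
qed

lemma max_degree_from_spec:
  "\<exists>w\<in>insert v (set xs). result (max_degree_from v (Defs.degree E v) xs) = return_pmf w \<and>
     (\<forall>u\<in>insert v (set xs). Defs.degree E u \<le> Defs.degree E w)"
proof (induction xs arbitrary: v)
  case (Cons x xs)
  show ?case
  proof (cases "Defs.degree E v < Defs.degree E x")
    case True
    obtain w where w: "w \<in> insert x (set xs)" "result (max_degree_from x (Defs.degree E x) xs) = return_pmf w"
      "\<forall>u\<in>insert x (set xs). Defs.degree E u \<le> Defs.degree E w"
      using Cons.IH[of x] by blast
    then have "Defs.degree E v \<le> Defs.degree E w" "Defs.degree E x \<le> Defs.degree E w"
      using True by (auto dest: bspec[of _ _ x])
    then show ?thesis using w True by (intro bexI[of _ w]) auto
  next
    case False
    obtain w where w: "w \<in> insert v (set xs)" "result (max_degree_from v (Defs.degree E v) xs) = return_pmf w"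
      "\<forall>u\<in>insert v (set xs). Defs.degree E u \<le> Defs.degree E w"
      using Cons.IH[of v] by blast
    then have "Defs.degree E v \<le> Defs.degree E w" "Defs.degree E x \<le> Defs.degree E w"
      using False by (auto dest: bspec[of _ _ v])
    then show ?thesis using w False by (intro bexI[of _ w]) auto
  qed
qed simp

lemma ecost_max_degree_from: "ecost (max_degree_from v d xs) = of_nat (length xs)"
  by (induction xs arbitrary: v d) auto

lemma ok_max_degree_from:
  "insert v (set xs) \<subseteq> K \<Longrightarrow> ok ex K (max_degree_from v d xs) (\<lambda>K' w. w \<in> insert v (set xs))"
proof (induction xs arbitrary: v d)
  case (Cons x xs)
  have "ok ex K (max_degree_from u d' xs) (\<lambda>K' w. w \<in> insert v (set (x # xs)))" if "u \<in> {v, x}" for u d'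
    by (rule ok_mono[OF Cons.IH[of u]]) (use Cons.prems that in auto)
  then show ?case using Cons.prems by simp
qed simp

text \<open>Taken from the actual outcome of the deterministic program \<open>max_degree\<close>, so
  ties are broken as the program breaks them.\<close>

definition hub :: "nat list \<Rightarrow> nat" where
  "hub xs = (SOME w. w \<in> set xs \<and> result (max_degree xs) = return_pmf w \<and>
     (\<forall>u\<in>set xs. Defs.degree E u \<le> Defs.degree E w))"

lemma hub:
  assumes "xs \<noteq> []"
  shows "hub xs \<in> set xs" "result (max_degree xs) = return_pmf (hub xs)"
    "\<And>u. u \<in> set xs \<Longrightarrow> Defs.degree E u \<le> Defs.degree E (hub xs)"
proof -
  obtain x ys where xs: "xs = x # ys" using assms by (cases xs) auto
  obtain w where "w \<in> insert x (set ys)"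
    "result (max_degree_from x (Defs.degree E x) ys) = return_pmf w"
    "\<forall>u\<in>insert x (set ys). Defs.degree E u \<le> Defs.degree E w"
    using max_degree_from_spec[of x ys] by blast
  then have "w \<in> set xs \<and> result (max_degree xs) = return_pmf w \<and>
     (\<forall>u\<in>set xs. Defs.degree E u \<le> Defs.degree E w)"
    by (simp add: xs max_degree_def)
  then have *: "hub xs \<in> set xs \<and> result (max_degree xs) = return_pmf (hub xs) \<and>
     (\<forall>u\<in>set xs. Defs.degree E u \<le> Defs.degree E (hub xs))"
    unfolding hub_def by (rule someI)
  show "hub xs \<in> set xs" using * by (rule conjunct1)
  show "result (max_degree xs) = return_pmf (hub xs)" using * by (elim conjE)
  show "Defs.degree E u \<le> Defs.degree E (hub xs)" if "u \<in> set xs" for u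
    using * that by (elim conjE) (erule bspec)
qed

lemma ecost_max_degree: "xs \<noteq> [] \<Longrightarrow> ecost (max_degree xs) = of_nat (length xs)"
  by (cases xs) (simp_all add: max_degree_def ecost_max_degree_from)

lemma ok_max_degree:
  assumes "xs \<noteq> []" "set xs \<subseteq> K"
  shows "ok ex K (max_degree xs) (\<lambda>K' w. w \<in> set xs)"
  using assms ok_max_degree_from[of "hd xs" "tl xs" K ex] by (cases xs) (auto simp: max_degree_def)

end

section \<open>Light and heavy edges\<close>

definition hits :: "bool list \<Rightarrow> nat" where
  "hits bs = length (filter id bs)"

text \<open>Rounds double their size, so the right size 1 / p is replaced by the first power of the
  base that reaches it. Base 4 is used when 2 ^ k has to approximate the square root of 1 /
  p.\<close>

definition level :: "real \<Rightarrow> real \<Rightarrow> nat" where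
  "level b p = (LEAST k. 1 \<le> b ^ k * p)"

lemma level:
  assumes "1 < b" "0 < p" "p \<le> 1"
  shows "1 \<le> b ^ level b p * p" "b ^ level b p * p < b"
proof -
  obtain k where "1 / p < b ^ k" using real_arch_pow[OF \<open>1 < b\<close>] by blast
  then have "1 \<le> b ^ k * p" using assms by (simp add: field_simps)
  then show *: "1 \<le> b ^ level b p * p" unfolding level_def by (rule LeastI)
  show "b ^ level b p * p < b"
  proof (cases "level b p")
    case 0
    then show ?thesis using assms by simp
  next
    case (Suc m)
    have "\<not> 1 \<le> b ^ m * p" using Suc unfolding level_def by (intro not_less_Least) simp
    then show ?thesis using assms by (simp add: Suc mult.assoc)
  qed
qed

text \<open>
  Both kinds of rounds are analysed through the ratio \<open>t\<close> of the sample size to the right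
  sample size, which doubles in each round. The two functions below bound the total error
  probability and the total cost of all rounds from ratio \<open>t\<close> on: the probability of stopping with a
  wrong answer is at most \<open>4 * t\<close> for small \<open>t\<close> by Markov's inequality and at most
  \<open>\<beta> / t\<close> for the other \<open>t\<close> by Chebyshev's inequality.
\<close>

definition error_potential :: "real \<Rightarrow> real \<Rightarrow> real" where
  "error_potential \<beta> t = (if 1 / 128 \<le> t then 2 * \<beta> / t else 4 * (1 / 64 - t) + 256 * \<beta>)"

definition cost_potential :: "real \<Rightarrow> real \<Rightarrow> real" where
  "cost_potential a t = (if 1 \<le> t then 2 * a * t ^ 3 else a * (18 - t))"

lemma error_potential_nonneg: "0 < t \<Longrightarrow> 0 \<le> \<beta> \<Longrightarrow> 0 \<le> error_potential \<beta> t"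
  by (simp add: error_potential_def)

lemma error_potential_le:
  assumes "0 < t" "0 \<le> \<beta>"
  shows "error_potential \<beta> t \<le> 1 / 16 + 256 * \<beta>"
proof (cases "1 / 128 \<le> t")
  case True
  then have "2 * \<beta> / t \<le> 2 * \<beta> / (1 / 128)" using assms by (intro divide_left_mono) auto
  then show ?thesis using True by (simp add: error_potential_def)
qed (use assms in \<open>simp add: error_potential_def\<close>)

text \<open>From 1/128 on, \<beta> / t + \<beta> / (2 * t) + ... sums to 2 * \<beta> / t, which is
  at most 256 * \<beta>. Below, 4 * t + 4 * (1/64 - 2 * t) = 4 * (1/64 - t) holds exactly; at the
  crossing t < 1/128 makes this term at least 4 * t.\<close>

lemma error_potential_step:
  assumes "0 < t" "0 \<le> \<beta>" and b: "b \<le> (if 1 / 128 \<le> t then \<beta> / t else 4 * t)"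
  shows "b + error_potential \<beta> (2 * t) \<le> error_potential \<beta> t"
proof (cases "1 / 128 \<le> t")
  case True
  then show ?thesis using assms by (simp add: error_potential_def field_simps)
next
  case False
  show ?thesis
  proof (cases "1 / 128 \<le> 2 * t")
    case True
    have "2 * \<beta> / (2 * t) \<le> 2 * \<beta> / (1 / 128)" using True assms by (intro divide_left_mono) auto
    then show ?thesis using False True b by (simp add: error_potential_def)
  qed (use False b in \<open>simp add: error_potential_def\<close>)
qed

lemma cost_potential_nonneg: "0 < t \<Longrightarrow> 0 \<le> a \<Longrightarrow> 0 \<le> cost_potential a t"
  by (simp add: cost_potential_def)

lemma cost_potential_le: "0 < t \<Longrightarrow> t \<le> 1 \<Longrightarrow> 0 \<le> a \<Longrightarrow> cost_potential a t \<le> 18 * a"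
  by (auto simp: cost_potential_def algebra_simps)

text \<open>For t at least 1 a round costs up to a * t^3, the factor t^2 covering repeated sample
  vertices. Doubling t multiplies this by 8 and the continuation probability 1/16 halves the
  product, so the sum is 2 * a * t^3. Below 1 the costs a * t telescope; 18 = 16 + 2 leaves room for
  the first potential after the crossing.\<close>

lemma cost_potential_step:
  assumes "0 < t" "0 \<le> a" "0 \<le> q" and c: "c \<le> a * t * (1 + (if 1 \<le> t then t\<^sup>2 - 1 else 0))"
    and q: "q \<le> (if 1 \<le> t then 1 / 16 else 1)"
  shows "c + q * cost_potential a (2 * t) \<le> cost_potential a t"
proof (cases "1 \<le> t")
  case True
  then have pot: "cost_potential a (2 * t) = 2 * a * (2 * t) ^ 3" by (simp add: cost_potential_def)
  have "q * cost_potential a (2 * t) \<le> 1 / 16 * (2 * a * (2 * t) ^ 3)"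
    unfolding pot using True assms by (intro mult_right_mono) auto
  then show ?thesis using True c
    by (simp add: cost_potential_def power2_eq_square power3_eq_cube algebra_simps)
next
  case False
  have "q * cost_potential a (2 * t) \<le> 1 * cost_potential a (2 * t)"
    using False assms by (intro mult_right_mono cost_potential_nonneg) auto
  also have "\<dots> \<le> a * (18 - 2 * t)"
  proof (cases "1 \<le> 2 * t")
    case True
    have "t ^ 3 \<le> 1" using False assms by (intro power_le_one) auto
    then have "2 * (2 * t) ^ 3 \<le> 18 - 2 * t" using False by (simp add: power_mult_distrib)
    then have "a * (2 * (2 * t) ^ 3) \<le> a * (18 - 2 * t)" using assms by (intro mult_left_mono)
    then show ?thesis using True by (simp add: cost_potential_def mult_ac)
  qed (simp add: cost_potential_def)
  finally show ?thesis using False c by (simp add: cost_potential_def algebra_simps)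
qed

section \<open>Adjacency probabilities and the split by degree\<close>

context graph
begin

definition edge_density :: real where
  "edge_density = avg_degree V E / real (card V)"

abbreviation adjr :: "nat \<Rightarrow> nat \<Rightarrow> real" where
  "adjr x y \<equiv> of_bool ({x, y} \<in> E)"

lemma expec_U: "expec U f = (\<Sum>x\<in>V. f x) / real (card V)"
  using finite_V V_nonempty by (simp add: integral_pmf_of_set)

lemma sum_adjr: "x \<in> V \<Longrightarrow> (\<Sum>y\<in>V. adjr x y) = real (Defs.degree E x)"
proof -
  have "V \<inter> {y. {x, y} \<in> E} = nbrs E x" using nbrs_subset by (auto simp: nbrs_def)
  then show ?thesis using finite_V by (simp add: degree_def)
qed

lemma expec_adjr: "x \<in> V \<Longrightarrow> expec U (adjr x) = real (Defs.degree E x) / real (card V)"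
  by (simp add: expec_U sum_adjr)

lemma sum_degree_edge_density: "(\<Sum>x\<in>V. real (Defs.degree E x)) = edge_density * (real (card V))\<^sup>2"
proof -
  have "(\<Sum>x\<in>V. real (Defs.degree E x)) = 2 * real (card E)"
    using sum_degree by (simp flip: of_nat_sum)
  then show ?thesis using card_V_pos by (simp add: edge_density_def avg_degree_def power2_eq_square)
qed

lemma edge_density_expec: "expec U (\<lambda>x. expec U (adjr x)) = edge_density"
proof -
  have "expec U (\<lambda>x. expec U (adjr x)) = (\<Sum>x\<in>V. real (Defs.degree E x) / real (card V)) / real (card V)"
    by (simp add: expec_U[of "\<lambda>x. expec U (adjr x)"] expec_adjr)
  then show ?thesis
    using sum_degree_edge_density card_V_pos by (simp add: sum_divide_distrib[symmetric] power2_eq_square)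
qed

text \<open>Every degree is at least 1 because no vertex is isolated. This turns the bound r^2 / n
  on repetitions into r^2 * p, which is controlled by the ratio of the round.\<close>

lemma edge_density_ge: "1 / real (card V) \<le> edge_density"
proof -
  have "(\<Sum>x\<in>V. 1) \<le> (\<Sum>x\<in>V. real (Defs.degree E x))"
    using degree_pos by (intro sum_mono) (simp add: Suc_le_eq[symmetric] del: of_nat_Suc)
  then have "real (card V) \<le> edge_density * (real (card V))\<^sup>2" by (simp add: sum_degree_edge_density)
  then show ?thesis using card_V_pos by (simp add: field_simps power2_eq_square)
qed

lemma edge_density_pos: "0 < edge_density"
  using edge_density_ge card_V_pos by (smt (verit) divide_pos_pos of_nat_0_less_iff)

lemma edge_density_le_1: "edge_density \<le> 1"
proof -
  have "expec U (\<lambda>x. expec U (adjr x)) \<le> expec U (\<lambda>x. 1)"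
  proof (intro expec_mono finite_U)
    fix x
    have "expec U (adjr x) \<le> expec U (\<lambda>y. 1)" by (intro expec_mono finite_U) auto
    then show "expec U (adjr x) \<le> 1" by simp
  qed
  then show ?thesis by (simp add: edge_density_expec)
qed

lemma inverse_edge_density: "real (card V) / avg_degree V E = 1 / edge_density"
  by (simp add: edge_density_def)

definition coin_prob :: "nat option \<Rightarrow> real" where
  "coin_prob c = (case c of None \<Rightarrow> edge_density | Some h \<Rightarrow> real (Defs.degree E h) / real (card V))"

lemma coin_prob_bounds:
  assumes "\<And>h. c = Some h \<Longrightarrow> h \<in> V"
  shows "0 < coin_prob c" "coin_prob c \<le> 1"
  using assms edge_density_pos edge_density_le_1 degree_pos degree_le card_V_pos
  by (auto simp: coin_prob_def split: option.split)

lemma finite_coin: "finite (set_pmf (result (coin ex c)))"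
  by (rule finite_subset[of _ UNIV]) auto

lemma expec_coin:
  assumes "\<And>h. c = Some h \<Longrightarrow> h \<in> V"
  shows "expec (result (coin ex c)) of_bool = coin_prob c"
proof (cases c)
  case None
  then show ?thesis
    using finite_U by (simp add: result_coin coin_prob_def expec_bind o_def edge_density_expec)
next
  case (Some h)
  have "(\<lambda>x. adjr x h) = adjr h" by (simp add: insert_commute)
  then show ?thesis
    using assms by (simp add: Some result_coin coin_prob_def o_def expec_adjr)
qed

lemma hits_sum: "real (hits bs) = (\<Sum>b\<leftarrow>bs. of_bool b)"
  by (induction bs) (simp_all add: hits_def)

lemma coin_markov:
  assumes "\<And>h. c = Some h \<Longrightarrow> h \<in> V" "0 < a"
  shows "measure_pmf.prob (replicate_pmf N (result (coin ex c))) {bs. a \<le> real (hits bs)} \<le> real N * coin_prob c / a"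
proof -
  have "measure_pmf.prob (replicate_pmf N (result (coin ex c))) {bs. a \<le> real (hits bs)}
      \<le> expec (replicate_pmf N (result (coin ex c))) (\<lambda>bs. real (hits bs)) / a"
    using assms(2) by (intro markov_finite finite_replicate_pmf finite_coin) auto
  then show ?thesis
    using assms(1) by (simp add: hits_sum expec_replicate_sum[OF finite_coin] expec_coin)
qed

lemma coin_chebyshev:
  assumes "\<And>h. c = Some h \<Longrightarrow> h \<in> V" "0 < a"
  shows "measure_pmf.prob (replicate_pmf N (result (coin ex c)))
      {bs. a \<le> \<bar>real (hits bs) - real N * coin_prob c\<bar>} \<le> real N * coin_prob c / a\<^sup>2"
proof -
  have sq: "(of_bool b :: real)\<^sup>2 = of_bool b" for b by simp
  have "expec (result (coin ex c)) (\<lambda>b. (of_bool b)\<^sup>2) - (expec (result (coin ex c)) of_bool)\<^sup>2 \<le> coin_prob c"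
    using assms(1) by (simp add: sq expec_coin)
  from chebyshev_replicate[OF finite_coin assms(2) this] show ?thesis
    using assms(1) by (simp add: expec_coin hits_sum)
qed

text \<open>With \<open>2 ^ level 4 edge_density\<close> as r, about sqrt (n / d), this is the
  condition deg v \<ge> n / r.\<close>

definition heavy :: "nat \<Rightarrow> bool" where
  "heavy v \<longleftrightarrow> real (card V) \<le> real (Defs.degree E v) * 2 ^ level 4 edge_density"

definition light_adj :: "nat \<Rightarrow> nat \<Rightarrow> real" where
  "light_adj x y = of_bool ({x, y} \<in> E \<and> \<not> heavy x \<and> \<not> heavy y)"

definition light_density :: real where
  "light_density = expec U (\<lambda>x. expec U (light_adj x))"

lemma level_edge_density: "1 \<le> 4 ^ level 4 edge_density * edge_density" "4 ^ level 4 edge_density * edge_density < 4"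
  using level[of 4 edge_density] edge_density_pos edge_density_le_1 by simp_all

text \<open>A light vertex has adjacency probability at most 1 / r, so the second moment is at most
  1 / r times the first.\<close>

lemma light_square:
  "expec U (\<lambda>x. (expec U (light_adj x))\<^sup>2) \<le> light_density / 2 ^ level 4 edge_density"
proof -
  have "(expec U (light_adj x))\<^sup>2 \<le> 1 / 2 ^ level 4 edge_density * expec U (light_adj x)" if "x \<in> V" for x
  proof -
    have nn: "0 \<le> expec U (light_adj x)"
      by (intro Bochner_Integration.integral_nonneg) (simp add: light_adj_def)
    have "expec U (light_adj x) \<le> 1 / 2 ^ level 4 edge_density"
    proof (cases "heavy x")
      case True
      then have "light_adj x = (\<lambda>y. 0)" by (simp add: light_adj_def fun_eq_iff)
      then show ?thesis by simp
    next
      case False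
      have "expec U (light_adj x) \<le> expec U (adjr x)"
        by (intro expec_mono finite_U) (auto simp: light_adj_def)
      also have "\<dots> \<le> 1 / 2 ^ level 4 edge_density"
        using False card_V_pos that by (simp add: expec_adjr heavy_def field_simps)
      finally show ?thesis .
    qed
    then show ?thesis unfolding power2_eq_square using nn by (rule mult_right_mono)
  qed
  then have "expec U (\<lambda>x. (expec U (light_adj x))\<^sup>2) \<le> expec U (\<lambda>x. 1 / 2 ^ level 4 edge_density * expec U (light_adj x))"
    by (intro expec_mono finite_U) auto
  also have "\<dots> = light_density / 2 ^ level 4 edge_density"
    by (simp only: expec_cmult light_density_def) simp
  finally show ?thesis .
qed

text \<open>
  An edge with a heavy end is found by a probe from its end of smaller degree, unless both ends
  have a degree above \<open>D\<close>; the number of vertices of degree above \<open>D\<close> is so small that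
  even all pairs of them contribute little.
\<close>

lemma prob_probe_heavy:
  assumes "0 < \<epsilon>" "\<epsilon> < 1" and loss: "\<epsilon> / 4 * edge_density \<le> edge_density - light_density"
  shows "\<epsilon>\<^sup>2 / 128 * edge_density * 2 ^ level 4 edge_density \<le> measure_pmf.prob (result probe) {v. heavy v}"
proof -
  let ?n = "real (card V)" and ?d = "\<lambda>x. real (Defs.degree E x)" and ?L = "2 ^ level 4 edge_density :: real"
  \<comment> \<open>Chosen so that the sum of degrees leaves at most n * p * \<epsilon> * r / 8
    vertices above \<open>D\<close>, where r is \<open>?L\<close>; since r^2 * p < 4, their pairs
    number at most an \<epsilon>^2 / 16 fraction of p * n^2.\<close>
  define D where "D = ?n * 8 / (\<epsilon> * ?L)"
  define S where "S = (\<Sum>x\<in>V. \<Sum>y\<in>V. adjr x y * of_bool (heavy y \<and> ?d x \<le> D))"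
  define B where "B = {x \<in> V. D < ?d x}"
  have n: "0 < ?n" using card_V_pos by simp
  have L: "0 < ?L" by simp
  have D: "0 < D" using n assms by (simp add: D_def)
  have finB: "finite B" using finite_V by (simp add: B_def)
  have "real (card B) * D = (\<Sum>x\<in>B. D)" by simp
  also have "\<dots> \<le> (\<Sum>x\<in>B. ?d x)" by (intro sum_mono) (simp add: B_def)
  also have "\<dots> \<le> (\<Sum>x\<in>V. ?d x)" using finite_V by (intro sum_mono2) (auto simp: B_def)
  finally have "real (card B) \<le> edge_density * ?n\<^sup>2 / D"
    using D by (simp add: sum_degree_edge_density field_simps)
  also have "\<dots> = ?n * (edge_density * \<epsilon> * ?L / 8)" using n assms by (simp add: D_def field_simps power2_eq_square)
  finally have "(real (card B))\<^sup>2 \<le> (?n * (edge_density * \<epsilon> * ?L / 8))\<^sup>2"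
    by (rule power_mono) simp
  also have "\<dots> = ?n\<^sup>2 * (edge_density * \<epsilon>\<^sup>2 / 64) * (?L\<^sup>2 * edge_density)"
    by (simp add: power2_eq_square)
  also have "?L\<^sup>2 = 4 ^ level 4 edge_density"
    by (simp add: power2_eq_square flip: power_mult_distrib)
  also have "?n\<^sup>2 * (edge_density * \<epsilon>\<^sup>2 / 64) * (4 ^ level 4 edge_density * edge_density) \<le> ?n\<^sup>2 * (edge_density * \<epsilon>\<^sup>2 / 64) * 4"
    using level_edge_density edge_density_pos by (intro mult_left_mono) auto
  finally have B: "(real (card B))\<^sup>2 \<le> ?n\<^sup>2 * (edge_density * \<epsilon>\<^sup>2 / 16)" by (simp add: mult_ac)
  have dens: "(\<Sum>x\<in>V. \<Sum>y\<in>V. adjr x y) = ?n\<^sup>2 * edge_density"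
    using edge_density_expec n by (simp add: expec_U field_simps power2_eq_square sum_divide_distrib[symmetric])
  have light: "(\<Sum>x\<in>V. \<Sum>y\<in>V. light_adj x y) = ?n\<^sup>2 * light_density"
    using n by (simp add: light_density_def expec_U power2_eq_square sum_divide_distrib[symmetric])
  have "?n\<^sup>2 * edge_density - ?n\<^sup>2 * light_density = (\<Sum>x\<in>V. \<Sum>y\<in>V. adjr x y - light_adj x y)"
    by (simp add: dens light sum_subtractf)
  also have "\<dots> \<le> (\<Sum>x\<in>V. \<Sum>y\<in>V. adjr x y * of_bool (heavy y \<and> ?d x \<le> D) +
      (adjr y x * of_bool (heavy x \<and> ?d y \<le> D) + of_bool (x \<in> B) * of_bool (y \<in> B)))"
  proof (intro sum_mono)
    fix x y assume "x \<in> V" "y \<in> V"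
    \<comment> \<open>If one end is heavy, so is the end of larger degree; it is then the other end
      whose degree has to be at most \<open>D\<close>.\<close>
    have mono: "heavy a \<Longrightarrow> ?d a \<le> ?d b \<Longrightarrow> heavy b" for a b
      unfolding heavy_def by (erule order_trans) (intro mult_right_mono, auto)
    show "adjr x y - light_adj x y \<le> adjr x y * of_bool (heavy y \<and> ?d x \<le> D) +
      (adjr y x * of_bool (heavy x \<and> ?d y \<le> D) + of_bool (x \<in> B) * of_bool (y \<in> B))"
    proof (cases "{x, y} \<in> E \<and> (heavy x \<or> heavy y) \<and> \<not> (x \<in> B \<and> y \<in> B)")
      case True
      then have "?d x \<le> D \<or> ?d y \<le> D" using \<open>x \<in> V\<close> \<open>y \<in> V\<close> by (auto simp: B_def)
      moreover have "heavy y" if "?d x \<le> ?d y" using True mono that by blast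
      moreover have "heavy x" if "?d y \<le> ?d x" using True mono that by blast
      ultimately have "heavy y \<and> ?d x \<le> D \<or> heavy x \<and> ?d y \<le> D" by (cases "?d x \<le> ?d y") auto
      then show ?thesis using True by (auto simp: light_adj_def insert_commute)
    qed (auto simp: light_adj_def)
  qed
  also have "\<dots> = S + (\<Sum>x\<in>V. \<Sum>y\<in>V. adjr y x * of_bool (heavy x \<and> ?d y \<le> D)) +
      (\<Sum>x\<in>V. of_bool (x \<in> B)) * (\<Sum>y\<in>V. of_bool (y \<in> B))"
    by (simp only: sum.distrib S_def sum_distrib_left[symmetric] sum_distrib_right[symmetric])
  also have "(\<Sum>x\<in>V. of_bool (x \<in> B)) = real (card B)"
  proof -
    have "V \<inter> B = B" by (auto simp: B_def)
    then show ?thesis using finite_V by simp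
  qed
  also have "(\<Sum>x\<in>V. \<Sum>y\<in>V. adjr y x * of_bool (heavy x \<and> ?d y \<le> D)) = S"
    unfolding S_def by (rule sum.swap)
  finally have "?n\<^sup>2 * edge_density - ?n\<^sup>2 * light_density \<le> 2 * S + (real (card B))\<^sup>2"
    by (simp add: power2_eq_square)
  moreover have "?n\<^sup>2 * (\<epsilon> / 4 * edge_density) \<le> ?n\<^sup>2 * (edge_density - light_density)"
    using loss by (intro mult_left_mono) auto
  moreover have "?n\<^sup>2 * (edge_density * \<epsilon>\<^sup>2 / 16) \<le> ?n\<^sup>2 * (edge_density * \<epsilon> / 16)"
    using assms edge_density_pos
    by (intro mult_left_mono divide_right_mono) (auto simp: power2_eq_square)
  moreover have "?n\<^sup>2 * (\<epsilon> / 4 * edge_density) = 4 * (?n\<^sup>2 * (edge_density * \<epsilon> / 16))" by simp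
  moreover have "?n\<^sup>2 * (edge_density - light_density) = ?n\<^sup>2 * edge_density - ?n\<^sup>2 * light_density"
    by (rule right_diff_distrib)
  moreover have "0 \<le> ?n\<^sup>2 * (edge_density * \<epsilon> / 16)" using assms edge_density_pos by simp
  ultimately have S: "?n\<^sup>2 * (edge_density * \<epsilon> / 16) \<le> S"
    using B by linarith
  have "\<epsilon>\<^sup>2 / 128 * edge_density * ?L = ?n\<^sup>2 * (edge_density * \<epsilon> / 16) / (?n * D)"
    using n assms by (simp add: D_def field_simps power2_eq_square)
  also have "\<dots> \<le> S / (?n * D)"
    using S n D by (intro divide_right_mono) auto
  also have "\<dots> = (\<Sum>x\<in>V. (\<Sum>y\<in>V. adjr x y * of_bool (heavy y \<and> ?d x \<le> D)) / D) / ?n"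
    by (simp add: S_def sum_divide_distrib mult.commute)
  \<comment> \<open>A probe through x takes a given neighbour with probability 1 / deg x, which is
    at least 1 / D for the vertices counted in \<open>S\<close>.\<close>
  also have "\<dots> \<le> (\<Sum>x\<in>V. (\<Sum>y\<in>V. adjr x y * of_bool (heavy y)) / ?d x) / ?n"
  proof (intro divide_right_mono sum_mono)
    fix x assume "x \<in> V"
    show "(\<Sum>y\<in>V. adjr x y * of_bool (heavy y \<and> ?d x \<le> D)) / D \<le> (\<Sum>y\<in>V. adjr x y * of_bool (heavy y)) / ?d x"
    proof (cases "?d x \<le> D")
      case True
      then show ?thesis using degree_pos[OF \<open>x \<in> V\<close>] D by (auto intro!: divide_left_mono sum_nonneg)
    qed (auto intro!: divide_nonneg_nonneg sum_nonneg)
  qed simp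
  also have "\<dots> = (\<Sum>x\<in>V. measure_pmf.prob (pmf_of_set (nbrs E x)) {v. heavy v}) / ?n"
  proof (intro arg_cong2[of _ _ _ _ "(/)"] sum.cong refl)
    fix x assume x: "x \<in> V"
    have "(\<Sum>y\<in>V. adjr x y * of_bool (heavy y)) = (\<Sum>y\<in>V. of_bool (y \<in> nbrs E x \<inter> {v. heavy v}))"
      by (intro sum.cong) (auto simp: nbrs_def)
    also have "\<dots> = real (card (nbrs E x \<inter> {v. heavy v}))"
    proof -
      have "V \<inter> {y \<in> nbrs E x. heavy y} = nbrs E x \<inter> {v. heavy v}" using nbrs_subset by auto
      then show ?thesis using finite_V by simp
    qed
    finally show "(\<Sum>y\<in>V. adjr x y * of_bool (heavy y)) / ?d x = measure_pmf.prob (pmf_of_set (nbrs E x)) {v. heavy v}"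
      using nbrs_nonempty[OF x] by (simp add: measure_pmf_of_set degree_def)
  qed
  also have "\<dots> = measure_pmf.prob (result probe) {v. heavy v}"
  proof -
    have "measure_pmf.prob (result probe) {v. heavy v} = expec (result probe) (indicator {v. heavy v})"
      by simp
    also have "\<dots> = expec U (\<lambda>x. expec (pmf_of_set (nbrs E x)) (indicator {v. heavy v}))"
      unfolding result_probe using nbrs_nonempty by (intro expec_bind finite_U) auto
    finally show ?thesis by (simp add: expec_U)
  qed
  finally show ?thesis .
qed

end

section \<open>Estimating the bias of a coin\<close>

datatype state = Coin "nat option" nat | Phase nat

text \<open>Stopping requires at least G / 2 hits, which both rules out division by zero and forces
  the sample to have about the right size.\<close>

definition coin_round :: "extra_oracle \<Rightarrow> nat \<Rightarrow> nat option \<Rightarrow> nat \<Rightarrow> (state + estimate) prog" where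
  "coin_round ex G c j = do {
     bs \<leftarrow> repeat_prog (G * 2 ^ j) (coin ex c);
     if G \<le> 2 * hits bs
     then (case c of
         None \<Rightarrow> Ret (Inr (Est_rho (real (G * 2 ^ j) / real (hits bs))))
       | Some h \<Rightarrow> Deg h (\<lambda>d. Ret (Inr (Est_n (real d * (real (G * 2 ^ j) / real (hits bs)))))))
     else Ret (Inl (Coin c (Suc j))) }"

locale estimation = graph +
  fixes \<epsilon> :: real and G :: nat
  assumes \<epsilon>: "0 < \<epsilon>" "\<epsilon> < 1" and G: "2 ^ 24 \<le> \<epsilon>\<^sup>2 * real G"
begin

text \<open>Sample size over right size, rounded to a power of two so that it doubles exactly and
  starts at most at 1.\<close>

definition coin_ratio :: "nat option \<Rightarrow> nat \<Rightarrow> real" where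
  "coin_ratio c j = 2 ^ j / 2 ^ level 2 (coin_prob c)"

definition phase_ratio :: "nat \<Rightarrow> real" where
  "phase_ratio k = 2 ^ k / 2 ^ level 4 edge_density"

text \<open>The constant in the \<open>Phase\<close> case is the largest error of a coin estimation
  from its start; it is held in reserve for the one commitment that may come.\<close>

fun error_bound :: "state \<Rightarrow> ennreal" where
  "error_bound (Coin c j) = ennreal (error_potential (1 / 2 ^ 22) (coin_ratio c j))"
| "error_bound (Phase k) = ennreal (1 / 16 + 256 / 2 ^ 22 + error_potential (3200 / 2 ^ 24) (phase_ratio k))"

fun cost_bound :: "state \<Rightarrow> ennreal" where
  "cost_bound (Coin c j) = ennreal (cost_potential (5 * real G * 2 ^ level 2 (coin_prob c)) (coin_ratio c j))"
| "cost_bound (Phase k) = ennreal (cost_potential (50000 * real G * 2 ^ level 4 edge_density) (phase_ratio k))"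

definition wrong :: "estimate \<Rightarrow> ennreal" where
  "wrong r = indicator (- correct_estimates \<epsilon> V E) r"

abbreviation valid_coin :: "nat option \<Rightarrow> bool" where
  "valid_coin c \<equiv> \<forall>h. c = Some h \<longrightarrow> h \<in> V"

lemma eps_sq: "0 < \<epsilon>\<^sup>2" "\<epsilon>\<^sup>2 < 1"
proof -
  have "\<epsilon> * \<epsilon> < 1 * 1" using \<epsilon> by (intro mult_strict_mono) auto
  then show "0 < \<epsilon>\<^sup>2" "\<epsilon>\<^sup>2 < 1" using \<epsilon> by (auto simp: power2_eq_square)
qed

lemma G_ge: "2 ^ 24 \<le> real G"
proof -
  have "\<epsilon>\<^sup>2 * real G \<le> 1 * real G" using eps_sq by (intro mult_right_mono) auto
  then show ?thesis using G by linarith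
qed

lemma G_pos: "0 < G" "0 < real G"
  using G_ge by auto

lemma coin_ratio: "0 < coin_ratio c j" "coin_ratio c (Suc j) = 2 * coin_ratio c j"
  by (simp_all add: coin_ratio_def)

lemma phase_ratio: "0 < phase_ratio k" "phase_ratio (Suc k) = 2 * phase_ratio k"
  by (simp_all add: phase_ratio_def)

definition coin_estimate :: "nat option \<Rightarrow> real \<Rightarrow> estimate" where
  "coin_estimate c x = (case c of None \<Rightarrow> Est_rho x | Some h \<Rightarrow> Est_n (real (Defs.degree E h) * x))"

lemma result_coin_round:
  "result (coin_round ex G c j) = map_pmf (\<lambda>bs.
     if G \<le> 2 * hits bs then Inr (coin_estimate c (real (G * 2 ^ j) / real (hits bs))) else Inl (Coin c (Suc j)))
     (replicate_pmf (G * 2 ^ j) (result (coin ex c)))"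
  unfolding coin_round_def result_bind result_repeat map_pmf_def
  by (intro bind_pmf_cong refl) (auto simp: coin_estimate_def split: option.split)

lemma ok_coin_round:
  assumes "\<And>h. c = Some h \<Longrightarrow> h \<in> K"
  shows "ok ex K (coin_round ex G c j) (\<lambda>K' r. r = Inl (Coin c (Suc j)) \<or> isl r = False)"
  unfolding coin_round_def
proof (rule ok_bindI[OF ok_repeat])
  show "ok ex K' (coin ex c) (\<lambda>_ _. True)" if "K \<subseteq> K'" for K'
    by (rule ok_coin) (use that assms in auto)
qed (use assms in \<open>auto split: option.split\<close>)

lemma ecost_coin_round:
  "1 \<le> ecost (coin_round ex G c j)" "ecost (coin_round ex G c j) \<le> ennreal (5 * real (G * 2 ^ j))"
proof -
  let ?N = "G * 2 ^ j" and ?R = "result (repeat_prog (G * 2 ^ j) (coin ex c))"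
  let ?f = "\<lambda>bs. ecost (if G \<le> 2 * hits bs
     then (case c of
         None \<Rightarrow> Ret (Inr (Est_rho (real ?N / real (hits bs))))
       | Some h \<Rightarrow> Deg h (\<lambda>d. Ret (Inr (Est_n (real d * (real ?N / real (hits bs)))))))
     else Ret (Inl (Coin c (Suc j))) :: (state + estimate) prog)"
  have N: "1 \<le> ?N" using G_pos by simp
  have "1 * 1 \<le> (of_nat ?N :: ennreal) * ecost (coin ex c)"
    using N ecost_coin(1) of_nat_mono[OF N] by (intro mult_mono) auto
  then show "1 \<le> ecost (coin_round ex G c j)"
    unfolding coin_round_def ecost_bind ecost_repeat by (simp add: add_increasing2)
  have "(\<integral>\<^sup>+ bs. ?f bs \<partial>?R) \<le> (\<integral>\<^sup>+ bs. 1 \<partial>?R)"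
    by (intro nn_integral_mono) (auto split: option.split)
  then have "ecost (coin_round ex G c j) \<le> of_nat ?N * 4 + 1"
    unfolding coin_round_def ecost_bind ecost_repeat
    by (intro add_mono mult_left_mono ecost_coin) auto
  also have "\<dots> = of_nat (?N * 4 + 1)" by simp
  also have "\<dots> = ennreal (real ?N * 4 + 1)"
    by (simp only: ennreal_of_nat_eq_real_of_nat) simp
  also have "\<dots> \<le> ennreal (5 * real ?N)"
    using N by (intro ennreal_leI) linarith
  finally show "ecost (coin_round ex G c j) \<le> ennreal (5 * real ?N)" .
qed

context
  fixes ex :: extra_oracle and c :: "nat option" and j :: nat
  assumes c: "valid_coin c"
begin

private abbreviation "R \<equiv> replicate_pmf (G * 2 ^ j) (result (coin ex c))"
private abbreviation "\<mu> \<equiv> real (G * 2 ^ j) * coin_prob c"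
private abbreviation "t \<equiv> coin_ratio c j"
private abbreviation "far \<equiv> {bs. \<epsilon> / 2 * \<mu> \<le> \<bar>real (hits bs) - \<mu>\<bar>}"

private lemma mean_bounds: "real G * t \<le> \<mu>" "\<mu> \<le> 2 * (real G * t)"
proof -
  let ?L = "2 ^ level 2 (coin_prob c) :: real"
  have p: "0 < coin_prob c" "coin_prob c \<le> 1" using coin_prob_bounds c by auto
  have *: "\<mu> = real G * t * (?L * coin_prob c)" by (simp add: coin_ratio_def)
  have B: "1 \<le> ?L * coin_prob c" "?L * coin_prob c \<le> 2" using level[of 2 "coin_prob c"] p by auto
  have "0 \<le> real G * t" using coin_ratio(1)[of c j] by simp
  from mult_left_mono[OF B(1) this] mult_left_mono[OF B(2) this]
  show "real G * t \<le> \<mu>" "\<mu> \<le> 2 * (real G * t)" unfolding * by auto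
qed

private lemma mean_pos: "0 < \<mu>"
  using mean_bounds(1) G_pos coin_ratio(1)[of c j] by (smt (verit) mult_pos_pos)

text \<open>Chebyshev with relative deviation \<epsilon> / 2: the bound 4 / (\<epsilon>^2 * \<mu>)
  becomes 4 / (2^24 * t), the origin of the 2^22 in the potential.\<close>

private lemma prob_far: "measure_pmf.prob R far \<le> 1 / 2 ^ 22 / t"
proof -
  have "measure_pmf.prob R far \<le> \<mu> / (\<epsilon> / 2 * \<mu>)\<^sup>2"
    using c \<epsilon> mean_pos by (intro coin_chebyshev) auto
  also have "\<dots> = 4 / (\<epsilon>\<^sup>2 * \<mu>)" using mean_pos \<epsilon> by (simp add: field_simps power2_eq_square)
  also have "\<dots> \<le> 4 / (2 ^ 24 * t)"
  proof (rule divide_left_mono)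
    have "2 ^ 24 * t \<le> \<epsilon>\<^sup>2 * real G * t" using G coin_ratio(1)[of c j] by (intro mult_right_mono) auto
    also have "\<dots> \<le> \<epsilon>\<^sup>2 * \<mu>" using mean_bounds(1) eps_sq by (simp add: mult.assoc mult_left_mono)
    finally show "2 ^ 24 * t \<le> \<epsilon>\<^sup>2 * \<mu>" .
    show "0 < \<epsilon>\<^sup>2 * \<mu> * (2 ^ 24 * t)"
      by (rule mult_pos_pos[OF mult_pos_pos[OF eps_sq(1) mean_pos]]) (use coin_ratio(1) in simp)
  qed simp
  finally show ?thesis by simp
qed

text \<open>The estimate is a reciprocal of the hit count: accuracy \<epsilon> / 2 before inversion
  gives \<epsilon> after it, because (1 - \<epsilon>) * (1 + \<epsilon> / 2) \<le> 1 \<le> (1 +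
  \<epsilon>) * (1 - \<epsilon> / 2).\<close>

private lemma estimate_correct:
  assumes "bs \<notin> far"
  shows "coin_estimate c (real (G * 2 ^ j) / real (hits bs)) \<in> correct_estimates \<epsilon> V E"
proof -
  let ?N = "real (G * 2 ^ j)" and ?h = "real (hits bs)"
  have p: "0 < coin_prob c" using coin_prob_bounds c by auto
  have N: "0 < ?N" using G_pos by simp
  have h: "(1 - \<epsilon> / 2) * \<mu> < ?h" "?h < (1 + \<epsilon> / 2) * \<mu>"
  proof -
    have "\<bar>?h - \<mu>\<bar> < \<epsilon> / 2 * \<mu>" using assms by (simp only: mem_Collect_eq not_le)
    then show "(1 - \<epsilon> / 2) * \<mu> < ?h" "?h < (1 + \<epsilon> / 2) * \<mu>"
      unfolding left_diff_distrib distrib_right by linarith+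
  qed
  have "0 < (1 - \<epsilon> / 2) * \<mu>" by (rule mult_pos_pos[OF _ mean_pos]) (use \<epsilon> in simp)
  then have h_pos: "0 < ?h" using h by linarith
  have e1: "(1 - \<epsilon>) * (1 + \<epsilon> / 2) = 1 - \<epsilon> / 2 - \<epsilon>\<^sup>2 / 2"
    and e2: "(1 + \<epsilon>) * (1 - \<epsilon> / 2) = 1 + \<epsilon> / 2 - \<epsilon>\<^sup>2 / 2"
    by (simp_all add: field_simps power2_eq_square)
  have "(1 - \<epsilon>) * ?h \<le> (1 - \<epsilon>) * ((1 + \<epsilon> / 2) * \<mu>)" using h \<epsilon> by (intro mult_left_mono) auto
  also have "\<dots> = (1 - \<epsilon> / 2 - \<epsilon>\<^sup>2 / 2) * \<mu>"
    by (simp only: e1 mult.assoc[symmetric])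
  also have "\<dots> \<le> 1 * \<mu>"
    using mean_pos \<epsilon> zero_le_power2[of \<epsilon>] by (intro mult_right_mono) linarith+
  finally have 1: "(1 - \<epsilon>) * ?h \<le> \<mu>" by simp
  have "\<epsilon>\<^sup>2 \<le> \<epsilon>" using \<epsilon> by (simp add: power2_eq_square)
  then have "1 * \<mu> \<le> (1 + \<epsilon> / 2 - \<epsilon>\<^sup>2 / 2) * \<mu>" using mean_pos by (intro mult_right_mono) auto
  also have "\<dots> = (1 + \<epsilon>) * ((1 - \<epsilon> / 2) * \<mu>)"
    by (simp only: e2 mult.assoc[symmetric])
  also have "\<dots> \<le> (1 + \<epsilon>) * ?h" using h \<epsilon> by (intro mult_left_mono) auto
  finally have 2: "\<mu> \<le> (1 + \<epsilon>) * ?h" by simp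
  have est: "(1 - \<epsilon>) * (1 / coin_prob c) \<le> ?N / ?h" "?N / ?h \<le> (1 + \<epsilon>) * (1 / coin_prob c)"
    using 1 2 h_pos p by (simp_all add: field_simps)
  show ?thesis
  proof (cases c)
    case None
    then show ?thesis using est
      by (simp add: coin_estimate_def correct_estimates_def approx_def coin_prob_def inverse_edge_density)
  next
    case (Some h)
    then have d: "0 < real (Defs.degree E h)" using c degree_pos by auto
    have e: "real (Defs.degree E h) * (1 / coin_prob c) = real (card V)"
      using Some d by (simp add: coin_prob_def)
    have "(1 - \<epsilon>) * real (card V) \<le> real (Defs.degree E h) * (?N / ?h)"
      "real (Defs.degree E h) * (?N / ?h) \<le> (1 + \<epsilon>) * real (card V)"
      using mult_left_mono[OF est(1), of "real (Defs.degree E h)"] mult_left_mono[OF est(2), of "real (Defs.degree E h)"] d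
      unfolding mult.left_commute[of "real (Defs.degree E h)" _ "1 / coin_prob c"] e by auto
    then have "real (Defs.degree E h) * (?N / ?h) \<in> approx \<epsilon> (real (card V))"
      unfolding approx_def by (simp only: atLeastAtMost_iff)
    then show ?thesis unfolding Some coin_estimate_def option.case correct_estimates_def by blast
  qed
qed

text \<open>For small t stopping at all is unlikely: it needs G / 2 hits against a mean of at most 2
  * G * t, so Markov gives 4 * t.\<close>

private lemma prob_wrong:
  "measure_pmf.prob R {bs. G \<le> 2 * hits bs \<and> coin_estimate c (real (G * 2 ^ j) / real (hits bs)) \<notin> correct_estimates \<epsilon> V E}
   \<le> (if 1 / 128 \<le> t then 1 / 2 ^ 22 / t else 4 * t)"
proof (cases "1 / 128 \<le> t")
  case True
  have "{bs. G \<le> 2 * hits bs \<and> coin_estimate c (real (G * 2 ^ j) / real (hits bs)) \<notin> correct_estimates \<epsilon> V E} \<subseteq> far"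
    using estimate_correct by blast
  then have "measure_pmf.prob R {bs. G \<le> 2 * hits bs \<and> coin_estimate c (real (G * 2 ^ j) / real (hits bs)) \<notin> correct_estimates \<epsilon> V E}
      \<le> measure_pmf.prob R far"
    by (intro measure_pmf.finite_measure_mono) auto
  then show ?thesis using True prob_far by simp
next
  case False
  have "measure_pmf.prob R {bs. G \<le> 2 * hits bs \<and> coin_estimate c (real (G * 2 ^ j) / real (hits bs)) \<notin> correct_estimates \<epsilon> V E}
      \<le> measure_pmf.prob R {bs. real G / 2 \<le> real (hits bs)}"
    by (intro measure_pmf.finite_measure_mono) auto
  also have "\<dots> \<le> \<mu> / (real G / 2)" using c G_pos by (intro coin_markov) auto
  also have "\<dots> \<le> 4 * t" using mean_bounds(2) G_pos by (simp add: field_simps)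
  finally show ?thesis using False by simp
qed

text \<open>For t at least 1 the mean is at least G, so fewer than G / 2 hits is already a deviation
  by half of the mean.\<close>

private lemma prob_continue: "measure_pmf.prob R {bs. \<not> G \<le> 2 * hits bs} \<le> (if 1 \<le> t then 1 / 16 else 1)"
proof (cases "1 \<le> t")
  case True
  have "{bs. \<not> G \<le> 2 * hits bs} \<subseteq> far"
  proof
    fix bs assume "bs \<in> {bs. \<not> G \<le> 2 * hits bs}"
    then have "2 * real (hits bs) < real G" by simp
    also have "real G \<le> \<mu>" using mean_bounds(1) True G_pos by (smt (verit) mult_le_cancel_left1)
    finally have "2 * real (hits bs) < \<mu>" .
    moreover have "\<epsilon> * \<mu> \<le> 1 * \<mu>" using \<epsilon> mean_pos by (intro mult_right_mono) auto
    ultimately show "bs \<in> far" by simp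
  qed
  then have "measure_pmf.prob R {bs. \<not> G \<le> 2 * hits bs} \<le> measure_pmf.prob R far"
    by (intro measure_pmf.finite_measure_mono) auto
  also have "\<dots> \<le> 1 / 2 ^ 22 / t" by (rule prob_far)
  also have "\<dots> \<le> 1 / 2 ^ 22 / 1" using True by (intro divide_left_mono) auto
  finally show ?thesis using True by simp
qed simp

lemma coin_round_error: "expect_next error_bound wrong (coin_round ex G c j) \<le> error_bound (Coin c j)"
proof -
  let ?W = "{bs. G \<le> 2 * hits bs \<and> coin_estimate c (real (G * 2 ^ j) / real (hits bs)) \<notin> correct_estimates \<epsilon> V E}"
  have nn: "0 \<le> error_potential (1 / 2 ^ 22) (coin_ratio c (Suc j))"
    using coin_ratio(1) by (intro error_potential_nonneg) auto
  have "expect_next error_bound wrong (coin_round ex G c j)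
      \<le> (\<integral>\<^sup>+ bs. indicator ?W bs + error_bound (Coin c (Suc j)) \<partial>R)"
    unfolding result_coin_round nn_integral_map_pmf
    by (intro nn_integral_mono) (auto simp: wrong_def indicator_def)
  also have "\<dots> = ennreal (measure_pmf.prob R ?W + error_potential (1 / 2 ^ 22) (coin_ratio c (Suc j)))"
    using nn by (simp add: nn_integral_add measure_pmf.emeasure_eq_measure)
  also have "\<dots> \<le> error_bound (Coin c j)"
    unfolding error_bound.simps coin_ratio(2)
    using prob_wrong coin_ratio(1) by (intro ennreal_leI error_potential_step) auto
  finally show ?thesis .
qed

lemma coin_round_cost:
  "ecost (coin_round ex G c j) + expect_next cost_bound (\<lambda>_. 0) (coin_round ex G c j) \<le> cost_bound (Coin c j)"
proof -
  let ?a = "5 * real G * 2 ^ level 2 (coin_prob c)"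
  let ?C = "{bs. \<not> G \<le> 2 * hits bs}"
  have nn: "0 \<le> cost_potential ?a (coin_ratio c (Suc j))"
    using coin_ratio(1) by (intro cost_potential_nonneg) auto
  have "expect_next cost_bound (\<lambda>_. 0) (coin_round ex G c j)
      = (\<integral>\<^sup>+ bs. indicator ?C bs * cost_bound (Coin c (Suc j)) \<partial>R)"
    unfolding result_coin_round nn_integral_map_pmf
    by (intro nn_integral_cong) (auto simp: indicator_def)
  also have "\<dots> = ennreal (measure_pmf.prob R ?C * cost_potential ?a (coin_ratio c (Suc j)))"
    by (simp add: nn_integral_multc measure_pmf.emeasure_eq_measure ennreal_mult')
  finally have "ecost (coin_round ex G c j) + expect_next cost_bound (\<lambda>_. 0) (coin_round ex G c j)
      \<le> ennreal (5 * real (G * 2 ^ j)) + ennreal (measure_pmf.prob R ?C * cost_potential ?a (coin_ratio c (Suc j)))"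
    using ecost_coin_round(2)[of ex c j] by (simp add: add_right_mono del: of_nat_mult of_nat_power)
  also have "\<dots> = ennreal (5 * real (G * 2 ^ j) + measure_pmf.prob R ?C * cost_potential ?a (coin_ratio c (Suc j)))"
    using nn by (intro ennreal_plus[symmetric] mult_nonneg_nonneg) auto
  also have "\<dots> \<le> cost_bound (Coin c j)"
    unfolding cost_bound.simps coin_ratio(2)
  proof (intro ennreal_leI cost_potential_step coin_ratio(1) prob_continue)
    have "5 * real (G * 2 ^ j) = ?a * t * 1" by (simp add: coin_ratio_def)
    also have "\<dots> \<le> ?a * t * (1 + (if 1 \<le> t then t\<^sup>2 - 1 else 0))"
      using coin_ratio(1)[of c j] by (intro mult_left_mono) (auto simp: one_le_power)
    finally show "5 * real (G * 2 ^ j) \<le> ?a * t * (1 + (if 1 \<le> t then t\<^sup>2 - 1 else 0))" .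
  qed auto
  finally show ?thesis .
qed

end

end

section \<open>A round with the additive oracle\<close>

definition observed :: "nat list \<Rightarrow> (nat list \<times> nat list) list \<Rightarrow> nat list" where
  "observed ps gs = ps @ concat (map (\<lambda>(xs, ys). xs @ ys) gs)"

text \<open>The test on \<open>hits\<close> comes before the pair count is used, so a count spoiled
  by a recognised heavy vertex is discarded. Its threshold G / 256 is half of G / 128, the least
  mean of a heavy hub at ratio 1/128.\<close>

definition phase_round :: "extra_oracle \<Rightarrow> nat \<Rightarrow> nat \<Rightarrow> (state + estimate) prog" where
  "phase_round ex G k = do {
     ps \<leftarrow> repeat_prog (G * 2 ^ k) probe;
     gs \<leftarrow> repeat_prog G (group (2 ^ k));
     zs \<leftarrow> map_prog (\<lambda>(xs, ys). pair_count xs ys) gs;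
     h \<leftarrow> max_degree (observed ps gs);
     bs \<leftarrow> repeat_prog (G * 2 ^ k) (coin ex (Some h));
     Ret (if G \<le> 256 * hits bs then Inl (Coin (Some h) 0)
          else if G \<le> 2 * sum_list zs then Inr (Est_rho (real (G * 4 ^ k) / real (sum_list zs)))
          else Inl (Phase (Suc k))) }"

lemma prob_bind_pmf_le:
  assumes "\<And>x. x \<in> set_pmf p \<Longrightarrow> measure_pmf.prob (f x) A \<le> b"
  shows "measure_pmf.prob (bind_pmf p f) A \<le> b"
proof -
  obtain x where "x \<in> set_pmf p" using set_pmf_not_empty[of p] by blast
  then have "0 \<le> b" using assms[of x] measure_nonneg[of "f x" A] by linarith
  have "emeasure (bind_pmf p f) A = (\<integral>\<^sup>+ x. emeasure (f x) A \<partial>p)"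
    by (rule emeasure_bind_pmf)
  also have "\<dots> \<le> (\<integral>\<^sup>+ x. ennreal b \<partial>p)"
    using assms \<open>0 \<le> b\<close> by (intro nn_integral_mono_AE AE_pmfI) (simp add: measure_pmf.emeasure_eq_measure)
  finally show ?thesis using \<open>0 \<le> b\<close> by (simp add: measure_pmf.emeasure_eq_measure)
qed

lemma nn_integral_replicate_sum:
  "(\<integral>\<^sup>+ xs. (\<Sum>x\<leftarrow>xs. f x) \<partial>replicate_pmf n p) = of_nat n * (\<integral>\<^sup>+ x. f x \<partial>measure_pmf p)"
  by (induction n) (simp_all add: nn_integral_add distrib_right)

lemma sum_list_mono_ennreal:
  "(\<And>x. x \<in> set xs \<Longrightarrow> f x \<le> g x) \<Longrightarrow> (\<Sum>x\<leftarrow>xs. f x :: ennreal) \<le> (\<Sum>x\<leftarrow>xs. g x)"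
  by (induction xs) (auto intro: add_mono)

lemma nn_integral_expec:
  assumes "finite (set_pmf p)" "\<And>x. 0 \<le> f x"
  shows "(\<integral>\<^sup>+ x. ennreal (f x) \<partial>measure_pmf p) = ennreal (expec p f)"
  using assms by (intro nn_integral_eq_integral integrable_measure_pmf_finite) auto

context estimation
begin

definition round_pairs :: "(nat list \<times> nat list) list \<Rightarrow> nat" where
  "round_pairs gs = (\<Sum>(xs, ys)\<leftarrow>gs. pair_sum xs ys)"

definition decide :: "nat \<Rightarrow> nat list \<times> (nat list \<times> nat list) list \<times> bool list \<Rightarrow> state + estimate" where
  "decide k = (\<lambda>(ps, gs, bs).
     if G \<le> 256 * hits bs then Inl (Coin (Some (hub (observed ps gs))) 0)
     else if G \<le> 2 * round_pairs gs then Inr (Est_rho (real (G * 4 ^ k) / real (round_pairs gs)))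
     else Inl (Phase (Suc k)))"

definition round_vertices :: "nat \<Rightarrow> (nat list \<times> (nat list \<times> nat list) list) pmf" where
  "round_vertices k = pair_pmf (replicate_pmf (G * 2 ^ k) (result probe)) (replicate_pmf G (result (group (2 ^ k))))"

definition hub_hits :: "extra_oracle \<Rightarrow> nat \<Rightarrow> nat \<Rightarrow> bool list pmf" where
  "hub_hits ex k h = replicate_pmf (G * 2 ^ k) (result (coin ex (Some h)))"

definition round_sample :: "extra_oracle \<Rightarrow> nat \<Rightarrow> (nat list \<times> (nat list \<times> nat list) list \<times> bool list) pmf" where
  "round_sample ex k = bind_pmf (round_vertices k) (\<lambda>(ps, gs).
     map_pmf (\<lambda>bs. (ps, gs, bs)) (hub_hits ex k (hub (observed ps gs))))"

lemma set_group: "(xs, ys) \<in> set_pmf (result (group r)) \<Longrightarrow>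
    length xs = r \<and> length ys = r \<and> set xs \<subseteq> V \<and> set ys \<subseteq> V"
  by (auto simp: result_group set_replicate_pmf lists_eq_set)

lemma round_vertices_support:
  assumes "(ps, gs) \<in> set_pmf (round_vertices k)"
  shows "observed ps gs \<noteq> []" "set (observed ps gs) \<subseteq> V" "length ps = G * 2 ^ k" "length gs = G"
    "\<And>xs ys. (xs, ys) \<in> set gs \<Longrightarrow> length xs = 2 ^ k \<and> length ys = 2 ^ k"
    "length (observed ps gs) = G * 2 ^ k + G * (2 * 2 ^ k)"
proof -
  have ps: "set ps \<subseteq> V" "length ps = G * 2 ^ k"
    using assms set_probe by (auto simp: round_vertices_def set_replicate_pmf lists_eq_set)
  have gs: "set gs \<subseteq> set_pmf (result (group (2 ^ k)))" "length gs = G"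
    using assms by (auto simp: round_vertices_def set_replicate_pmf lists_eq_set)
  show "length ps = G * 2 ^ k" "length gs = G" by fact+
  show groups: "length xs = 2 ^ k \<and> length ys = 2 ^ k" if "(xs, ys) \<in> set gs" for xs ys
    using set_group that gs by blast
  have "set (xs @ ys) \<subseteq> V" if "(xs, ys) \<in> set gs" for xs ys
    using set_group that gs by fastforce
  then show "set (observed ps gs) \<subseteq> V" using ps by (fastforce simp: observed_def)
  show "observed ps gs \<noteq> []" using ps G_pos by (auto simp: observed_def)
  have "length (concat (map (\<lambda>(xs, ys). xs @ ys) gs)) = length gs * (2 * 2 ^ k)"
    using groups by (induction gs) fastforce+
  then show "length (observed ps gs) = G * 2 ^ k + G * (2 * 2 ^ k)"
    using ps gs by (simp add: observed_def)
qed

lemma hub_in_V: "(ps, gs) \<in> set_pmf (round_vertices k) \<Longrightarrow> hub (observed ps gs) \<in> V"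
  using round_vertices_support(1,2) hub(1) by blast

lemma result_map_pair_count:
  "result (map_prog (\<lambda>(xs, ys). pair_count xs ys) gs) = return_pmf (map (\<lambda>(xs, ys). pair_sum xs ys) gs)"
  by (rule result_map_prog) (auto simp: result_pair_count)

lemma result_phase_round: "result (phase_round ex G k) = map_pmf (decide k) (round_sample ex k)"
proof -
  have "result (phase_round ex G k) = bind_pmf (round_vertices k) (\<lambda>(ps, gs).
      result (max_degree (observed ps gs)) \<bind> (\<lambda>h. hub_hits ex k h \<bind> (\<lambda>bs. return_pmf
       (if G \<le> 256 * hits bs then Inl (Coin (Some h) 0)
        else if G \<le> 2 * round_pairs gs then Inr (Est_rho (real (G * 4 ^ k) / real (round_pairs gs)))
        else Inl (Phase (Suc k))))))"
    unfolding phase_round_def result_bind result_repeat result_map_pair_count round_vertices_def pair_pmf_def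
      bind_assoc_pmf bind_return_pmf case_prod_conv round_pairs_def hub_hits_def result.simps ..
  also have "\<dots> = bind_pmf (round_vertices k) (\<lambda>(ps, gs). map_pmf (\<lambda>bs. decide k (ps, gs, bs))
      (hub_hits ex k (hub (observed ps gs))))"
  proof (intro bind_pmf_cong refl, clarify)
    fix ps gs assume "(ps, gs) \<in> set_pmf (round_vertices k)"
    from hub(2)[OF round_vertices_support(1)[OF this]]
    show "result (max_degree (observed ps gs)) \<bind> (\<lambda>h. hub_hits ex k h \<bind> (\<lambda>bs. return_pmf
       (if G \<le> 256 * hits bs then Inl (Coin (Some h) 0)
        else if G \<le> 2 * round_pairs gs then Inr (Est_rho (real (G * 4 ^ k) / real (round_pairs gs)))
        else Inl (Phase (Suc k))))) = map_pmf (\<lambda>bs. decide k (ps, gs, bs)) (hub_hits ex k (hub (observed ps gs)))"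
      by (simp add: bind_return_pmf map_pmf_def decide_def)
  qed
  also have "\<dots> = map_pmf (decide k) (round_sample ex k)"
    by (simp add: round_sample_def map_bind_pmf case_prod_unfold pmf.map_comp o_def)
  finally show ?thesis .
qed

lemma ok_phase_round:
  "ok Additive_Oracle K (phase_round Additive_Oracle G k) (\<lambda>K'. case_sum
     (\<lambda>s. case s of Coin c j \<Rightarrow> (\<forall>h. c = Some h \<longrightarrow> h \<in> K' \<and> h \<in> V) | Phase _ \<Rightarrow> True) (\<lambda>_. True))"
proof -
  note gr = G_pos(1)
  have probes: "ok Additive_Oracle K (repeat_prog (G * 2 ^ k) probe)
      (\<lambda>K' ps. (\<forall>x\<in>set ps. x \<in> K' \<and> x \<in> V) \<and> ps \<noteq> [])" for K
  proof -
    have "ok Additive_Oracle K (repeat_prog (Suc m) probe) (\<lambda>K' ps. (\<forall>x\<in>set ps. x \<in> K' \<and> x \<in> V) \<and> ps \<noteq> [])" for m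
      unfolding repeat_prog.simps
    proof (rule ok_bindI[OF ok_probe])
      fix K' x assume "x \<in> K' \<and> x \<in> V"
      show "ok Additive_Oracle K' (repeat_prog m probe \<bind> (\<lambda>xs. Ret (x # xs)))
          (\<lambda>K' ps. (\<forall>x\<in>set ps. x \<in> K' \<and> x \<in> V) \<and> ps \<noteq> [])"
        by (rule ok_bindI[OF ok_repeat[OF ok_probe]]) (use \<open>x \<in> K' \<and> x \<in> V\<close> in auto)
    qed
    \<comment> \<open>At least one probe is made, so the list given to \<open>max_degree\<close> is
      nonempty.\<close>
    moreover obtain m where "G * 2 ^ k = Suc m" using gr by (metis not0_implies_Suc nat_0_less_mult_iff neq0_conv zero_less_numeral zero_less_power)
    ultimately show ?thesis by simp
  qed
  have groups: "ok Additive_Oracle K (repeat_prog G (group (2 ^ k)))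
      (\<lambda>K' gs. \<forall>g\<in>set gs. case g of (xs, ys) \<Rightarrow> set xs \<subseteq> K' \<inter> V \<and> set ys \<subseteq> K' \<inter> V)" for K
    by (rule ok_repeat[OF ok_group]) auto
  show ?thesis
    unfolding phase_round_def
  proof (rule ok_bindI[OF probes], rule ok_bindI[OF groups])
    fix K1 ps K2 gs
    assume 1: "(\<forall>x\<in>set ps. x \<in> K1 \<and> x \<in> V) \<and> ps \<noteq> []" "K1 \<subseteq> K2"
      and 2: "\<forall>g\<in>set gs. case g of (xs, ys) \<Rightarrow> set xs \<subseteq> K2 \<inter> V \<and> set ys \<subseteq> K2 \<inter> V"
    have obs: "observed ps gs \<noteq> []" "set (observed ps gs) \<subseteq> K2 \<inter> V"
      using 1 2 by (auto simp: observed_def)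
    show "ok Additive_Oracle K2 (map_prog (\<lambda>(xs, ys). pair_count xs ys) gs \<bind> (\<lambda>zs.
        max_degree (observed ps gs) \<bind> (\<lambda>h. repeat_prog (G * 2 ^ k) (coin Additive_Oracle (Some h)) \<bind>
        (\<lambda>bs. Ret (if G \<le> 256 * hits bs then Inl (Coin (Some h) 0)
          else if G \<le> 2 * sum_list zs then Inr (Est_rho (real (G * 4 ^ k) / real (sum_list zs)))
          else Inl (Phase (Suc k)))))))
        (\<lambda>K'. case_sum (\<lambda>s. case s of Coin c j \<Rightarrow> (\<forall>h. c = Some h \<longrightarrow> h \<in> K' \<and> h \<in> V) | Phase _ \<Rightarrow> True) (\<lambda>_. True))"
    proof (rule ok_bindI[OF ok_map_prog])
      fix K' g assume "K2 \<subseteq> K'" "g \<in> set gs"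
      moreover obtain xs ys where "g = (xs, ys)" by (cases g)
      ultimately have "set xs \<subseteq> K'" "set ys \<subseteq> K'" "g = (xs, ys)" using 2 by fastforce+
      then show "ok Additive_Oracle K' (case g of (xs, ys) \<Rightarrow> pair_count xs ys) (\<lambda>_ _. True)"
        by (simp add: ok_pair_count)
    next
      fix K3 zs assume "K2 \<subseteq> K3"
      show "ok Additive_Oracle K3 (max_degree (observed ps gs) \<bind> (\<lambda>h.
          repeat_prog (G * 2 ^ k) (coin Additive_Oracle (Some h)) \<bind>
          (\<lambda>bs. Ret (if G \<le> 256 * hits bs then Inl (Coin (Some h) 0)
          else if G \<le> 2 * sum_list zs then Inr (Est_rho (real (G * 4 ^ k) / real (sum_list zs)))
          else Inl (Phase (Suc k))))))
        (\<lambda>K'. case_sum (\<lambda>s. case s of Coin c j \<Rightarrow> (\<forall>h. c = Some h \<longrightarrow> h \<in> K' \<and> h \<in> V) | Phase _ \<Rightarrow> True) (\<lambda>_. True))"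
      proof (rule ok_bindI[OF ok_max_degree])
        show "observed ps gs \<noteq> []" "set (observed ps gs) \<subseteq> K3" using obs \<open>K2 \<subseteq> K3\<close> by auto
      next
        fix K4 h assume "K3 \<subseteq> K4" and h: "h \<in> set (observed ps gs)"
        then have h: "h \<in> K4" "h \<in> V" using obs \<open>K2 \<subseteq> K3\<close> by auto
        have coins: "ok Additive_Oracle K4 (repeat_prog (G * 2 ^ k) (coin Additive_Oracle (Some h))) (\<lambda>K' bs. \<forall>x\<in>set bs. True)"
          by (rule ok_repeat[OF ok_coin]) (use h in auto)
        show "ok Additive_Oracle K4 (repeat_prog (G * 2 ^ k) (coin Additive_Oracle (Some h)) \<bind>
          (\<lambda>bs. Ret (if G \<le> 256 * hits bs then Inl (Coin (Some h) 0)
          else if G \<le> 2 * sum_list zs then Inr (Est_rho (real (G * 4 ^ k) / real (sum_list zs)))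
          else Inl (Phase (Suc k)))))
        (\<lambda>K'. case_sum (\<lambda>s. case s of Coin c j \<Rightarrow> (\<forall>h. c = Some h \<longrightarrow> h \<in> K' \<and> h \<in> V) | Phase _ \<Rightarrow> True) (\<lambda>_. True))"
          by (rule ok_bindI[OF coins]) (use h in auto)
      qed
    qed
  qed
qed

lemma ratio_sq: "(phase_ratio k)\<^sup>2 = 4 ^ k / 4 ^ level 4 edge_density"
  by (simp add: phase_ratio_def power_divide power2_eq_square flip: power_mult_distrib)

lemma pairs_bounds: "(phase_ratio k)\<^sup>2 \<le> 4 ^ k * edge_density" "4 ^ k * edge_density \<le> 4 * (phase_ratio k)\<^sup>2"
proof -
  have *: "4 ^ k * edge_density = (phase_ratio k)\<^sup>2 * (4 ^ level 4 edge_density * edge_density)"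
    by (simp add: ratio_sq)
  have "(phase_ratio k)\<^sup>2 * 1 \<le> 4 ^ k * edge_density" "4 ^ k * edge_density \<le> (phase_ratio k)\<^sup>2 * 4"
    unfolding * using level_edge_density by (intro mult_left_mono; simp)+
  then show "(phase_ratio k)\<^sup>2 \<le> 4 ^ k * edge_density" "4 ^ k * edge_density \<le> 4 * (phase_ratio k)\<^sup>2" by simp_all
qed

lemma nn_integral_pair_count:
  "(\<integral>\<^sup>+ g. (case g of (xs, ys) \<Rightarrow> of_nat (2 * r * (2 + length (repeats xs) + length (repeats ys)))) \<partial>result (group r))
   \<le> ennreal (4 * real r * (1 + (real r)\<^sup>2 * edge_density))"
proof -
  let ?R = "replicate_pmf r U"
  let ?rep = "expec ?R (\<lambda>xs. real (length (repeats xs)))"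
  note fin = finite_replicate_pmf[OF finite_U, of r]
  have nn: "0 \<le> ?rep" by (intro Bochner_Integration.integral_nonneg) simp
  have inner: "(\<integral>\<^sup>+ ys. of_nat (2 * r * (2 + length (repeats xs) + length (repeats ys))) \<partial>?R)
      = ennreal (4 * real r + 2 * real r * real (length (repeats xs)) + 2 * real r * ?rep)" for xs :: "nat list"
    unfolding ennreal_of_nat_eq_real_of_nat
    by (subst nn_integral_expec[OF fin]) (simp_all add: algebra_simps expec_add[OF fin])
  have "(\<integral>\<^sup>+ g. (case g of (xs, ys) \<Rightarrow> of_nat (2 * r * (2 + length (repeats xs) + length (repeats ys)))) \<partial>result (group r))
      = (\<integral>\<^sup>+ xs. ennreal (4 * real r + 2 * real r * real (length (repeats xs)) + 2 * real r * ?rep) \<partial>?R)"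
    unfolding result_group nn_integral_pair_pmf' case_prod_conv inner ..
  also have "\<dots> = ennreal (4 * real r + 4 * real r * ?rep)"
    using nn by (subst nn_integral_expec[OF fin]) (simp_all add: expec_add[OF fin])
  also have "\<dots> \<le> ennreal (4 * real r * (1 + (real r)\<^sup>2 * edge_density))"
  proof (rule ennreal_leI)
    have "?rep \<le> (real r)\<^sup>2 * (1 / real (card V))"
      using expec_repeats[OF finite_V V_nonempty, of r] by simp
    also have "\<dots> \<le> (real r)\<^sup>2 * edge_density" using edge_density_ge by (intro mult_left_mono) auto
    finally have "4 * real r * ?rep \<le> 4 * real r * ((real r)\<^sup>2 * edge_density)" by (intro mult_left_mono) auto
    then show "4 * real r + 4 * real r * ?rep \<le> 4 * real r * (1 + (real r)\<^sup>2 * edge_density)"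
      by (simp add: distrib_left)
  qed
  finally show ?thesis .
qed

text \<open>In units of G * 2 ^ k: 2 for probes, 2 for drawing groups, 4 for pair counts, 3 for
  degrees and 4 for the hub test make 15; repeated sample vertices add 16 times the squared
  ratio.\<close>

lemma ecost_phase_round:
  "1 \<le> ecost (phase_round ex G k)"
  "ecost (phase_round ex G k) \<le> ennreal (real (G * 2 ^ k) * (15 + 16 * (phase_ratio k)\<^sup>2))"
proof -
  let ?s = "G * 2 ^ k"
  let ?P = "replicate_pmf ?s (result probe)" and ?Q = "replicate_pmf G (result (group (2 ^ k)))"
  let ?h = "\<lambda>ps gs zs. (max_degree (observed ps gs) \<bind> (\<lambda>h. repeat_prog ?s (coin ex (Some h)) \<bind>
        (\<lambda>bs. Ret (if G \<le> 256 * hits bs then Inl (Coin (Some h) 0)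
          else if G \<le> 2 * sum_list zs then Inr (Est_rho (real (G * 4 ^ k) / real (sum_list zs)))
          else Inl (Phase (Suc k)))))) :: (state + estimate) prog"
  let ?c = "\<lambda>g. (case g of (xs, ys) \<Rightarrow> of_nat (2 * 2 ^ k * (2 + length (repeats xs) + length (repeats ys)))) :: ennreal"
  have s: "1 \<le> ?s" using G_pos by simp
  have eq: "ecost (phase_round ex G k) = of_nat ?s * 2 + (\<integral>\<^sup>+ ps. of_nat G * of_nat (2 * 2 ^ k) +
      (\<integral>\<^sup>+ gs. (\<Sum>(xs, ys)\<leftarrow>gs. ecost (pair_count xs ys)) +
         ecost (?h ps gs (map (\<lambda>(xs, ys). pair_sum xs ys) gs)) \<partial>?Q) \<partial>?P)"
    unfolding phase_round_def
    by (subst ecost_bind, subst ecost_bind, subst ecost_bind)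
      (simp add: ecost_repeat ecost_probe ecost_group result_repeat ecost_map_prog result_map_pair_count
        prod.case_distrib[of ecost])
  have "1 * 1 \<le> (of_nat ?s :: ennreal) * 2"
    using of_nat_mono[OF s] by (intro mult_mono) auto
  then show "1 \<le> ecost (phase_round ex G k)"
    unfolding eq by (simp add: add_increasing2)
  have inner: "ecost (?h ps gs zs) \<le> of_nat (7 * ?s)" if "(ps, gs) \<in> set_pmf (round_vertices k)" for ps gs zs
  proof -
    have "ecost (?h ps gs zs) = of_nat (length (observed ps gs)) + of_nat ?s * ecost (coin ex (Some (hub (observed ps gs))))"
      using round_vertices_support(1)[OF that] hub(2)[OF round_vertices_support(1)[OF that]]
      by (simp add: ecost_bind ecost_repeat ecost_max_degree)
    also have "\<dots> \<le> of_nat (G * 2 ^ k + G * (2 * 2 ^ k)) + of_nat ?s * 4"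
      unfolding round_vertices_support(6)[OF that]
      by (intro add_left_mono mult_left_mono ecost_coin) auto
    also have "\<dots> = of_nat (7 * ?s)"
    proof -
      have "(of_nat (G * 2 ^ k + G * (2 * 2 ^ k)) + of_nat ?s * 4 :: ennreal) = of_nat (G * 2 ^ k + G * (2 * 2 ^ k) + ?s * 4)"
        by (simp only: of_nat_add of_nat_mult of_nat_numeral)
      also have "G * 2 ^ k + G * (2 * 2 ^ k) + ?s * 4 = 7 * ?s" by simp
      finally show ?thesis .
    qed
    finally show ?thesis .
  qed
  have "ecost (phase_round ex G k) \<le> of_nat ?s * 2 + (\<integral>\<^sup>+ ps. of_nat G * of_nat (2 * 2 ^ k) +
      (\<integral>\<^sup>+ gs. (\<Sum>g\<leftarrow>gs. ?c g) + of_nat (7 * ?s) \<partial>?Q) \<partial>?P)"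
    unfolding eq
  proof (intro add_left_mono nn_integral_mono_AE AE_pmfI add_mono)
    fix ps gs assume sup: "ps \<in> set_pmf ?P" "gs \<in> set_pmf ?Q"
    then have *: "(ps, gs) \<in> set_pmf (round_vertices k)" by (simp add: round_vertices_def)
    show "(\<Sum>(xs, ys)\<leftarrow>gs. ecost (pair_count xs ys)) \<le> (\<Sum>g\<leftarrow>gs. ?c g)"
    proof (rule sum_list_mono_ennreal)
      fix g assume g: "g \<in> set gs"
      obtain xs ys where g_eq: "g = (xs, ys)" by (cases g)
      then have "length xs = 2 ^ k" "length ys = 2 ^ k"
        using round_vertices_support(5)[OF *, of xs ys] g by auto
      then show "(case g of (xs, ys) \<Rightarrow> ecost (pair_count xs ys)) \<le> ?c g"
        unfolding g_eq case_prod_conv by (rule ecost_pair_count)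
    qed
    show "ecost (?h ps gs (map (\<lambda>(xs, ys). pair_sum xs ys) gs)) \<le> of_nat (7 * ?s)"
      by (rule inner[OF *])
  qed
  also have "\<dots> = of_nat ?s * 2 + (of_nat G * of_nat (2 * 2 ^ k) +
      (of_nat G * (\<integral>\<^sup>+ g. ?c g \<partial>result (group (2 ^ k))) + of_nat (7 * ?s)))"
    by (simp add: nn_integral_add nn_integral_replicate_sum del: of_nat_mult of_nat_add of_nat_power)
  also have "\<dots> \<le> of_nat ?s * 2 + (of_nat G * of_nat (2 * 2 ^ k) +
      (of_nat G * ennreal (4 * real (2 ^ k) * (1 + (real (2 ^ k))\<^sup>2 * edge_density)) + of_nat (7 * ?s)))"
    by (intro add_left_mono add_right_mono mult_left_mono nn_integral_pair_count) simp
  also have "\<dots> = ennreal (real ?s * 2 + (real G * real (2 * 2 ^ k) +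
      (real G * (4 * real (2 ^ k) * (1 + (real (2 ^ k))\<^sup>2 * edge_density)) + real (7 * ?s))))"
    using edge_density_pos
    by (simp add: ennreal_of_nat_eq_real_of_nat ennreal_mult ennreal_plus del: of_nat_mult of_nat_add of_nat_power
        flip: ennreal_numeral)
  also have "\<dots> \<le> ennreal (real ?s * (15 + 16 * (phase_ratio k)\<^sup>2))"
  proof (rule ennreal_leI)
    have "(real (2 ^ k))\<^sup>2 * edge_density = 4 ^ k * edge_density"
      by (simp add: power2_eq_square flip: power_mult_distrib)
    also have "\<dots> \<le> 4 * (phase_ratio k)\<^sup>2" by (rule pairs_bounds)
    finally have "real ?s * (4 * ((real (2 ^ k))\<^sup>2 * edge_density)) \<le> real ?s * (4 * (4 * (phase_ratio k)\<^sup>2))"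
      by (intro mult_left_mono) auto
    then show "real ?s * 2 + (real G * real (2 * 2 ^ k) +
      (real G * (4 * real (2 ^ k) * (1 + (real (2 ^ k))\<^sup>2 * edge_density)) + real (7 * ?s)))
      \<le> real ?s * (15 + 16 * (phase_ratio k)\<^sup>2)"
      by (simp add: algebra_simps)
  qed
  finally show "ecost (phase_round ex G k) \<le> ennreal (real ?s * (15 + 16 * (phase_ratio k)\<^sup>2))" .
qed

end

lemma expec_pair:
  assumes "finite (set_pmf p)" "finite (set_pmf q)"
  shows "expec (pair_pmf p q) h = expec p (\<lambda>x. expec q (\<lambda>y. h (x, y)))"
  using assms by (simp add: pair_pmf_def expec_bind)

lemma sum_list_swap: "(\<Sum>x\<leftarrow>xs. \<Sum>y\<leftarrow>ys. f x y) = (\<Sum>y\<leftarrow>ys. \<Sum>x\<leftarrow>xs. f x y)"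
  for f :: "'a \<Rightarrow> 'b \<Rightarrow> 'c::comm_monoid_add"
  by (induction xs) (simp_all add: sum_list_addf)

lemma real_sum_list: "real (\<Sum>x\<leftarrow>xs. f x) = (\<Sum>x\<leftarrow>xs. real (f x))"
  by (induction xs) simp_all

section \<open>Three bad events of a round, and what their absence implies\<close>

context estimation
begin

definition light_sum :: "nat list \<times> nat list \<Rightarrow> real" where
  "light_sum = (\<lambda>(xs, ys). \<Sum>y\<leftarrow>ys. \<Sum>x\<leftarrow>xs. light_adj x y)"

definition light_mean :: "nat \<Rightarrow> real" where
  "light_mean k = real G * (4 ^ k * light_density)"

lemma finite_group: "finite (set_pmf (result (group r)))"
  by (simp add: result_group finite_replicate_pmf[OF finite_U])

lemma real_pair_sum: "real (pair_sum xs ys) = (\<Sum>y\<leftarrow>ys. \<Sum>x\<leftarrow>xs. adjr x y)"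
  by (simp add: pair_sum_def real_sum_list adj_def sum_list_swap[of _ ys xs])

lemma power_two_four: "(real (2 ^ k))\<^sup>2 = 4 ^ k"
  by (simp add: power2_eq_square flip: power_mult_distrib)

lemma expec_pair_sum: "expec (result (group (2 ^ k))) (\<lambda>(xs, ys). real (pair_sum xs ys)) = 4 ^ k * edge_density"
  unfolding result_group
  by (subst expec_pair) (simp_all add: finite_replicate_pmf[OF finite_U] real_pair_sum
      pair_replicate_mean[OF finite_U] edge_density_expec power_two_four[simplified])

lemma expec_light_sum: "expec (result (group (2 ^ k))) light_sum = 4 ^ k * light_density"
  unfolding result_group
  by (subst expec_pair) (simp_all add: finite_replicate_pmf[OF finite_U] light_sum_def
      pair_replicate_mean[OF finite_U] light_density_def power_two_four[simplified])

text \<open>The second term is 2 * r^3 * \<open>light_density\<close> /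
  \<open>2 ^ level 4 edge_density\<close> with group size r = 2 ^ k, that is, 2 *
  \<open>phase_ratio k\<close> times the mean.\<close>

lemma light_sum_variance:
  "expec (result (group (2 ^ k))) (\<lambda>g. (light_sum g)\<^sup>2) - (expec (result (group (2 ^ k))) light_sum)\<^sup>2
   \<le> 4 ^ k * light_density * (1 + 2 * phase_ratio k)"
proof -
  let ?R = "replicate_pmf (2 ^ k) U"
  have eq: "expec (result (group (2 ^ k))) (\<lambda>g. (light_sum g)\<^sup>2)
      = expec ?R (\<lambda>xs. expec ?R (\<lambda>ys. (\<Sum>y\<leftarrow>ys. \<Sum>x\<leftarrow>xs. light_adj x y)\<^sup>2))"
    unfolding result_group by (subst expec_pair) (simp_all add: finite_replicate_pmf[OF finite_U] light_sum_def)
  have "expec (result (group (2 ^ k))) (\<lambda>g. (light_sum g)\<^sup>2) - ((real (2 ^ k))\<^sup>2 * light_density)\<^sup>2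
      \<le> (real (2 ^ k))\<^sup>2 * light_density + 2 * real (2 ^ k) ^ 3 * (light_density / 2 ^ level 4 edge_density)"
    unfolding eq
    by (rule pair_replicate_square[OF finite_U _ _ light_density_def light_square]) (auto simp: light_adj_def insert_commute)
  also have "\<dots> = (real (2 ^ k))\<^sup>2 * light_density * (1 + 2 * phase_ratio k)"
    by (simp add: phase_ratio_def power2_eq_square power3_eq_cube algebra_simps)
  finally show ?thesis unfolding expec_light_sum power_two_four .
qed

definition hub_missed :: "(nat list \<times> (nat list \<times> nat list) list \<times> bool list) set" where
  "hub_missed = {(ps, gs, bs). heavy (hub (observed ps gs)) \<and> 256 * hits bs < G}"

definition heavy_loss :: bool where
  "heavy_loss \<longleftrightarrow> \<epsilon> / 4 * edge_density \<le> edge_density - light_density"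

definition heavy_unseen :: "(nat list \<times> (nat list \<times> nat list) list \<times> bool list) set" where
  "heavy_unseen = {(ps, gs, bs). heavy_loss \<and> set ps \<inter> {v. heavy v} = {}}"

definition light_far :: "nat \<Rightarrow> (nat list \<times> (nat list \<times> nat list) list \<times> bool list) set" where
  "light_far k = {(ps, gs, bs). \<not> heavy_loss \<and> \<epsilon> / 4 * light_mean k \<le> \<bar>(\<Sum>g\<leftarrow>gs. light_sum g) - light_mean k\<bar>}"

text \<open>The coin tosses depend on the hub and hence on all vertices drawn. Events that ignore
  the tosses can be evaluated where probes and groups are still independent.\<close>

lemma round_sample_vertices:
  "measure_pmf.prob (round_sample ex k) {(ps, gs, bs). P ps gs} = measure_pmf.prob (round_vertices k) {(ps, gs). P ps gs}"
proof -
  have "round_vertices k = map_pmf (\<lambda>(ps, gs, bs). (ps, gs)) (round_sample ex k)"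
    by (simp add: round_sample_def map_bind_pmf case_prod_unfold pmf.map_comp o_def bind_return_pmf' flip: map_pmf_def)
  then show ?thesis
    by (simp add: vimage_def case_prod_unfold)
qed

lemma round_sample_support:
  "(ps, gs, bs) \<in> set_pmf (round_sample ex k) \<Longrightarrow> (ps, gs) \<in> set_pmf (round_vertices k)"
  by (auto simp: round_sample_def)

lemma prob_probes: "measure_pmf.prob (round_vertices k) {(ps, gs). P ps}
    = measure_pmf.prob (replicate_pmf (G * 2 ^ k) (result probe)) {ps. P ps}"
proof -
  have "measure_pmf.prob (map_pmf fst (round_vertices k)) {ps. P ps} = measure_pmf.prob (round_vertices k) {(ps, gs). P ps}"
    by (simp add: vimage_def case_prod_unfold)
  then show ?thesis by (simp add: round_vertices_def map_fst_pair_pmf)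
qed

lemma prob_groups: "measure_pmf.prob (round_vertices k) {(ps, gs). P gs}
    = measure_pmf.prob (replicate_pmf G (result (group (2 ^ k)))) {gs. P gs}"
proof -
  have "measure_pmf.prob (map_pmf snd (round_vertices k)) {gs. P gs} = measure_pmf.prob (round_vertices k) {(ps, gs). P gs}"
    by (simp add: vimage_def case_prod_unfold)
  then show ?thesis by (simp add: round_vertices_def map_snd_pair_pmf)
qed

text \<open>A heavy hub has mean at least G * t, hence at least G / 128, so fewer than G / 256 hits
  is a deviation by half of the mean. The bound holds for each choice of vertices
  separately.\<close>

lemma prob_hub_missed:
  assumes "1 / 128 \<le> phase_ratio k"
  shows "measure_pmf.prob (round_sample ex k) hub_missed \<le> 4 / 2 ^ 24 / phase_ratio k"
  unfolding round_sample_def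
proof (rule prob_bind_pmf_le, clarify)
  fix ps gs assume "(ps, gs) \<in> set_pmf (round_vertices k)"
  let ?h = "hub (observed ps gs)" and ?t = "phase_ratio k"
  let ?\<mu> = "real (G * 2 ^ k) * coin_prob (Some ?h)"
  have h: "?h \<in> V" by (rule hub_in_V) fact
  have t: "0 < ?t" by (rule phase_ratio)
  show "measure_pmf.prob (map_pmf (\<lambda>bs. (ps, gs, bs)) (hub_hits ex k ?h)) hub_missed \<le> 4 / 2 ^ 24 / ?t"
  proof (cases "heavy ?h")
    case True
    have "1 / 2 ^ level 4 edge_density \<le> coin_prob (Some ?h)"
      using True card_V_pos by (simp add: heavy_def coin_prob_def field_simps)
    then have "real (G * 2 ^ k) * (1 / 2 ^ level 4 edge_density) \<le> ?\<mu>"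
      by (rule mult_left_mono) simp
    then have \<mu>: "real G * ?t \<le> ?\<mu>" by (simp add: phase_ratio_def)
    have Gt: "2 ^ 24 * ?t \<le> real G * ?t" using G_ge t by (intro mult_right_mono) auto
    have "0 < 2 ^ 24 * ?t" using t by simp
    then have \<mu>_pos: "0 < ?\<mu>" using \<mu> Gt by linarith
    have "real G * (1 / 128) \<le> real G * ?t" using assms by (intro mult_left_mono) auto
    then have small: "real G / 128 \<le> ?\<mu>" using \<mu> by simp
    have "measure_pmf.prob (map_pmf (\<lambda>bs. (ps, gs, bs)) (hub_hits ex k ?h)) hub_missed
        \<le> measure_pmf.prob (hub_hits ex k ?h) {bs. ?\<mu> / 2 \<le> \<bar>real (hits bs) - ?\<mu>\<bar>}"
      unfolding measure_map_pmf
    proof (intro measure_pmf.finite_measure_mono subsetI)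
      fix bs assume "bs \<in> (\<lambda>bs. (ps, gs, bs)) -` hub_missed"
      then have "256 * hits bs < G" by (simp add: hub_missed_def)
      then have "256 * real (hits bs) < real G" by linarith
      then show "bs \<in> {bs. ?\<mu> / 2 \<le> \<bar>real (hits bs) - ?\<mu>\<bar>}"
        unfolding mem_Collect_eq using small by linarith
    qed simp
    also have "\<dots> \<le> ?\<mu> / (?\<mu> / 2)\<^sup>2"
      unfolding hub_hits_def using h \<mu>_pos by (intro coin_chebyshev) auto
    also have "\<dots> = 4 / ?\<mu>" using \<mu>_pos by (simp add: power2_eq_square field_simps)
    also have "\<dots> \<le> 4 / (2 ^ 24 * ?t)"
    proof (rule divide_left_mono)
      show "2 ^ 24 * ?t \<le> ?\<mu>" using \<mu> Gt by linarith
      show "0 < ?\<mu> * (2 ^ 24 * ?t)" using \<mu>_pos \<open>0 < 2 ^ 24 * ?t\<close> by (rule mult_pos_pos)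
    qed simp
    finally show ?thesis by simp
  qed (use t in \<open>simp add: hub_missed_def vimage_def\<close>)
qed

text \<open>G * 2 ^ k probes, each finding a heavy vertex with probability at least \<epsilon>^2 /
  128 * p * r for r = \<open>2 ^ level 4 edge_density\<close>, find 2^24 / 128 * t of them on
  average, because r^2 * p \<ge> 1.\<close>

lemma prob_heavy_unseen: "measure_pmf.prob (round_sample ex k) heavy_unseen \<le> 128 / 2 ^ 24 / phase_ratio k"
proof (cases heavy_loss)
  case True
  let ?t = "phase_ratio k" and ?L = "2 ^ level 4 edge_density :: real"
  let ?q = "measure_pmf.prob (result probe) {v. heavy v}"
  have t: "0 < ?t" by (rule phase_ratio)
  have "2 ^ 24 / 128 * ?t * 1 \<le> (\<epsilon>\<^sup>2 * real G) / 128 * ?t * (4 ^ level 4 edge_density * edge_density)"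
    using G t level_edge_density by (intro mult_mono) auto
  also have "\<dots> = real (G * 2 ^ k) * (\<epsilon>\<^sup>2 / 128 * edge_density * ?L)"
  proof -
    have "(4 :: real) ^ level 4 edge_density = ?L * ?L" by (simp flip: power_mult_distrib)
    then show ?thesis by (simp add: phase_ratio_def)
  qed
  also have "\<dots> \<le> real (G * 2 ^ k) * ?q"
    using True prob_probe_heavy[OF \<epsilon>] by (intro mult_left_mono) (auto simp: heavy_loss_def)
  finally have "measure_pmf.prob (replicate_pmf (G * 2 ^ k) (result probe)) {ps. set ps \<inter> {v. heavy v} = {}}
      \<le> 1 / (2 ^ 24 / 128 * ?t)"
    using t by (intro prob_replicate_miss_le) auto
  moreover have "heavy_unseen = {(ps, gs, bs). set ps \<inter> {v. heavy v} = {}}"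
    using True by (simp add: heavy_unseen_def)
  ultimately show ?thesis
    using round_sample_vertices[of ex k "\<lambda>ps gs. set ps \<inter> {v. heavy v} = {}"]
      prob_probes[of k "\<lambda>ps. set ps \<inter> {v. heavy v} = {}"] by simp
next
  case False
  then have "heavy_unseen = {}" by (simp add: heavy_unseen_def)
  then show ?thesis using phase_ratio(1)[of k] by simp
qed

lemma light_density_large:
  assumes "\<not> heavy_loss"
  shows "(1 - \<epsilon> / 4) * edge_density < light_density" "light_density \<le> edge_density"
proof -
  show "(1 - \<epsilon> / 4) * edge_density < light_density"
    using assms by (simp add: heavy_loss_def algebra_simps)
  have "expec U (\<lambda>x. expec U (light_adj x)) \<le> expec U (\<lambda>x. expec U (adjr x))"
    by (intro expec_mono finite_U) (auto simp: light_adj_def)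
  then show "light_density \<le> edge_density" by (simp add: light_density_def edge_density_expec)
qed

lemma light_mean_bounds:
  assumes "\<not> heavy_loss"
  shows "(1 - \<epsilon> / 4) * (real G * (4 ^ k * edge_density)) \<le> light_mean k"
    "light_mean k \<le> real G * (4 ^ k * edge_density)"
    "3 / 4 * (real G * (phase_ratio k)\<^sup>2) \<le> light_mean k"
proof -
  have "real G * 4 ^ k * ((1 - \<epsilon> / 4) * edge_density) \<le> real G * 4 ^ k * light_density"
    "real G * 4 ^ k * light_density \<le> real G * 4 ^ k * edge_density"
    using light_density_large[OF assms] by (intro mult_left_mono; simp)+
  then show 1: "(1 - \<epsilon> / 4) * (real G * (4 ^ k * edge_density)) \<le> light_mean k"
    "light_mean k \<le> real G * (4 ^ k * edge_density)"
    by (simp_all add: light_mean_def mult_ac)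
  have "3 / 4 * (real G * (phase_ratio k)\<^sup>2) \<le> (1 - \<epsilon> / 4) * (real G * (4 ^ k * edge_density))"
    using \<epsilon> pairs_bounds(1) by (intro mult_mono mult_left_mono) auto
  then show "3 / 4 * (real G * (phase_ratio k)\<^sup>2) \<le> light_mean k" using 1 by linarith
qed

text \<open>Chebyshev with relative deviation \<epsilon> / 4 gives 16 * (1 + 2 * t) / (\<epsilon>^2
  * m) for the mean m. Here 1 + 2 * t \<le> 130 * t since t \<ge> 1/128, and m is at least 3/4 * G *
  t^2; 130 * 16 * 4/3 is below 3000.\<close>

lemma prob_light_far:
  assumes "1 / 128 \<le> phase_ratio k"
  shows "measure_pmf.prob (round_sample ex k) (light_far k) \<le> 3000 / 2 ^ 24 / phase_ratio k"
proof (cases heavy_loss)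
  case True
  then have "light_far k = {}" by (simp add: light_far_def)
  then show ?thesis using phase_ratio(1)[of k] by simp
next
  case False
  let ?t = "phase_ratio k" and ?m = "light_mean k"
  have t: "0 < ?t" by (rule phase_ratio)
  have Gt: "0 < real G * ?t\<^sup>2" using G_pos t by simp
  have m: "0 < ?m" using light_mean_bounds(3)[OF False, of k] Gt by linarith
  have "measure_pmf.prob (replicate_pmf G (result (group (2 ^ k))))
      {gs. \<epsilon> / 4 * ?m \<le> \<bar>(\<Sum>g\<leftarrow>gs. light_sum g) - real G * expec (result (group (2 ^ k))) light_sum\<bar>}
      \<le> real G * (4 ^ k * light_density * (1 + 2 * ?t)) / (\<epsilon> / 4 * ?m)\<^sup>2"
    by (rule chebyshev_replicate[OF finite_group mult_pos_pos[OF _ m] light_sum_variance]) (use \<epsilon> in simp)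
  also have "real G * expec (result (group (2 ^ k))) light_sum = ?m"
    by (simp only: expec_light_sum light_mean_def)
  also have "real G * (4 ^ k * light_density * (1 + 2 * ?t)) / (\<epsilon> / 4 * ?m)\<^sup>2 = (1 + 2 * ?t) * 16 / (\<epsilon>\<^sup>2 * ?m)"
  proof -
    have "real G * (4 ^ k * light_density * (1 + 2 * ?t)) = ?m * (1 + 2 * ?t)" by (simp add: light_mean_def)
    then show ?thesis using m \<epsilon> by (simp add: power2_eq_square field_simps)
  qed
  also have "\<dots> \<le> (130 * ?t) * 16 / (3 / 4 * (2 ^ 24 * ?t\<^sup>2))"
  proof (rule frac_le)
    have "\<epsilon>\<^sup>2 * (3 / 4 * (real G * ?t\<^sup>2)) \<le> \<epsilon>\<^sup>2 * ?m"
      using light_mean_bounds(3)[OF False] by (intro mult_left_mono) auto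
    moreover have "2 ^ 24 * ?t\<^sup>2 \<le> \<epsilon>\<^sup>2 * real G * ?t\<^sup>2" using G by (intro mult_right_mono) auto
    ultimately show "3 / 4 * (2 ^ 24 * ?t\<^sup>2) \<le> \<epsilon>\<^sup>2 * ?m" by simp
  qed (use assms t in auto)
  also have "\<dots> \<le> 3000 / 2 ^ 24 / ?t"
    using t by (simp add: power2_eq_square field_simps)
  finally show ?thesis
    using False round_sample_vertices[of ex k "\<lambda>ps gs. \<epsilon> / 4 * ?m \<le> \<bar>(\<Sum>g\<leftarrow>gs. light_sum g) - ?m\<bar>"]
      prob_groups[of k "\<lambda>gs. \<epsilon> / 4 * ?m \<le> \<bar>(\<Sum>g\<leftarrow>gs. light_sum g) - ?m\<bar>"]
    by (simp add: light_far_def)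
qed

definition bad_round :: "nat \<Rightarrow> (nat list \<times> (nat list \<times> nat list) list \<times> bool list) set" where
  "bad_round k = hub_missed \<union> heavy_unseen \<union> light_far k"

lemma prob_bad_round:
  assumes "1 / 128 \<le> phase_ratio k"
  shows "measure_pmf.prob (round_sample ex k) (bad_round k) \<le> 3200 / 2 ^ 24 / phase_ratio k"
proof -
  have "measure_pmf.prob (round_sample ex k) (bad_round k)
      \<le> 4 / 2 ^ 24 / phase_ratio k + 128 / 2 ^ 24 / phase_ratio k + 3000 / 2 ^ 24 / phase_ratio k"
    unfolding bad_round_def
    using prob_hub_missed[OF assms] prob_heavy_unseen prob_light_far[OF assms]
    by (intro order_trans[OF measure_Un_le] add_mono) auto
  also have "\<dots> \<le> 3200 / 2 ^ 24 / phase_ratio k"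
    using phase_ratio(1)[of k] by (simp add: field_simps)
  finally show ?thesis .
qed

text \<open>If the hub test is negative, the hub is light, and as the hub has maximal degree so is
  every vertex seen. Then no probe found a heavy vertex, which excludes \<open>heavy_loss\<close>,
  and all pairs counted are light, so the count concentrates.\<close>

lemma good_round:
  assumes sup: "(ps, gs, bs) \<in> set_pmf (round_sample ex k)" and good: "(ps, gs, bs) \<notin> bad_round k"
    and "\<not> G \<le> 256 * hits bs"
  shows "\<not> heavy_loss" "\<bar>real (round_pairs gs) - light_mean k\<bar> < \<epsilon> / 4 * light_mean k"
proof -
  note obs = round_vertices_support[OF round_sample_support[OF sup]]
  have "\<not> heavy (hub (observed ps gs))"
    using good assms(3) by (auto simp: bad_round_def hub_missed_def)
  then have light: "\<not> heavy v" if "v \<in> set (observed ps gs)" for v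
  proof -
    have "real (Defs.degree E v) * 2 ^ level 4 edge_density \<le> real (Defs.degree E (hub (observed ps gs))) * 2 ^ level 4 edge_density"
      using hub(3)[OF obs(1) that] by (intro mult_right_mono) auto
    then show ?thesis using \<open>\<not> heavy (hub (observed ps gs))\<close> unfolding heavy_def by linarith
  qed
  have "set ps \<inter> {v. heavy v} = {}" using light by (auto simp: observed_def)
  then show nl: "\<not> heavy_loss" using good by (auto simp: bad_round_def heavy_unseen_def)
  have "real (pair_sum xs ys) = light_sum (xs, ys)" if g: "(xs, ys) \<in> set gs" for xs ys
  proof -
    have l: "\<not> heavy v" if "v \<in> set xs \<union> set ys" for v
      using light[of v] g that by (force simp: observed_def)
    have "(\<Sum>y\<leftarrow>ys. \<Sum>x\<leftarrow>xs. adjr x y) = (\<Sum>y\<leftarrow>ys. \<Sum>x\<leftarrow>xs. light_adj x y)"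
      using l by (intro map_cong refl arg_cong[where f=sum_list]) (auto simp: light_adj_def)
    then show ?thesis by (simp only: real_pair_sum light_sum_def case_prod_conv)
  qed
  then have "real (round_pairs gs) = (\<Sum>g\<leftarrow>gs. light_sum g)"
    unfolding round_pairs_def real_sum_list by (intro arg_cong[where f=sum_list] map_cong refl) auto
  then show "\<bar>real (round_pairs gs) - light_mean k\<bar> < \<epsilon> / 4 * light_mean k"
    using good nl by (auto simp: bad_round_def light_far_def)
qed

text \<open>Two errors of \<epsilon> / 4 compound: the missing heavy edges lower the mean, and the
  count deviates from it. Both lower the count, hence the square in its lower bound.\<close>

lemma good_round_estimate:
  assumes "(ps, gs, bs) \<in> set_pmf (round_sample ex k)" "(ps, gs, bs) \<notin> bad_round k" "\<not> G \<le> 256 * hits bs"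
  shows "Est_rho (real (G * 4 ^ k) / real (round_pairs gs)) \<in> correct_estimates \<epsilon> V E"
proof -
  note good = good_round[OF assms]
  let ?N = "real (G * 4 ^ k)" and ?z = "real (round_pairs gs)" and ?m = "light_mean k"
  let ?\<mu> = "?N * edge_density"
  have \<mu>: "0 < ?\<mu>" using G_pos edge_density_pos by simp
  have m: "(1 - \<epsilon> / 4) * ?\<mu> \<le> ?m" "?m \<le> ?\<mu>" using light_mean_bounds[OF good(1), of k] by (simp_all add: mult_ac)
  have z: "(1 - \<epsilon> / 4) * ?m < ?z" "?z < (1 + \<epsilon> / 4) * ?m"
    using good(2) unfolding left_diff_distrib distrib_right by linarith+
  have "(1 - \<epsilon> / 4) * ((1 - \<epsilon> / 4) * ?\<mu>) \<le> (1 - \<epsilon> / 4) * ?m" using m \<epsilon> by (intro mult_left_mono) auto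
  then have lower: "(1 - \<epsilon> / 4)\<^sup>2 * ?\<mu> \<le> ?z" using z(1) by (simp add: power2_eq_square mult.assoc)
  have "0 < (1 - \<epsilon> / 4)\<^sup>2 * ?\<mu>" by (rule mult_pos_pos[OF _ \<mu>]) (use \<epsilon> in simp)
  then have z_pos: "0 < ?z" using lower by linarith
  have "(1 + \<epsilon> / 4) * ?m \<le> (1 + \<epsilon> / 4) * ?\<mu>" using m \<epsilon> by (intro mult_left_mono) auto
  then have upper: "?z \<le> (1 + \<epsilon> / 4) * ?\<mu>" using z(2) by linarith
  have e2: "\<epsilon>\<^sup>2 \<le> \<epsilon>" "0 \<le> \<epsilon>\<^sup>2" using \<epsilon> by (simp_all add: power2_eq_square)
  have "(1 - \<epsilon>) * (1 + \<epsilon> / 4) \<le> 1"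
    using e2 \<epsilon> by (simp add: algebra_simps flip: power2_eq_square)
  then have "(1 - \<epsilon>) * (1 + \<epsilon> / 4) * ?\<mu> \<le> 1 * ?\<mu>" using \<mu> by (intro mult_right_mono) auto
  moreover have "(1 - \<epsilon>) * ?z \<le> (1 - \<epsilon>) * ((1 + \<epsilon> / 4) * ?\<mu>)" using upper \<epsilon> by (intro mult_left_mono) auto
  ultimately have 1: "(1 - \<epsilon>) * ?z \<le> ?\<mu>" by (simp add: mult.assoc)
  have "1 - \<epsilon> / 2 \<le> (1 - \<epsilon> / 4)\<^sup>2" using e2 by (simp add: power2_eq_square algebra_simps)
  then have "(1 + \<epsilon>) * (1 - \<epsilon> / 2) \<le> (1 + \<epsilon>) * (1 - \<epsilon> / 4)\<^sup>2" using \<epsilon> by (intro mult_left_mono) auto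
  moreover have "1 \<le> (1 + \<epsilon>) * (1 - \<epsilon> / 2)" using e2 by (simp add: algebra_simps flip: power2_eq_square)
  ultimately have "1 \<le> (1 + \<epsilon>) * (1 - \<epsilon> / 4)\<^sup>2" by linarith
  then have "1 * ?\<mu> \<le> (1 + \<epsilon>) * (1 - \<epsilon> / 4)\<^sup>2 * ?\<mu>" using \<mu> by (intro mult_right_mono) auto
  moreover have "(1 + \<epsilon>) * ((1 - \<epsilon> / 4)\<^sup>2 * ?\<mu>) \<le> (1 + \<epsilon>) * ?z" using lower \<epsilon> by (intro mult_left_mono) auto
  ultimately have 2: "?\<mu> \<le> (1 + \<epsilon>) * ?z" by (simp add: mult.assoc)
  have "(1 - \<epsilon>) * (1 / edge_density) \<le> ?N / ?z" "?N / ?z \<le> (1 + \<epsilon>) * (1 / edge_density)"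
    using 1 2 z_pos edge_density_pos by (simp_all add: field_simps)
  then have "?N / ?z \<in> approx \<epsilon> (real (card V) / avg_degree V E)"
    unfolding approx_def inverse_edge_density by (simp only: atLeastAtMost_iff)
  then show ?thesis unfolding correct_estimates_def by blast
qed

text \<open>The mean is at least 3/4 * G and the count at least 3/4 of the mean; 9/16 exceeds
  1/2.\<close>

lemma good_round_stops:
  assumes "(ps, gs, bs) \<in> set_pmf (round_sample ex k)" "(ps, gs, bs) \<notin> bad_round k" "\<not> G \<le> 256 * hits bs"
    and "1 \<le> phase_ratio k"
  shows "G \<le> 2 * round_pairs gs"
proof -
  note good = good_round[OF assms(1-3)]
  have "real G * 1 \<le> real G * (phase_ratio k)\<^sup>2" using assms(4) by (intro mult_left_mono one_le_power) auto
  then have m: "3 / 4 * real G \<le> light_mean k" using light_mean_bounds(3)[OF good(1), of k] by linarith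
  then have "0 \<le> light_mean k" using G_pos by linarith
  then have "\<epsilon> / 4 * light_mean k \<le> 1 / 4 * light_mean k" using \<epsilon> by (intro mult_right_mono) auto
  then have "real G \<le> 2 * real (round_pairs gs)" using good(2) m by linarith
  then show ?thesis by linarith
qed

end

section \<open>Error and cost bounds\<close>

context estimation
begin

lemma prob_mono_support:
  assumes "\<And>x. x \<in> set_pmf p \<Longrightarrow> x \<in> A \<Longrightarrow> x \<in> B"
  shows "measure_pmf.prob p A \<le> measure_pmf.prob p B"
  using assms by (intro measure_pmf.finite_measure_mono_AE AE_pmfI) auto

text \<open>A wrong answer at ratio at least 1/128 implies a bad round. Below, the mean 4 * G * t^2
  against the required G / 2 pairs gives 8 * t^2, which is at most 4 * t.\<close>

lemma prob_round_wrong: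
  "measure_pmf.prob (round_sample ex k) {(ps, gs, bs). \<not> G \<le> 256 * hits bs \<and> G \<le> 2 * round_pairs gs \<and>
     Est_rho (real (G * 4 ^ k) / real (round_pairs gs)) \<notin> correct_estimates \<epsilon> V E}
   \<le> (if 1 / 128 \<le> phase_ratio k then 3200 / 2 ^ 24 / phase_ratio k else 4 * phase_ratio k)"
  (is "measure_pmf.prob _ ?W \<le> _")
proof (cases "1 / 128 \<le> phase_ratio k")
  case True
  have "measure_pmf.prob (round_sample ex k) ?W \<le> measure_pmf.prob (round_sample ex k) (bad_round k)"
    using good_round_estimate by (intro prob_mono_support) blast
  then show ?thesis using prob_bad_round[OF True, of ex] True by simp
next
  case False
  let ?t = "phase_ratio k"
  have "measure_pmf.prob (round_sample ex k) ?W
      \<le> measure_pmf.prob (round_sample ex k) {(ps, gs, bs). G \<le> 2 * round_pairs gs}"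
    by (intro prob_mono_support) auto
  also have "\<dots> = measure_pmf.prob (replicate_pmf G (result (group (2 ^ k)))) {gs. G \<le> 2 * round_pairs gs}"
    by (simp add: round_sample_vertices[of ex k "\<lambda>ps gs. G \<le> 2 * round_pairs gs"]
        prob_groups[of k "\<lambda>gs. G \<le> 2 * round_pairs gs"])
  also have "\<dots> \<le> expec (replicate_pmf G (result (group (2 ^ k)))) (\<lambda>gs. \<Sum>g\<leftarrow>gs. case g of (xs, ys) \<Rightarrow> real (pair_sum xs ys)) / (real G / 2)"
  proof (rule markov_finite[OF finite_replicate_pmf[OF finite_group]])
    have eq: "(\<Sum>g\<leftarrow>gs. case g of (xs, ys) \<Rightarrow> real (pair_sum xs ys)) = real (round_pairs gs)" for gs
      by (simp add: round_pairs_def real_sum_list case_prod_unfold)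
    show "0 \<le> (\<Sum>g\<leftarrow>gs. case g of (xs, ys) \<Rightarrow> real (pair_sum xs ys))" for gs
      unfolding eq by simp
    show "real G / 2 \<le> (\<Sum>g\<leftarrow>gs. case g of (xs, ys) \<Rightarrow> real (pair_sum xs ys))" if "gs \<in> {gs. G \<le> 2 * round_pairs gs}" for gs
      using that unfolding eq by simp
  qed (use G_pos in simp)
  also have "\<dots> = 2 * (4 ^ k * edge_density)"
    using G_pos by (simp add: expec_replicate_sum[OF finite_group] expec_pair_sum)
  also have "\<dots> \<le> 8 * ?t\<^sup>2" using pairs_bounds(2)[of k] by (simp add: mult_ac)
  also have "\<dots> \<le> 4 * ?t"
    using False phase_ratio(1)[of k] by (simp add: power2_eq_square)
  finally show ?thesis using False by simp
qed

text \<open>A commitment adds no error of its own to the round: whichever vertex is chosen, its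
  entire later error is covered by the reserve, which passes unchanged from phase to phase and is
  spent at most once.\<close>

lemma phase_round_error: "expect_next error_bound wrong (phase_round ex G k) \<le> error_bound (Phase k)"
proof -
  let ?W = "{(ps, gs, bs). \<not> G \<le> 256 * hits bs \<and> G \<le> 2 * round_pairs gs \<and>
     Est_rho (real (G * 4 ^ k) / real (round_pairs gs)) \<notin> correct_estimates \<epsilon> V E}"
  let ?d = "1 / 16 + 256 / 2 ^ 22 :: real" and ?u = "error_potential (3200 / 2 ^ 24) (phase_ratio (Suc k))"
  have nn: "0 \<le> ?u" using phase_ratio(1) by (intro error_potential_nonneg) auto
  have coin: "error_bound (Coin c 0) \<le> ennreal (?d + ?u)" for c
  proof -
    have "error_potential (1 / 2 ^ 22) (coin_ratio c 0) \<le> 1 / 16 + 256 * (1 / 2 ^ 22)"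
      using coin_ratio(1) by (intro error_potential_le) auto
    then show ?thesis unfolding error_bound.simps using nn by (intro ennreal_leI) linarith
  qed
  have "expect_next error_bound wrong (phase_round ex G k)
      \<le> (\<integral>\<^sup>+ x. indicator ?W x + ennreal (?d + ?u) \<partial>round_sample ex k)"
    unfolding result_phase_round nn_integral_map_pmf
  proof (intro nn_integral_mono)
    fix x :: "nat list \<times> (nat list \<times> nat list) list \<times> bool list"
    obtain ps gs bs where x: "x = (ps, gs, bs)" by (cases x)
    show "case_sum error_bound wrong (decide k x) \<le> indicator ?W x + ennreal (?d + ?u)"
    proof (cases "G \<le> 256 * hits bs")
      case True
      then have "case_sum error_bound wrong (decide k x) = error_bound (Coin (Some (hub (observed ps gs))) 0)"
        by (simp add: x decide_def)
      also have "\<dots> \<le> ennreal (?d + ?u)" by (rule coin)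
      finally show ?thesis by (rule add_increasing[OF zero_le])
    next
      case False
      show ?thesis
      proof (cases "G \<le> 2 * round_pairs gs")
        case True
        then show ?thesis using False by (auto simp: x decide_def wrong_def indicator_def)
      next
        case nz: False
        have "error_bound (Phase (Suc k)) = ennreal (?d + ?u)" by simp
        then show ?thesis using False nz by (simp add: x decide_def del: error_bound.simps)
      qed
    qed
  qed
  also have "\<dots> = ennreal (measure_pmf.prob (round_sample ex k) ?W) + ennreal (?d + ?u)"
    by (simp add: nn_integral_add measure_pmf.emeasure_eq_measure)
  also have "\<dots> = ennreal (measure_pmf.prob (round_sample ex k) ?W + (?d + ?u))"
    using nn by (intro ennreal_plus[symmetric]) auto
  also have "\<dots> \<le> error_bound (Phase k)"
  proof -
    have "measure_pmf.prob (round_sample ex k) ?W + ?u \<le> error_potential (3200 / 2 ^ 24) (phase_ratio k)"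
      unfolding phase_ratio(2) using prob_round_wrong phase_ratio(1) by (intro error_potential_step) auto
    then show ?thesis unfolding error_bound.simps by (intro ennreal_leI) linarith
  qed
  finally show ?thesis .
qed

lemma prob_next_round:
  "measure_pmf.prob (round_sample ex k) {(ps, gs, bs). \<not> G \<le> 256 * hits bs \<and> \<not> G \<le> 2 * round_pairs gs}
   \<le> (if 1 \<le> phase_ratio k then 1 / 16 else 1)"
proof (cases "1 \<le> phase_ratio k")
  case True
  have "measure_pmf.prob (round_sample ex k) {(ps, gs, bs). \<not> G \<le> 256 * hits bs \<and> \<not> G \<le> 2 * round_pairs gs}
      \<le> measure_pmf.prob (round_sample ex k) (bad_round k)"
    using good_round_stops True by (intro prob_mono_support) blast
  also have "\<dots> \<le> 3200 / 2 ^ 24 / phase_ratio k" using True by (intro prob_bad_round) simp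
  also have "\<dots> \<le> 3200 / 2 ^ 24 / 1" using True by (intro divide_left_mono) auto
  finally show ?thesis using True by simp
qed simp

text \<open>
  The cost of using a vertex of degree \<open>d\<close> as hub is proportional to \<open>n / d\<close>, but by Markov's
  inequality the probability of choosing it is at most proportional to \<open>d / n\<close>.
\<close>

lemma hub_cost:
  assumes h: "h \<in> V"
  shows "(\<integral>\<^sup>+ bs. indicator {bs. G \<le> 256 * hits bs} bs * cost_bound (Coin (Some h) 0) \<partial>hub_hits ex k h)
    \<le> ennreal (46080 * real (G * 2 ^ k))"
proof -
  let ?p = "coin_prob (Some h)"
  let ?L = "2 ^ level 2 ?p :: real"
  let ?q = "measure_pmf.prob (hub_hits ex k h) {bs. G \<le> 256 * hits bs}"
  have p: "0 < ?p" "?p \<le> 1" using coin_prob_bounds[of "Some h"] h by auto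
  have "?q \<le> measure_pmf.prob (hub_hits ex k h) {bs. real G / 256 \<le> real (hits bs)}"
    by (intro prob_mono_support) auto
  also have "\<dots> \<le> real (G * 2 ^ k) * ?p / (real G / 256)"
    unfolding hub_hits_def using h G_pos by (intro coin_markov) auto
  also have "\<dots> = 256 * 2 ^ k * ?p" using G_pos by simp
  finally have q: "?q \<le> 256 * 2 ^ k * ?p" .
  have ratio: "coin_ratio (Some h) 0 \<le> 1" by (simp add: coin_ratio_def)
  have cost: "cost_potential (5 * real G * ?L) (coin_ratio (Some h) 0) \<le> 18 * (5 * real G * ?L)"
    "0 \<le> cost_potential (5 * real G * ?L) (coin_ratio (Some h) 0)"
    using ratio coin_ratio(1) by (intro cost_potential_le cost_potential_nonneg; simp)+
  have "(\<integral>\<^sup>+ bs. indicator {bs. G \<le> 256 * hits bs} bs * cost_bound (Coin (Some h) 0) \<partial>hub_hits ex k h)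
      = ennreal (?q * cost_potential (5 * real G * ?L) (coin_ratio (Some h) 0))"
    using cost(2) by (simp add: nn_integral_multc measure_pmf.emeasure_eq_measure ennreal_mult')
  also have "\<dots> \<le> ennreal (46080 * real (G * 2 ^ k))"
  proof (rule ennreal_leI)
    \<comment> \<open>The bias cancels: \<open>?L * ?p\<close> is below 2, whatever the degree of
      the hub, and 256 * 18 * 5 * 2 = 46080.\<close>
    have "?q * cost_potential (5 * real G * ?L) (coin_ratio (Some h) 0) \<le> (256 * 2 ^ k * ?p) * (18 * (5 * real G * ?L))"
      using q cost p by (intro mult_mono) auto
    also have "\<dots> = 23040 * real (G * 2 ^ k) * (?L * ?p)" by simp
    also have "\<dots> \<le> 23040 * real (G * 2 ^ k) * 2"
      using level(2)[of 2 ?p] p by (intro mult_left_mono) auto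
    finally show "?q * cost_potential (5 * real G * ?L) (coin_ratio (Some h) 0) \<le> 46080 * real (G * 2 ^ k)" by simp
  qed
  finally show ?thesis .
qed

lemma phase_round_cost:
  "ecost (phase_round ex G k) + expect_next cost_bound (\<lambda>_. 0) (phase_round ex G k) \<le> cost_bound (Phase k)"
proof -
  let ?t = "phase_ratio k" and ?s = "real (G * 2 ^ k)" and ?a = "50000 * real G * 2 ^ level 4 edge_density"
  let ?C = "{(ps, gs, bs). \<not> G \<le> 256 * hits bs \<and> \<not> G \<le> 2 * round_pairs gs}"
  let ?q = "measure_pmf.prob (round_sample ex k) ?C"
  let ?u = "cost_potential ?a (phase_ratio (Suc k))"
  let ?f = "\<lambda>x. case x of (ps, gs, bs) \<Rightarrow>
    indicator {bs. G \<le> 256 * hits bs} bs * cost_bound (Coin (Some (hub (observed ps gs))) 0)"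
  have nn: "0 \<le> ?u" using phase_ratio(1) by (intro cost_potential_nonneg) auto
  have "expect_next cost_bound (\<lambda>_. 0) (phase_round ex G k)
      = (\<integral>\<^sup>+ x. ?f x + indicator ?C x * ennreal ?u \<partial>round_sample ex k)"
    unfolding result_phase_round nn_integral_map_pmf
  proof (intro nn_integral_cong)
    fix x :: "nat list \<times> (nat list \<times> nat list) list \<times> bool list"
    obtain ps gs bs where x: "x = (ps, gs, bs)" by (cases x)
    show "case_sum cost_bound (\<lambda>_. 0) (decide k x) = ?f x + indicator ?C x * ennreal ?u"
      by (cases "G \<le> 256 * hits bs"; cases "G \<le> 2 * round_pairs gs") (simp_all add: x decide_def)
  qed
  also have "\<dots> = (\<integral>\<^sup>+ x. ?f x \<partial>round_sample ex k) + ennreal (?q * ?u)"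
    using nn by (simp add: nn_integral_add nn_integral_multc measure_pmf.emeasure_eq_measure ennreal_mult')
  also have "(\<integral>\<^sup>+ x. ?f x \<partial>round_sample ex k) \<le> ennreal (46080 * ?s)"
  proof -
    have "(\<integral>\<^sup>+ x. ?f x \<partial>round_sample ex k) = (\<integral>\<^sup>+ y. (case y of (ps, gs) \<Rightarrow>
        \<integral>\<^sup>+ bs. indicator {bs. G \<le> 256 * hits bs} bs * cost_bound (Coin (Some (hub (observed ps gs))) 0)
          \<partial>hub_hits ex k (hub (observed ps gs))) \<partial>round_vertices k)"
      by (simp add: round_sample_def case_prod_unfold)
    also have "\<dots> \<le> (\<integral>\<^sup>+ y. ennreal (46080 * ?s) \<partial>round_vertices k)"
    proof (intro nn_integral_mono_AE AE_pmfI)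
      fix y assume y: "y \<in> set_pmf (round_vertices k)"
      obtain ps gs where "y = (ps, gs)" by (cases y)
      then show "(case y of (ps, gs) \<Rightarrow>
        \<integral>\<^sup>+ bs. indicator {bs. G \<le> 256 * hits bs} bs * cost_bound (Coin (Some (hub (observed ps gs))) 0)
          \<partial>hub_hits ex k (hub (observed ps gs))) \<le> ennreal (46080 * ?s)"
        using hub_cost[OF hub_in_V, of ps gs k ex k] y by (simp del: cost_bound.simps)
    qed
    finally show ?thesis by simp
  qed
  finally have "ecost (phase_round ex G k) + expect_next cost_bound (\<lambda>_. 0) (phase_round ex G k)
      \<le> ennreal (?s * (15 + 16 * ?t\<^sup>2)) + (ennreal (46080 * ?s) + ennreal (?q * ?u))"
    by (intro add_mono[OF ecost_phase_round(2)]) (simp add: add_right_mono)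
  also have "\<dots> = ennreal (?s * (15 + 16 * ?t\<^sup>2) + (46080 * ?s + ?q * ?u))"
  proof -
    have "0 \<le> ?s * (15 + 16 * ?t\<^sup>2)" "0 \<le> 46080 * ?s" "0 \<le> ?q * ?u" using nn by auto
    then show ?thesis by (simp only: ennreal_plus add_nonneg_nonneg)
  qed
  also have "?s * (15 + 16 * ?t\<^sup>2) + (46080 * ?s + ?q * ?u) = ?s * (46095 + 16 * ?t\<^sup>2) + ?q * ?u"
    by (simp add: distrib_left)
  also have "\<dots> \<le> cost_bound (Phase k)"
    unfolding cost_bound.simps phase_ratio(2)
  proof (intro ennreal_leI cost_potential_step phase_ratio(1) prob_next_round)
    \<comment> \<open>The constant 46095 is 15 for the queries of the round plus 46080 for a
      possible commitment. Below ratio 1 the quadratic term is at most 16.\<close>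
    have "46095 + 16 * ?t\<^sup>2 \<le> 50000 * (1 + (if 1 \<le> ?t then ?t\<^sup>2 - 1 else 0))"
    proof (cases "1 \<le> ?t")
      case True
      then have "1 \<le> ?t\<^sup>2" by (rule one_le_power)
      moreover have "46095 + 16 * x \<le> 50000 * (1 + (x - 1))" if "1 \<le> x" for x :: real
        using that by simp
      ultimately show ?thesis unfolding if_P[OF True] by blast
    next
      case False
      then have "?t\<^sup>2 \<le> 1" using phase_ratio(1)[of k] by (intro power_le_one) auto
      then show ?thesis using False by simp
    qed
    then have "?s * (46095 + 16 * ?t\<^sup>2) \<le> ?s * (50000 * (1 + (if 1 \<le> ?t then ?t\<^sup>2 - 1 else 0)))"
      by (rule mult_left_mono) simp
    also have "\<dots> = ?a * ?t * (1 + (if 1 \<le> ?t then ?t\<^sup>2 - 1 else 0))" by (simp add: phase_ratio_def)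
    finally show "?s * (46095 + 16 * ?t\<^sup>2) \<le> ?a * ?t * (1 + (if 1 \<le> ?t then ?t\<^sup>2 - 1 else 0))" .
  qed auto
  finally show ?thesis .
qed

end

section \<open>The complete estimator: invariant, error and cost\<close>

definition round_step :: "extra_oracle \<Rightarrow> nat \<Rightarrow> state \<Rightarrow> (state + estimate) prog" where
  "round_step ex G s = (case s of Coin c j \<Rightarrow> coin_round ex G c j | Phase k \<Rightarrow> phase_round ex G k)"

definition first_round :: "extra_oracle \<Rightarrow> state" where
  "first_round ex = (case ex of Pair_Oracle \<Rightarrow> Coin None 0 | Additive_Oracle \<Rightarrow> Phase 0)"

definition group_number :: "real \<Rightarrow> nat" where
  "group_number \<epsilon> = nat \<lceil>2 ^ 24 / \<epsilon>\<^sup>2\<rceil>"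

definition estimator :: "extra_oracle \<Rightarrow> real \<Rightarrow> estimate alg" where
  "estimator ex \<epsilon> = loop (round_step ex (group_number \<epsilon>)) (Ret (Inl (first_round ex)))"

context estimation
begin

text \<open>The loop invariant: a hub stays a known vertex, and phases, which issue additive
  queries, occur only with that oracle.\<close>

definition reachable :: "extra_oracle \<Rightarrow> nat set \<Rightarrow> state \<Rightarrow> bool" where
  "reachable ex K s = (case s of
     Coin c j \<Rightarrow> (\<forall>h. c = Some h \<longrightarrow> h \<in> K \<and> h \<in> V) | Phase k \<Rightarrow> ex = Additive_Oracle)"

lemma reachable_first: "reachable ex {} (first_round ex)"
  by (cases ex) (simp_all add: reachable_def first_round_def)

lemma reachable_step:
  assumes "reachable ex K s"
  shows "loop_ok ex (reachable ex) K (round_step ex G s)"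
proof (cases s)
  case (Coin c j)
  then have c: "\<forall>h. c = Some h \<longrightarrow> h \<in> K \<and> h \<in> V" using assms by (simp add: reachable_def)
  show ?thesis unfolding round_step_def Coin state.case
  proof (rule ok_mono[OF ok_coin_round])
    fix K' r assume "K \<subseteq> K'" "r = Inl (Coin c (Suc j)) \<or> isl r = False"
    moreover have "\<forall>h. c = Some h \<longrightarrow> h \<in> K' \<and> h \<in> V" using c \<open>K \<subseteq> K'\<close> by blast
    ultimately show "case_sum (reachable ex K') (\<lambda>_. True) r" by (cases r) (auto simp: reachable_def)
  qed (use c in blast)
next
  case (Phase k)
  then have ex: "ex = Additive_Oracle" using assms by (simp add: reachable_def)
  show ?thesis unfolding round_step_def Phase state.case ex
    by (rule ok_mono[OF ok_phase_round]) (auto simp: reachable_def split: sum.splits state.splits)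
qed

lemma step_cost:
  assumes "reachable ex K s"
  shows "ecost (round_step ex G s) + expect_next cost_bound (\<lambda>_. 0) (round_step ex G s) \<le> cost_bound s"
  using assms coin_round_cost phase_round_cost by (cases s) (auto simp: round_step_def reachable_def)

lemma step_error:
  assumes "reachable ex K s"
  shows "expect_next error_bound wrong (round_step ex G s) \<le> error_bound s"
  using assms coin_round_error phase_round_error by (cases s) (auto simp: round_step_def reachable_def)

lemma step_ecost_ge: "1 \<le> ecost (round_step ex G s)"
  using ecost_coin_round(1) ecost_phase_round(1) by (cases s) (auto simp: round_step_def)

abbreviation run_estimator :: "extra_oracle \<Rightarrow> (estimate \<times> nat) spmf" where
  "run_estimator ex \<equiv> run ex V E {} (loop (round_step ex G) (Ret (Inl (first_round ex))))"

lemma estimator_lossless: "lossless_spmf (run_estimator ex)"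
proof (rule run_loop_lossless[OF reachable_step step_cost step_ecost_ge reachable_first])
  show "cost_bound (first_round ex) < \<top>" by (cases ex) (simp_all add: first_round_def)
qed

lemma estimator_cost: "(\<integral>\<^sup>+ (r, c). of_nat c \<partial>measure_spmf (run_estimator ex)) \<le> cost_bound (first_round ex)"
proof -
  have "(\<integral>\<^sup>+ x. (case x of (r, c) \<Rightarrow> 1 * of_nat c + (\<lambda>_. 0) r) \<partial>measure_spmf (run_estimator ex))
      \<le> 1 * ecost (Ret (Inl (first_round ex)) :: (state + estimate) prog)
        + expect_next cost_bound (\<lambda>_. 0) (Ret (Inl (first_round ex)) :: (state + estimate) prog)"
    by (rule run_loop_le[OF reachable_step]) (use step_cost reachable_first in auto)
  then show ?thesis by simp
qed

text \<open>Undersized rounds contribute 1/16 once for the phases and once for the coin; 256 * 3200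
  / 2^24 is below 1/20 and the remaining term is negligible.\<close>

lemma error_bound_first: "error_bound (first_round ex) \<le> ennreal (1 / 4)"
proof (cases ex)
  case Pair_Oracle
  have "error_potential (1 / 2 ^ 22) (coin_ratio None 0) \<le> 1 / 16 + 256 * (1 / 2 ^ 22)"
    using coin_ratio(1) by (intro error_potential_le) auto
  also have "\<dots> \<le> 1 / 4" by simp
  finally show ?thesis unfolding first_round_def Pair_Oracle extra_oracle.case error_bound.simps by (rule ennreal_leI)
next
  case Additive_Oracle
  have "error_potential (3200 / 2 ^ 24) (phase_ratio 0) \<le> 1 / 16 + 256 * (3200 / 2 ^ 24)"
    using phase_ratio(1) by (intro error_potential_le) auto
  then have "1 / 16 + 256 / 2 ^ 22 + error_potential (3200 / 2 ^ 24) (phase_ratio 0) \<le> 1 / 4" by simp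
  then show ?thesis unfolding first_round_def Additive_Oracle extra_oracle.case error_bound.simps by (rule ennreal_leI)
qed

text \<open>The loop rule bounds only the mass of wrong outputs; losslessness turns this into a
  lower bound for the correct ones.\<close>

lemma estimator_correct:
  "3 / 4 \<le> measure (measure_spmf (run_estimator ex)) {(r, c). r \<in> correct_estimates \<epsilon> V E}"
proof -
  let ?M = "measure_spmf (run_estimator ex)" and ?A = "{(r, c :: nat). r \<in> correct_estimates \<epsilon> V E}"
  have "emeasure ?M (- ?A) = (\<integral>\<^sup>+ x. indicator (- ?A) x \<partial>?M)" by simp
  also have "\<dots> = (\<integral>\<^sup>+ x. (case x of (r, c) \<Rightarrow> 0 * of_nat c + wrong r) \<partial>?M)"
    by (intro nn_integral_cong) (auto simp: wrong_def indicator_def)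
  also have "\<dots> \<le> 0 * ecost (Ret (Inl (first_round ex)) :: (state + estimate) prog)
        + expect_next error_bound wrong (Ret (Inl (first_round ex)) :: (state + estimate) prog)"
    by (rule run_loop_le[OF reachable_step]) (use step_error reachable_first in auto)
  also have "\<dots> \<le> ennreal (1 / 4)" using error_bound_first by simp
  finally have "measure ?M (- ?A) \<le> 1 / 4"
    by (simp add: measure_spmf.emeasure_eq_measure)
  moreover have "measure ?M UNIV = 1"
    using estimator_lossless by (simp add: lossless_spmf_def weight_spmf_def space_measure_spmf)
  moreover have "measure ?M (UNIV - ?A) = measure ?M UNIV - measure ?M ?A"
    by (rule measure_spmf.finite_measure_Diff) auto
  ultimately show ?thesis by (simp add: Compl_eq_Diff_UNIV)
qed

lemma cost_bound_pair: "cost_bound (first_round Pair_Oracle) \<le> ennreal (180 * real G * (1 / edge_density))"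
proof -
  have p: "0 < edge_density" "edge_density \<le> 1" by (rule edge_density_pos edge_density_le_1)+
  let ?L = "2 ^ level 2 edge_density :: real"
  have "?L \<le> 2 * (1 / edge_density)" using level(2)[of 2 edge_density] p by (simp add: field_simps)
  have "cost_potential (5 * real G * ?L) (coin_ratio None 0) \<le> 18 * (5 * real G * ?L)"
    using coin_ratio(1) by (intro cost_potential_le) (auto simp: coin_ratio_def)
  also have "\<dots> = 90 * real G * ?L" by simp
  also have "\<dots> \<le> 90 * real G * (2 * (1 / edge_density))" by (rule mult_left_mono) (fact, simp)
  finally show ?thesis by (simp add: first_round_def coin_prob_def ennreal_leI)
qed

text \<open>The square root of n / d appears here: the square of
  \<open>2 ^ level 4 edge_density\<close> is below 4 / p.\<close>

lemma cost_bound_additive: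
  "cost_bound (first_round Additive_Oracle) \<le> ennreal (1800000 * real G * sqrt (1 / edge_density))"
proof -
  let ?L = "2 ^ level 4 edge_density :: real"
  have "?L\<^sup>2 = 4 ^ level 4 edge_density" by (simp add: power2_eq_square flip: power_mult_distrib)
  then have "?L\<^sup>2 \<le> 4 * (1 / edge_density)"
    using level_edge_density(2) edge_density_pos by (simp add: field_simps)
  then have "sqrt (?L\<^sup>2) \<le> sqrt (4 * (1 / edge_density))" by (rule real_sqrt_le_mono)
  then have L: "?L \<le> 2 * sqrt (1 / edge_density)"
    by (simp only: real_sqrt_mult real_sqrt_four real_sqrt_abs)
  have "cost_potential (50000 * real G * ?L) (phase_ratio 0) \<le> 18 * (50000 * real G * ?L)"
    using phase_ratio(1) by (intro cost_potential_le) (auto simp: phase_ratio_def)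
  also have "\<dots> = 900000 * real G * ?L" by simp
  also have "\<dots> \<le> 900000 * real G * (2 * sqrt (1 / edge_density))" using L by (rule mult_left_mono) simp
  finally show ?thesis by (simp add: first_round_def ennreal_leI)
qed

end

lemma group_number:
  assumes "0 < \<epsilon>" "\<epsilon> < 1"
  shows "2 ^ 24 \<le> \<epsilon>\<^sup>2 * real (group_number \<epsilon>)" "real (group_number \<epsilon>) \<le> (2 ^ 24 + 1) * (1 / \<epsilon>\<^sup>2)"
proof -
  have e: "0 < \<epsilon>\<^sup>2" "\<epsilon>\<^sup>2 \<le> 1" using assms by (auto intro: power_le_one)
  have G: "real (group_number \<epsilon>) = real_of_int \<lceil>2 ^ 24 / \<epsilon>\<^sup>2\<rceil>"
    unfolding group_number_def using e by (intro of_nat_nat) (simp add: le_ceiling_iff less_le_trans[of _ 0])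
  have "2 ^ 24 / \<epsilon>\<^sup>2 \<le> real (group_number \<epsilon>)" unfolding G by (rule le_of_int_ceiling)
  then show "2 ^ 24 \<le> \<epsilon>\<^sup>2 * real (group_number \<epsilon>)" using e by (simp add: field_simps)
  have "real (group_number \<epsilon>) \<le> 2 ^ 24 / \<epsilon>\<^sup>2 + 1" unfolding G by linarith
  \<comment> \<open>Absorbs the rounding up of G into the factor 1 / \<epsilon>^2.\<close>
  also have "1 \<le> 1 / \<epsilon>\<^sup>2" using e by simp
  finally show "real (group_number \<epsilon>) \<le> (2 ^ 24 + 1) * (1 / \<epsilon>\<^sup>2)" by (simp add: distrib_right)
qed

theorem theorem4p5:
  "\<exists>(p :: real) (C :: real) (A :: extra_oracle \<Rightarrow> real \<Rightarrow> estimate alg).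
     p > 1 / 2 \<and>
     (\<forall>(\<epsilon> :: real) V E. 0 < \<epsilon> \<longrightarrow> \<epsilon> < 1 \<longrightarrow> simple_graph V E \<longrightarrow> no_isolated_vertices V E \<longrightarrow>
        (\<forall>ex. lossless_spmf (execute ex V E (A ex \<epsilon>)) \<and>
              output_prob ex V E (A ex \<epsilon>) (correct_estimates \<epsilon> V E) \<ge> p) \<and>
        expected_queries Pair_Oracle V E (A Pair_Oracle \<epsilon>)
          \<le> ennreal (C * (1 / \<epsilon>\<^sup>2) * (real (card V) / avg_degree V E)) \<and>
        expected_queries Additive_Oracle V E (A Additive_Oracle \<epsilon>)
          \<le> ennreal (C * (1 / \<epsilon>\<^sup>2) * sqrt (real (card V) / avg_degree V E)))"
proof (rule exI[of _ "3 / 4"], rule exI[of _ "1800000 * (2 ^ 24 + 1)"], rule exI[of _ estimator],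
    intro conjI allI impI)
  fix \<epsilon> :: real and V E
  assume \<epsilon>: "0 < \<epsilon>" "\<epsilon> < 1" and graph: "simple_graph V E" "no_isolated_vertices V E"
  interpret estimation V E \<epsilon> "group_number \<epsilon>"
    using \<epsilon> graph group_number(1)[OF \<epsilon>]
    by (simp add: estimation_def graph_def graph_axioms_def estimation_axioms_def)
  note G = group_number(2)[OF \<epsilon>]
  let ?G = "real (group_number \<epsilon>)" and ?C = "1800000 * (2 ^ 24 + 1) :: real"
  show "lossless_spmf (execute ex V E (estimator ex \<epsilon>))" for ex
    using estimator_lossless by (simp add: execute_def estimator_def)
  show "3 / 4 \<le> output_prob ex V E (estimator ex \<epsilon>) (correct_estimates \<epsilon> V E)" for ex
    using estimator_correct by (simp add: output_prob_def execute_def estimator_def)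
  have cost: "expected_queries ex V E (estimator ex \<epsilon>) \<le> cost_bound (first_round ex)" for ex
    using estimator_cost by (simp add: expected_queries_def execute_def estimator_def)
  show "expected_queries Pair_Oracle V E (estimator Pair_Oracle \<epsilon>)
      \<le> ennreal (?C * (1 / \<epsilon>\<^sup>2) * (real (card V) / avg_degree V E))"
  proof (rule order_trans[OF cost order_trans[OF cost_bound_pair]], rule ennreal_leI)
    have "180 * ?G * (1 / edge_density) \<le> 180 * ((2 ^ 24 + 1) * (1 / \<epsilon>\<^sup>2)) * (1 / edge_density)"
      using G edge_density_pos by (intro mult_right_mono mult_left_mono) auto
    also have "\<dots> \<le> ?C * (1 / \<epsilon>\<^sup>2) * (1 / edge_density)"
      using edge_density_pos \<epsilon> by (intro mult_right_mono) (auto simp: divide_right_mono)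
    finally show "180 * ?G * (1 / edge_density) \<le> ?C * (1 / \<epsilon>\<^sup>2) * (real (card V) / avg_degree V E)"
      unfolding inverse_edge_density .
  qed
  show "expected_queries Additive_Oracle V E (estimator Additive_Oracle \<epsilon>)
      \<le> ennreal (?C * (1 / \<epsilon>\<^sup>2) * sqrt (real (card V) / avg_degree V E))"
  proof (rule order_trans[OF cost order_trans[OF cost_bound_additive]], rule ennreal_leI)
    have "1800000 * ?G * sqrt (1 / edge_density) \<le> 1800000 * ((2 ^ 24 + 1) * (1 / \<epsilon>\<^sup>2)) * sqrt (1 / edge_density)"
      using G edge_density_pos by (intro mult_right_mono mult_left_mono) auto
    then show "1800000 * ?G * sqrt (1 / edge_density) \<le> ?C * (1 / \<epsilon>\<^sup>2) * sqrt (real (card V) / avg_degree V E)"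
      unfolding inverse_edge_density by (simp only: mult.assoc)
  qed
qed simp

end
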